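(* Let $L$ be a countable language, let $\square$ be an operation on $L$-structures and $\mathcal{C}$ a class of $L$-structures such that $(\square,\mathcal{C})$ is a perfect pair (written $\mathrm{Perf}(\square,\mathcal{C})$; see context). Let $n\geq 1$, let $\mathbb{X}:=\square_{i<n}\mathbb{X}_i$, where $\mathbb{X}_i\in\mathcal{C}$ for $i<n$, let $\mathcal{T}:=\mathrm{Th}(\mathbb{X})$ and $\mathcal{T}_i:=\mathrm{Th}(\mathbb{X}_i)$ for $i<n$. Then: (a) $\max\{I(\mathcal{T}_i):i<n\}\leq I(\mathcal{T})\leq\prod_{i<n}I(\mathcal{T}_i)$; thus, $I(\mathcal{T})=1$ if and only if $I(\mathcal{T}_i)=1$ for each $i<n$. (b) If the theories $\mathcal{T}_i$, $i<n$, satisfy Vaught's conjecture, then $\mathcal{T}$ satisfies Vaught's conjecture: defining $\kappa:=\prod_{i<n}I(\mathcal{T}_i)$, we have $I(\mathcal{T})=\kappa$ if $\kappa\in\{1,\omega,\mathfrak{c}\}$, and $I(\mathcal{T})\in[3,\omega)$ otherwise. (c) $\mathcal{T}$ is atomic if and only if the theories $\mathcal{T}_i$, $i<n$, are atomic; in that case $\square_{i<n}\mathbb{X}_i^{\rm at}$ is a countable atomic model of $\mathcal{T}$, where $\mathbb{X}_i^{\rm at}$ is a countable atomic model of $\mathcal{T}_i$, for $i<n$. (d) If, in addition, $\mathrm{Perf}_s(\square,\mathcal{C})$ holds (see context), then $\mathcal{T}$ is small if and only if the theories $\mathcal{T}_i$, $i<n$, are small; in that case $\square_{i<n}\mathbb{X}_i^{\rm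 sat}$ is a countably saturated model of $\mathcal{T}$, where $\mathbb{X}_i^{\rm sat}$ is a countably saturated model of $\mathcal{T}_i$, for $i<n$.
   Context: Perfect pairs. Let $L$ be a countable language and let $\square$ be an operation which, for each $n\geq 1$, assigns to each $n$-tuple $\langle\mathbb{X}_0,\dots,\mathbb{X}_{n-1}\rangle$ of $L$-structures an $L$-structure $\square_{i<n}\mathbb{X}_i$ such that $$\min\Big\{\sum_{i<n}|X_i|,\prod_{i<n}|X_i|\Big\}\leq|\square_{i<n}\mathbb{X}_i|\leq\max\Big\{\sum_{i<n}|X_i|,\prod_{i<n}|X_i|\Big\}.$$ Let $\mathcal{C}$ be a class of $L$-structures closed under elementary equivalence $\equiv$. The pair $(\square,\mathcal{C})$ is a perfect pair, written $\mathrm{Perf}(\square,\mathcal{C})$, iff whenever $\mathbb{X}_i,\mathbb{Y}_i\in\mathcal{C}$ for $i<\omega$, $m,n\geq 1$, and $\mathbb{Y},\mathbb{E}$ are $L$-structures, we have: (i) $\square_{i<n}\mathbb{X}_i\cong\square_{i<m}\mathbb{Y}_i$ iff $m=n$ and there is a permutation $\pi\in\mathrm{Sym}(n)$ such that $\mathbb{X}_i\cong\mathbb{Y}_{\pi(i)}$ for all $i<n$; (ii) $\mathbb{Y}\equiv\square_{i<n}\mathbb{X}_i$ iff $\mathbb{Y}\cong\square_{i<n}\mathbb{Z}_i$ for some $\mathbb{Z}_i$ with $\mathbb{Z}_i\equiv\mathbb{X}_i$, $i<n$; (iii) $\mathbb{E}\preccurlyeq\square_{i<n}\mathbb{X}_i$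 iff $\mathbb{E}=\square_{i<n}\mathbb{E}_i$ for some $\mathbb{E}_i$ with $\mathbb{E}_i\preccurlyeq\mathbb{X}_i$, $i<n$ ($\preccurlyeq$ denotes elementary substructure). We write $\mathrm{Perf}_s(\square,\mathcal{C})$ iff, in addition, whenever $n\geq 1$, $\mathbb{X}_i\in\mathcal{C}$ for $i<n$, and $\kappa$ is a cardinal: if all $\mathbb{X}_i$, $i<n$, are $\kappa$-saturated, then $\square_{i<n}\mathbb{X}_i$ is $\kappa$-saturated. A structure $\mathbb{X}$ is $\kappa$-saturated iff for each $A\subseteq X$ with $|A|<\kappa$ the expansion $\mathbb{X}_A$ of $\mathbb{X}$ by constants for the elements of $A$ realizes each 1-type consistent with $\mathrm{Th}(\mathbb{X}_A)$. "Countable" means of cardinality at most $\omega$. For a complete $L$-theory $\mathcal{T}$, $I(\mathcal{T})$ is the number of isomorphism types of models of $\mathcal{T}$ of cardinality $\omega$; if $\mathcal{T}$ has a finite model, $I(\mathcal{T}):=1$. $\mathfrak{c}=2^{\omega}$. $\mathcal{T}$ satisfies Vaught's conjecture iff $I(\mathcal{T})\leq\omega$ or $I(\mathcal{T})=\mathfrak{c}$. A formula $\varphi(\bar v)$ is complete in $\mathcal{T}$ iff it is consistent with $\mathcal{T}$ and for each formula $\psi(\bar v)$ we have $\mathcal{T}\vdash\varphi\rightarrow\psi$ or $\mathcal{T}\vdash\varphi\rightarrow\neg\psi$; a formula is completable in $\mathcal{T}$ iff it is implied, modulo $\mathcal{T}$, by a complete formula. $\mathcal{T}$ is atomic iff each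 formula consistent with $\mathcal{T}$ is completable in $\mathcal{T}$. A model is atomic iff each finite tuple of its elements satisfies a complete formula of its theory. $\mathcal{T}$ is small iff $|\bigcup_{n\in\omega}S_n(\mathcal{T})|\leq\omega$. A model is countably saturated iff it is countable and $\omega$-saturated. *)

theory Defs
  imports
    "HOL-Library.FuncSet"
    "HOL-Library.Countable_Set"
    "HOL-Combinatorics.Permutations"
begin

unbundle cardinal_syntax

text \<open>
  The L-structures under consideration are those whose domain is a subset of a fixed but arbitrary
  type \<open>'u\<close>, which plays the role of the universe of sets. Notions that quantify over all
  structures without having one as an argument take the universe as an argument of type
  \<open>'u itself\<close>. Nothing is assumed about \<open>'u\<close>: if it is infinite and the language is countable
  then, by Loewenheim-Skolem, consequence, consistency and the number of countable models
  do not depend on \<open>'u\<close>; if it is finite, a theory with a model in \<open>'u\<close> has a finite model.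
\<close>


section \<open>First-order languages and structures\<close>

record ('f, 'r) lang =
  funs :: "'f set"
  rels :: "'r set"
  far :: "'f \<Rightarrow> nat"
  rar :: "'r \<Rightarrow> nat"

definition countable_lang :: "('f, 'r) lang \<Rightarrow> bool" where
  "countable_lang L \<longleftrightarrow> countable (funs L) \<and> countable (rels L)"

record ('f, 'r, 'u) struct =
  univ :: "'u set"
  fint :: "'f \<Rightarrow> 'u list \<Rightarrow> 'u"
  rint :: "'r \<Rightarrow> 'u list set"

definition tuples :: "'u set \<Rightarrow> nat \<Rightarrow> 'u list set" where
  "tuples A k = {xs. length xs = k \<and> set xs \<subseteq> A}"

text \<open>
  Interpretations are extensional (fixed outside the language and outside the domain), so that
  equality of records is equality of L-structures.
\<close>

definition is_struct :: "('f, 'r) lang \<Rightarrow> ('f, 'r, 'u) struct \<Rightarrow> bool" where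
  "is_struct L M \<longleftrightarrow>
     univ M \<noteq> {} \<and>
     fint M \<in> (\<Pi>\<^sub>E f\<in>funs L. tuples (univ M) (far L f) \<rightarrow>\<^sub>E univ M) \<and>
     rint M \<in> (\<Pi>\<^sub>E r\<in>rels L. Pow (tuples (univ M) (rar L r)))"

definition iso :: "('f, 'r) lang \<Rightarrow> ('f, 'r, 'u) struct \<Rightarrow> ('f, 'r, 'u) struct \<Rightarrow> bool" where
  "iso L M N \<longleftrightarrow> is_struct L M \<and> is_struct L N \<and>
     (\<exists>h. bij_betw h (univ M) (univ N) \<and>
        (\<forall>f\<in>funs L. \<forall>xs\<in>tuples (univ M) (far L f). h (fint M f xs) = fint N f (map h xs)) \<and>
        (\<forall>r\<in>rels L. \<forall>xs\<in>tuples (univ M) (rar L r). xs \<in> rint M r \<longleftrightarrow> map h xs \<in> rint N r))"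

definition substruct :: "('f, 'r) lang \<Rightarrow> ('f, 'r, 'u) struct \<Rightarrow> ('f, 'r, 'u) struct \<Rightarrow> bool" where
  "substruct L E M \<longleftrightarrow> is_struct L E \<and> is_struct L M \<and> univ E \<subseteq> univ M \<and>
     (\<forall>f\<in>funs L. \<forall>xs\<in>tuples (univ E) (far L f). fint E f xs = fint M f xs) \<and>
     (\<forall>r\<in>rels L. rint E r = rint M r \<inter> tuples (univ E) (rar L r))"


section \<open>Formulas and satisfaction\<close>

datatype 'f trm = Var nat | Fun 'f "'f trm list"

datatype ('f, 'r) fm =
    Eq "'f trm" "'f trm"
  | Rel 'r "'f trm list"
  | Neg "('f, 'r) fm"
  | Imp "('f, 'r) fm" "('f, 'r) fm"
  | All nat "('f, 'r) fm"

fun wf_trm :: "('f, 'r) lang \<Rightarrow> 'f trm \<Rightarrow> bool" where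
  "wf_trm L (Var x) \<longleftrightarrow> True"
| "wf_trm L (Fun f ts) \<longleftrightarrow> f \<in> funs L \<and> length ts = far L f \<and> (\<forall>t\<in>set ts. wf_trm L t)"

primrec wf_fm :: "('f, 'r) lang \<Rightarrow> ('f, 'r) fm \<Rightarrow> bool" where
  "wf_fm L (Eq t u) \<longleftrightarrow> wf_trm L t \<and> wf_trm L u"
| "wf_fm L (Rel r ts) \<longleftrightarrow> r \<in> rels L \<and> length ts = rar L r \<and> (\<forall>t\<in>set ts. wf_trm L t)"
| "wf_fm L (Neg \<phi>) \<longleftrightarrow> wf_fm L \<phi>"
| "wf_fm L (Imp \<phi> \<psi>) \<longleftrightarrow> wf_fm L \<phi> \<and> wf_fm L \<psi>"
| "wf_fm L (All x \<phi>) \<longleftrightarrow> wf_fm L \<phi>"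

fun fv_trm :: "'f trm \<Rightarrow> nat set" where
  "fv_trm (Var x) = {x}"
| "fv_trm (Fun f ts) = (\<Union>t\<in>set ts. fv_trm t)"

primrec fv :: "('f, 'r) fm \<Rightarrow> nat set" where
  "fv (Eq t u) = fv_trm t \<union> fv_trm u"
| "fv (Rel r ts) = (\<Union>t\<in>set ts. fv_trm t)"
| "fv (Neg \<phi>) = fv \<phi>"
| "fv (Imp \<phi> \<psi>) = fv \<phi> \<union> fv \<psi>"
| "fv (All x \<phi>) = fv \<phi> - {x}"

text \<open>The formulas in the variables \<open>v\<^sub>0, \<dots>, v\<^sub>k\<^sub>-\<^sub>1\<close>; \<open>formulas L 0\<close> is the set of sentences.\<close>

definition formulas :: "('f, 'r) lang \<Rightarrow> nat \<Rightarrow> ('f, 'r) fm set" where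
  "formulas L k = {\<phi>. wf_fm L \<phi> \<and> fv \<phi> \<subseteq> {..<k}}"

primrec val :: "('f, 'r, 'u) struct \<Rightarrow> (nat \<Rightarrow> 'u) \<Rightarrow> 'f trm \<Rightarrow> 'u" where
  "val M s (Var x) = s x"
| "val M s (Fun f ts) = fint M f (map (val M s) ts)"

primrec sat :: "('f, 'r, 'u) struct \<Rightarrow> (nat \<Rightarrow> 'u) \<Rightarrow> ('f, 'r) fm \<Rightarrow> bool" where
  "sat M s (Eq t u) \<longleftrightarrow> val M s t = val M s u"
| "sat M s (Rel r ts) \<longleftrightarrow> map (val M s) ts \<in> rint M r"
| "sat M s (Neg \<phi>) \<longleftrightarrow> \<not> sat M s \<phi>"
| "sat M s (Imp \<phi> \<psi>) \<longleftrightarrow> (sat M s \<phi> \<longrightarrow> sat M s \<psi>)"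
| "sat M s (All x \<phi>) \<longleftrightarrow> (\<forall>a\<in>univ M. sat M (s(x := a)) \<phi>)"

text \<open>
  A \<open>k\<close>-tuple of elements is represented by the first \<open>k\<close> values of an assignment; only these
  matter for the satisfaction of members of \<open>formulas L k\<close>.
\<close>

definition assignments :: "('f, 'r, 'u) struct \<Rightarrow> (nat \<Rightarrow> 'u) set" where
  "assignments M = {s. range s \<subseteq> univ M}"

definition Th :: "('f, 'r) lang \<Rightarrow> ('f, 'r, 'u) struct \<Rightarrow> ('f, 'r) fm set" where
  "Th L M = {\<phi> \<in> formulas L 0. \<forall>s\<in>assignments M. sat M s \<phi>}"

definition model :: "('f, 'r) lang \<Rightarrow> ('f, 'r) fm set \<Rightarrow> ('f, 'r, 'u) struct \<Rightarrow> bool" where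
  "model L T M \<longleftrightarrow> is_struct L M \<and> (\<forall>\<phi>\<in>T. \<forall>s\<in>assignments M. sat M s \<phi>)"

definition elem_equiv :: "('f, 'r) lang \<Rightarrow> ('f, 'r, 'u) struct \<Rightarrow> ('f, 'r, 'u) struct \<Rightarrow> bool" where
  "elem_equiv L M N \<longleftrightarrow> is_struct L M \<and> is_struct L N \<and> Th L M = Th L N"

definition elem_sub :: "('f, 'r) lang \<Rightarrow> ('f, 'r, 'u) struct \<Rightarrow> ('f, 'r, 'u) struct \<Rightarrow> bool" where
  "elem_sub L E M \<longleftrightarrow> substruct L E M \<and>
     (\<forall>\<phi>. wf_fm L \<phi> \<longrightarrow> (\<forall>s\<in>assignments E. sat E s \<phi> \<longleftrightarrow> sat M s \<phi>))"


section \<open>Consequence, types, atomic and small theories\<close>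

text \<open>\<open>T \<turnstile> \<phi>\<close>, read semantically; free variables are universally quantified.\<close>

definition entails :: "'u itself \<Rightarrow> ('f, 'r) lang \<Rightarrow> ('f, 'r) fm set \<Rightarrow> ('f, 'r) fm \<Rightarrow> bool" where
  "entails U L T \<phi> \<longleftrightarrow>
     (\<forall>N :: ('f, 'r, 'u) struct. model L T N \<longrightarrow> (\<forall>s\<in>assignments N. sat N s \<phi>))"

definition realizes :: "('f, 'r, 'u) struct \<Rightarrow> ('f, 'r) fm set \<Rightarrow> bool" where
  "realizes M p \<longleftrightarrow> (\<exists>s\<in>assignments M. \<forall>\<phi>\<in>p. sat M s \<phi>)"

definition consistent_with :: "'u itself \<Rightarrow> ('f, 'r) lang \<Rightarrow> ('f, 'r) fm set \<Rightarrow> ('f, 'r) fm set \<Rightarrow> bool" where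
  "consistent_with U L T p \<longleftrightarrow> (\<exists>N :: ('f, 'r, 'u) struct. model L T N \<and> realizes N p)"

definition complete_fm :: "'u itself \<Rightarrow> ('f, 'r) lang \<Rightarrow> ('f, 'r) fm set \<Rightarrow> nat \<Rightarrow> ('f, 'r) fm \<Rightarrow> bool" where
  "complete_fm U L T k \<phi> \<longleftrightarrow> \<phi> \<in> formulas L k \<and> consistent_with U L T {\<phi>} \<and>
     (\<forall>\<psi>\<in>formulas L k. entails U L T (Imp \<phi> \<psi>) \<or> entails U L T (Imp \<phi> (Neg \<psi>)))"

definition completable_fm :: "'u itself \<Rightarrow> ('f, 'r) lang \<Rightarrow> ('f, 'r) fm set \<Rightarrow> nat \<Rightarrow> ('f, 'r) fm \<Rightarrow> bool" where
  "completable_fm U L T k \<phi> \<longleftrightarrow> (\<exists>\<chi>. complete_fm U L T k \<chi> \<and> entails U L T (Imp \<chi> \<phi>))"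

definition atomic_theory :: "'u itself \<Rightarrow> ('f, 'r) lang \<Rightarrow> ('f, 'r) fm set \<Rightarrow> bool" where
  "atomic_theory U L T \<longleftrightarrow>
     (\<forall>k. \<forall>\<phi>\<in>formulas L k. consistent_with U L T {\<phi>} \<longrightarrow> completable_fm U L T k \<phi>)"

definition atomic_struct :: "('f, 'r) lang \<Rightarrow> ('f, 'r, 'u) struct \<Rightarrow> bool" where
  "atomic_struct L M \<longleftrightarrow>
     (\<forall>k. \<forall>s\<in>assignments M. \<exists>\<phi>. complete_fm TYPE('u) L (Th L M) k \<phi> \<and> sat M s \<phi>)"

definition complete_types :: "'u itself \<Rightarrow> ('f, 'r) lang \<Rightarrow> ('f, 'r) fm set \<Rightarrow> nat \<Rightarrow> ('f, 'r) fm set set" where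
  "complete_types U L T k =
     {p. p \<subseteq> formulas L k \<and> consistent_with U L T p \<and> (\<forall>\<phi>\<in>formulas L k. \<phi> \<in> p \<or> Neg \<phi> \<in> p)}"

definition small_theory :: "'u itself \<Rightarrow> ('f, 'r) lang \<Rightarrow> ('f, 'r) fm set \<Rightarrow> bool" where
  "small_theory U L T \<longleftrightarrow> countable (\<Union>k. complete_types U L T k)"


section \<open>Saturation\<close>

definition expand_lang :: "('f, 'r) lang \<Rightarrow> 'u set \<Rightarrow> ('f + 'u, 'r) lang" where
  "expand_lang L A =
     \<lparr>funs = Inl ` funs L \<union> Inr ` A, rels = rels L, far = case_sum (far L) (\<lambda>_. 0), rar = rar L\<rparr>"

definition expand_struct ::
  "('f, 'r) lang \<Rightarrow> ('f, 'r, 'u) struct \<Rightarrow> 'u set \<Rightarrow> ('f + 'u, 'r, 'u) struct" where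
  "expand_struct L M A =
     \<lparr>univ = univ M,
      fint = restrict (case_sum (fint M) (\<lambda>a. \<lambda>xs\<in>{[]}. a)) (funs (expand_lang L A)),
      rint = rint M\<rparr>"

definition saturated :: "('f, 'r) lang \<Rightarrow> 'k rel \<Rightarrow> ('f, 'r, 'u) struct \<Rightarrow> bool" where
  "saturated L \<kappa> M \<longleftrightarrow>
     (\<forall>A \<subseteq> univ M. |A| <o \<kappa> \<longrightarrow>
        (\<forall>p \<subseteq> formulas (expand_lang L A) 1.
           consistent_with TYPE('u) (expand_lang L A) (Th (expand_lang L A) (expand_struct L M A)) p
           \<longrightarrow> realizes (expand_struct L M A) p))"


section \<open>Counting models\<close>

definition num_models :: "'u itself \<Rightarrow> ('f, 'r) lang \<Rightarrow> ('f, 'r) fm set \<Rightarrow> ('f, 'r, 'u) struct set rel" where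
  "num_models U L T =
     (if \<exists>M :: ('f, 'r, 'u) struct. model L T M \<and> finite (univ M) then |{ {} }|
      else |{M. model L T M \<and> |univ M| =o natLeq} // {(M, N). iso L M N}| )"

definition Cprod :: "'i set \<Rightarrow> ('i \<Rightarrow> 'k rel) \<Rightarrow> ('i \<Rightarrow> 'k) rel" where
  "Cprod J r = |\<Pi>\<^sub>E i\<in>J. Field (r i)|"

definition vaught :: "'u itself \<Rightarrow> ('f, 'r) lang \<Rightarrow> ('f, 'r) fm set \<Rightarrow> bool" where
  "vaught U L T \<longleftrightarrow> num_models U L T \<le>o natLeq \<or> num_models U L T =o ctwo ^c natLeq"

definition countable_atomic_model ::
  "('f, 'r) lang \<Rightarrow> ('f, 'r) fm set \<Rightarrow> ('f, 'r, 'u) struct \<Rightarrow> bool" where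
  "countable_atomic_model L T M \<longleftrightarrow> model L T M \<and> countable (univ M) \<and> atomic_struct L M"

definition countably_saturated_model ::
  "('f, 'r) lang \<Rightarrow> ('f, 'r) fm set \<Rightarrow> ('f, 'r, 'u) struct \<Rightarrow> bool" where
  "countably_saturated_model L T M \<longleftrightarrow> model L T M \<and> countable (univ M) \<and> saturated L natLeq M"


section \<open>Perfect pairs\<close>

text \<open>
  An operation on nonempty tuples is a function on lists, used as
  \<open>box (map X [0..<n])\<close>. A bound \<open>min {a, b} \<le> c \<le> max {a, b}\<close> is spelled out as
  \<open>a \<le> c \<or> b \<le> c\<close> and \<open>c \<le> a \<or> c \<le> b\<close>.
\<close>

definition struct_operation ::
  "('f, 'r) lang \<Rightarrow> (('f, 'r, 'u) struct list \<Rightarrow> ('f, 'r, 'u) struct) \<Rightarrow> bool" where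
  "struct_operation L box \<longleftrightarrow>
     (\<forall>n\<ge>1. \<forall>X. (\<forall>i<n. is_struct L (X i)) \<longrightarrow>
        (let B = box (map X [0..<n]);
             S = |(SIGMA i : {..<n}. univ (X i))|;
             P = |(\<Pi>\<^sub>E i\<in>{..<n}. univ (X i))|
         in is_struct L B \<and>
            (S \<le>o |univ B| \<or> P \<le>o |univ B| ) \<and>
            ( |univ B| \<le>o S \<or> |univ B| \<le>o P)))"

definition elementary_class :: "('f, 'r) lang \<Rightarrow> ('f, 'r, 'u) struct set \<Rightarrow> bool" where
  "elementary_class L C \<longleftrightarrow>
     (\<forall>M\<in>C. is_struct L M) \<and> (\<forall>M\<in>C. \<forall>N. elem_equiv L M N \<longrightarrow> N \<in> C)"

definition Perf ::
  "('f, 'r) lang \<Rightarrow> (('f, 'r, 'u) struct list \<Rightarrow> ('f, 'r, 'u) struct) \<Rightarrow> ('f, 'r, 'u) struct set \<Rightarrow> bool" where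
  "Perf L box C \<longleftrightarrow>
     struct_operation L box \<and> elementary_class L C \<and>
     (\<forall>X Y :: nat \<Rightarrow> ('f, 'r, 'u) struct. \<forall>m\<ge>1. \<forall>n\<ge>1.
        range X \<subseteq> C \<longrightarrow> range Y \<subseteq> C \<longrightarrow>
        (iso L (box (map X [0..<n])) (box (map Y [0..<m])) \<longleftrightarrow>
           m = n \<and> (\<exists>\<pi>. \<pi> permutes {..<n} \<and> (\<forall>i<n. iso L (X i) (Y (\<pi> i)))))) \<and>
     (\<forall>X :: nat \<Rightarrow> ('f, 'r, 'u) struct. \<forall>n\<ge>1. \<forall>Y. range X \<subseteq> C \<longrightarrow> is_struct L Y \<longrightarrow>
        (elem_equiv L Y (box (map X [0..<n])) \<longleftrightarrow>
           (\<exists>Z. (\<forall>i<n. elem_equiv L (Z i) (X i)) \<and> iso L Y (box (map Z [0..<n]))))) \<and>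
     (\<forall>X :: nat \<Rightarrow> ('f, 'r, 'u) struct. \<forall>n\<ge>1. \<forall>E. range X \<subseteq> C \<longrightarrow> is_struct L E \<longrightarrow>
        (elem_sub L E (box (map X [0..<n])) \<longleftrightarrow>
           (\<exists>F. (\<forall>i<n. elem_sub L (F i) (X i)) \<and> E = box (map F [0..<n]))))"

text \<open>
  Letting \<open>\<kappa>\<close> range over the cardinals on \<open>'u set\<close> is no restriction: all \<open>\<kappa> > |'u|\<close> give the same
  notion of \<open>\<kappa>\<close>-saturation for structures with domain in \<open>'u\<close>.
\<close>

definition Perf_s ::
  "('f, 'r) lang \<Rightarrow> (('f, 'r, 'u) struct list \<Rightarrow> ('f, 'r, 'u) struct) \<Rightarrow> ('f, 'r, 'u) struct set \<Rightarrow> bool" where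
  "Perf_s L box C \<longleftrightarrow> Perf L box C \<and>
     (\<forall>n\<ge>1. \<forall>X. \<forall>\<kappa> :: 'u set rel. (\<forall>i<n. X i \<in> C) \<longrightarrow> Card_order \<kappa> \<longrightarrow>
        (\<forall>i<n. saturated L \<kappa> (X i)) \<longrightarrow> saturated L \<kappa> (box (map X [0..<n])))"

end

theory Submission
  imports Defs "HOL-Library.Countable" "HOL-Library.Countable_Set_Type" "HOL-Library.Multiset"
begin

text \<open>The clauses of a perfect pair speak about structures only, whereas the theorem speaks about theories.
The proof therefore expresses each property of a complete theory by its countable models and the
elementary maps between them, and these pass through products: by clauses (i) and (ii) the models of
\<open>T\<close> are, up to isomorphism, exactly the products of models of the \<open>T\<^sub>i\<close>, and by the bounds on
cardinalities a product is countable iff its factors are; by clauses (i) and (iii) an elementary map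
between two products consists, up to a permutation of the factors, of elementary maps between the
factors (\<open>product_elementary_map\<close>, \<open>elementary_map_product\<close>).

For (a), sending a countable model of \<open>T\<close> to the isomorphism types of its factors is injective
(\<open>iso_types_product_le\<close>). Conversely, varying one factor and fixing the others gives non-isomorphic
products, because isomorphic products have the same multiset of isomorphism types of factors and the
common part of two multisets can be cancelled (\<open>cancel_factor\<close>, \<open>iso_types_factor_le\<close>).

Part (b) is arithmetic of finite products of cardinals once (a) is known, except for the bound
\<open>3 \<le> I(T)\<close>. If the product is finite and not \<open>1\<close> then some \<open>I(T\<^sub>i)\<close> is not \<open>1\<close>, hence at least \<open>3\<close> by
Vaught's theorem that no complete theory has exactly two countable models (\<open>never_two\<close>).

For (c), the countable atomic models are the countable prime models (\<open>isolated_tuples_prime\<close>,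
\<open>prime_isolated_tuples\<close>), and primeness is a property of elementary maps. For (d), a theory is small
iff it has a countable saturated model; such a model is universal for countable models, and
universality is again a property of elementary maps (\<open>small_saturated_model\<close>,
\<open>omega_saturated_universal\<close>, \<open>factor_small\<close>).

The model theory behind this has a single source. In an ultrapower over the natural numbers, one
assignment satisfies all formulas of a decreasing sequence of satisfiable formulas. If the sequence
is chosen to meet countably many dense requirements, among them the existence of Henkin witnesses,
then the range of this assignment is a countable elementary substructure with prescribed properties
(\<open>generic_model\<close>). Loewenheim-Skolem, compactness, omitting types and the existence of atomic models
are instances. Saturated models arise from closing off a countable subset of the same ultrapower.
The elements of an ultrapower are functions into the universe \<open>'u\<close>; countable parts of it can be
copied back into \<open>'u\<close> because either the given structure is infinite, or it is finite and the
ultrapower is no larger (\<open>countable_hull\<close>).\<close>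

section \<open>Formulas and substitution\<close>

definition Tr :: "('f, 'r) fm" where
  "Tr = All 0 (Eq (Var 0) (Var 0))"
definition Conj :: "('f, 'r) fm \<Rightarrow> ('f, 'r) fm \<Rightarrow> ('f, 'r) fm" where
  "Conj \<phi> \<psi> = Neg (Imp \<phi> (Neg \<psi>))"
definition Exi :: "nat \<Rightarrow> ('f, 'r) fm \<Rightarrow> ('f, 'r) fm" where
  "Exi x \<phi> = Neg (All x (Neg \<phi>))"
definition conjs :: "('f, 'r) fm list \<Rightarrow> ('f, 'r) fm" where
  "conjs \<phi>s = foldr Conj \<phi>s Tr"
definition exs :: "nat list \<Rightarrow> ('f, 'r) fm \<Rightarrow> ('f, 'r) fm" where
  "exs xs \<phi> = foldr Exi xs \<phi>"

lemma sat_Tr [simp]: "sat M s Tr"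
  and wf_Tr [simp]: "wf_fm L Tr"
  and fv_Tr [simp]: "fv Tr = {}"
  by (auto simp: Tr_def)

lemma sat_Conj [simp]: "sat M s (Conj \<phi> \<psi>) \<longleftrightarrow> sat M s \<phi> \<and> sat M s \<psi>"
  and wf_Conj [simp]: "wf_fm L (Conj \<phi> \<psi>) \<longleftrightarrow> wf_fm L \<phi> \<and> wf_fm L \<psi>"
  and fv_Conj [simp]: "fv (Conj \<phi> \<psi>) = fv \<phi> \<union> fv \<psi>"
  by (auto simp: Conj_def)

lemma sat_Exi [simp]: "sat M s (Exi x \<phi>) \<longleftrightarrow> (\<exists>a\<in>univ M. sat M (s(x := a)) \<phi>)"
  and wf_Exi [simp]: "wf_fm L (Exi x \<phi>) \<longleftrightarrow> wf_fm L \<phi>"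
  and fv_Exi [simp]: "fv (Exi x \<phi>) = fv \<phi> - {x}"
  by (auto simp: Exi_def)

lemma sat_conjs [simp]: "sat M s (conjs \<phi>s) \<longleftrightarrow> (\<forall>\<phi>\<in>set \<phi>s. sat M s \<phi>)"
  and wf_conjs [simp]: "wf_fm L (conjs \<phi>s) \<longleftrightarrow> (\<forall>\<phi>\<in>set \<phi>s. wf_fm L \<phi>)"
  and fv_conjs [simp]: "fv (conjs \<phi>s) = (\<Union>\<phi>\<in>set \<phi>s. fv \<phi>)"
  by (induction \<phi>s) (auto simp: conjs_def)

lemma wf_exs [simp]: "wf_fm L (exs xs \<phi>) \<longleftrightarrow> wf_fm L \<phi>"
  and fv_exs [simp]: "fv (exs xs \<phi>) = fv \<phi> - set xs"
  by (induction xs) (auto simp: exs_def)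

lemma assignments_upd [simp]: "s \<in> assignments M \<Longrightarrow> a \<in> univ M \<Longrightarrow> s(x := a) \<in> assignments M"
  by (auto simp: assignments_def)

lemma assignments_in [simp]: "s \<in> assignments M \<Longrightarrow> s i \<in> univ M"
  by (auto simp: assignments_def)

lemma assignments_comp [simp]: "s \<in> assignments M \<Longrightarrow> s \<circ> \<sigma> \<in> assignments M"
  by (auto simp: assignments_def)

lemma assignmentsI: "(\<And>i. s i \<in> univ M) \<Longrightarrow> s \<in> assignments M"
  by (auto simp: assignments_def)

lemma ex_assignment: "is_struct L M \<Longrightarrow> \<exists>s. s \<in> assignments M"
  unfolding is_struct_def by (metis assignmentsI ex_in_conv)

lemma sat_exs:
  "s \<in> assignments M \<Longrightarrow>
   sat M s (exs xs \<phi>) \<longleftrightarrow> (\<exists>t\<in>assignments M. (\<forall>i. i \<notin> set xs \<longrightarrow> t i = s i) \<and> sat M t \<phi>)"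
proof (induction xs arbitrary: s)
  case Nil
  have "\<And>t. (\<forall>i. t i = s i) \<longleftrightarrow> t = s" by auto
  then show ?case using Nil by (auto simp: exs_def)
next
  case (Cons x xs)
  have "sat M s (exs (x # xs) \<phi>) \<longleftrightarrow> (\<exists>a\<in>univ M. sat M (s(x := a)) (exs xs \<phi>))"
    by (simp add: exs_def)
  also have "\<dots> \<longleftrightarrow> (\<exists>a\<in>univ M. \<exists>t\<in>assignments M.
      (\<forall>i. i \<notin> set xs \<longrightarrow> t i = (s(x := a)) i) \<and> sat M t \<phi>)"
  proof (rule bex_cong[OF refl])
    fix a assume "a \<in> univ M"
    then show "sat M (s(x := a)) (exs xs \<phi>) = (\<exists>t\<in>assignments M.
      (\<forall>i. i \<notin> set xs \<longrightarrow> t i = (s(x := a)) i) \<and> sat M t \<phi>)"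
      by (intro Cons.IH assignments_upd Cons.prems)
  qed
  also have "\<dots> \<longleftrightarrow> (\<exists>t\<in>assignments M. (\<forall>i. i \<notin> set (x # xs) \<longrightarrow> t i = s i) \<and> sat M t \<phi>)"
  proof
    assume "\<exists>a\<in>univ M. \<exists>t\<in>assignments M.
      (\<forall>i. i \<notin> set xs \<longrightarrow> t i = (s(x := a)) i) \<and> sat M t \<phi>"
    then show "\<exists>t\<in>assignments M. (\<forall>i. i \<notin> set (x # xs) \<longrightarrow> t i = s i) \<and> sat M t \<phi>"
      by (metis fun_upd_apply list.set_intros(1) list.set_intros(2))
  next
    assume "\<exists>t\<in>assignments M. (\<forall>i. i \<notin> set (x # xs) \<longrightarrow> t i = s i) \<and> sat M t \<phi>"
    then obtain t where t: "t \<in> assignments M" "\<forall>i. i \<notin> set (x # xs) \<longrightarrow> t i = s i" "sat M t \<phi>"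
      by blast
    have "t x \<in> univ M" using t(1) by simp
    moreover have "\<forall>i. i \<notin> set xs \<longrightarrow> t i = (s(x := t x)) i" using t(2) by auto
    ultimately show "\<exists>a\<in>univ M. \<exists>t\<in>assignments M.
      (\<forall>i. i \<notin> set xs \<longrightarrow> t i = (s(x := a)) i) \<and> sat M t \<phi>" using t by blast
  qed
  finally show ?case .
qed

lemma val_cong: "(\<And>x. x \<in> fv_trm t \<Longrightarrow> s x = s' x) \<Longrightarrow> val M s t = val M s' t"
proof (induction t)
  case (Fun f ts)
  have "map (val M s) ts = map (val M s') ts" using Fun by (auto intro!: map_cong)
  then show ?case by (simp only: val.simps)
qed simp

lemma sat_cong: "(\<And>x. x \<in> fv \<phi> \<Longrightarrow> s x = s' x) \<Longrightarrow> sat M s \<phi> \<longleftrightarrow> sat M s' \<phi>"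
proof (induction \<phi> arbitrary: s s')
  case (Eq t u)
  have "val M s t = val M s' t" "val M s u = val M s' u"
    using Eq by (auto intro!: val_cong)
  then show ?case by (simp only: sat.simps)
next
  case (Rel r ts)
  have "map (val M s) ts = map (val M s') ts"
    using Rel by (auto intro!: map_cong val_cong)
  then show ?case by (simp only: sat.simps)
next
  case (Neg \<phi>)
  have "sat M s \<phi> = sat M s' \<phi>" by (rule Neg.IH) (use Neg.prems in simp)
  then show ?case by simp
next
  case (Imp \<phi> \<psi>)
  have "sat M s \<phi> = sat M s' \<phi>" "sat M s \<psi> = sat M s' \<psi>"
    by (rule Imp.IH(1), use Imp.prems in simp) (rule Imp.IH(2), use Imp.prems in simp)
  then show ?case by simp
next
  case (All x \<phi>)
  have "sat M (s(x := a)) \<phi> = sat M (s'(x := a)) \<phi>" for a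
    using All.prems by (intro All.IH) auto
  then show ?case by simp
qed

lemma sat_formulas_cong:
  "\<phi> \<in> formulas L k \<Longrightarrow> (\<And>i. i < k \<Longrightarrow> s i = s' i) \<Longrightarrow> sat M s \<phi> \<longleftrightarrow> sat M s' \<phi>"
  by (intro sat_cong) (auto simp: formulas_def)

lemma finite_fv_trm [simp]: "finite (fv_trm t)"
  by (induction t) auto

lemma finite_fv [simp]: "finite (fv \<phi>)"
  by (induction \<phi>) auto

lemma ex_formulas: "wf_fm L \<phi> \<Longrightarrow> \<exists>k. \<phi> \<in> formulas L k"
  unfolding formulas_def using finite_nat_iff_bounded[of "fv \<phi>"] by auto

lemma formulas_wf: "\<phi> \<in> formulas L k \<Longrightarrow> wf_fm L \<phi>"
  by (simp add: formulas_def)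

lemma formulas_Neg [simp]: "Neg \<phi> \<in> formulas L k \<longleftrightarrow> \<phi> \<in> formulas L k"
  and formulas_Conj [simp]: "Conj \<phi> \<psi> \<in> formulas L k \<longleftrightarrow> \<phi> \<in> formulas L k \<and> \<psi> \<in> formulas L k"
  and formulas_Imp [simp]: "Imp \<phi> \<psi> \<in> formulas L k \<longleftrightarrow> \<phi> \<in> formulas L k \<and> \<psi> \<in> formulas L k"
  and formulas_conjs [simp]: "conjs \<phi>s \<in> formulas L k \<longleftrightarrow> set \<phi>s \<subseteq> formulas L k"
  by (auto simp: formulas_def)

lemma val_in: "is_struct L M \<Longrightarrow> s \<in> assignments M \<Longrightarrow> wf_trm L t \<Longrightarrow> val M s t \<in> univ M"
proof (induction t)
  case (Fun f ts)
  have "map (val M s) ts \<in> tuples (univ M) (far L f)"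
    using Fun by (auto simp: tuples_def simp del: assignments_in)
  moreover have "fint M f \<in> tuples (univ M) (far L f) \<rightarrow>\<^sub>E univ M"
    using Fun.prems PiE_mem[of "fint M" "funs L"] by (auto simp: is_struct_def simp del: PiE_iff)
  ultimately show ?case unfolding val.simps by (rule PiE_mem[rotated])
qed simp

lemma fint_in: "is_struct L M \<Longrightarrow> f \<in> funs L \<Longrightarrow> xs \<in> tuples (univ M) (far L f) \<Longrightarrow> fint M f xs \<in> univ M"
  unfolding is_struct_def by (blast dest: PiE_mem)

lemma rint_tuples: "is_struct L M \<Longrightarrow> r \<in> rels L \<Longrightarrow> rint M r \<subseteq> tuples (univ M) (rar L r)"
  unfolding is_struct_def by (blast dest: PiE_mem)

text \<open>Substitution of variables for variables by an arbitrary, possibly non-injective, \<open>\<sigma>\<close>. A quantified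
  variable is renamed to one above all values of \<open>\<sigma>\<close> on the free variables, so that nothing is captured.\<close>

primrec sub_trm :: "'f trm \<Rightarrow> (nat \<Rightarrow> nat) \<Rightarrow> 'f trm" where
  "sub_trm (Var x) \<sigma> = Var (\<sigma> x)"
| "sub_trm (Fun f ts) \<sigma> = Fun f (map (\<lambda>t. sub_trm t \<sigma>) ts)"

primrec sub :: "('f, 'r) fm \<Rightarrow> (nat \<Rightarrow> nat) \<Rightarrow> ('f, 'r) fm" where
  "sub (Eq t u) \<sigma> = Eq (sub_trm t \<sigma>) (sub_trm u \<sigma>)"
| "sub (Rel r ts) \<sigma> = Rel r (map (\<lambda>t. sub_trm t \<sigma>) ts)"
| "sub (Neg \<phi>) \<sigma> = Neg (sub \<phi> \<sigma>)"
| "sub (Imp \<phi> \<psi>) \<sigma> = Imp (sub \<phi> \<sigma>) (sub \<psi> \<sigma>)"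
| "sub (All x \<phi>) \<sigma> =
     (let z = Suc (Max (insert 0 (\<sigma> ` fv \<phi>))) in All z (sub \<phi> (\<sigma>(x := z))))"

lemma Suc_Max_fresh: "finite A \<Longrightarrow> a \<in> A \<Longrightarrow> a < Suc (Max (insert 0 A))" for a :: nat
  by (meson Max_ge finite_insert insertI2 le_imp_less_Suc)

lemma val_sub: "val M s (sub_trm t \<sigma>) = val M (s \<circ> \<sigma>) t"
proof (induction t)
  case (Fun f ts)
  then show ?case by (simp add: comp_def cong: map_cong)
qed simp

lemma sat_sub: "sat M s (sub \<phi> \<sigma>) \<longleftrightarrow> sat M (s \<circ> \<sigma>) \<phi>"
proof (induction \<phi> arbitrary: s \<sigma>)
  case (Eq t u)
  then show ?case by (simp only: sub.simps sat.simps val_sub)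
next
  case (Rel r ts)
  then show ?case by (simp add: val_sub comp_def)
next
  case (All x \<phi>)
  define z where "z = Suc (Max (insert 0 (\<sigma> ` fv \<phi>)))"
  have z: "\<sigma> y \<noteq> z" if "y \<in> fv \<phi>" for y
    using Suc_Max_fresh[of "\<sigma> ` fv \<phi>" "\<sigma> y"] that by (auto simp: z_def)
  have "sat M (s(z := a) \<circ> \<sigma>(x := z)) \<phi> = sat M ((s \<circ> \<sigma>)(x := a)) \<phi>" for a
    using z by (intro sat_cong) auto
  then show ?case by (simp only: sub.simps Let_def z_def[symmetric] sat.simps All.IH)
qed (auto simp del: comp_apply)

lemma wf_sub_trm [simp]: "wf_trm L (sub_trm t \<sigma>) \<longleftrightarrow> wf_trm L t"
  by (induction t) auto

lemma wf_sub [simp]: "wf_fm L (sub \<phi> \<sigma>) \<longleftrightarrow> wf_fm L \<phi>"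
  by (induction \<phi> arbitrary: \<sigma>) (auto simp: Let_def)

lemma fv_sub_trm: "fv_trm (sub_trm t \<sigma>) = \<sigma> ` fv_trm t"
  by (induction t) auto

lemma fv_sub: "fv (sub \<phi> \<sigma>) \<subseteq> \<sigma> ` fv \<phi>"
proof (induction \<phi> arbitrary: \<sigma>)
  case (Eq t u)
  then show ?case by (auto simp: fv_sub_trm)
next
  case (Rel r ts)
  then show ?case by (auto simp: fv_sub_trm)
next
  case (Neg \<phi>)
  then show ?case by simp
next
  case (Imp \<phi> \<psi>)
  have "fv (sub \<phi> \<sigma>) \<subseteq> \<sigma> ` fv \<phi>" "fv (sub \<psi> \<sigma>) \<subseteq> \<sigma> ` fv \<psi>" using Imp by auto
  then show ?case by auto
next
  case (All x \<phi>)
  define z where "z = Suc (Max (insert 0 (\<sigma> ` fv \<phi>)))"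
  have "fv (sub \<phi> (\<sigma>(x := z))) \<subseteq> \<sigma>(x := z) ` fv \<phi>" by (rule All)
  then show ?case by (auto simp: Let_def z_def[symmetric])
qed

text \<open>The set defined by this formula consists of the tuples \<open>v\<^sub>0, \<dots>, v\<^sub>k\<^sub>-\<^sub>1\<close> that occur at the positions \<open>xs\<close>
  of an assignment satisfying \<open>\<phi>\<close>. The variables of \<open>\<phi>\<close> are shifted by \<open>k\<close> to keep them apart from
  the free ones. The empty tuple gives the existential closure of \<open>\<phi>\<close>, and the positions \<open>[0..<k]\<close> give the
  quantification over all variables other than the first \<open>k\<close>.\<close>

definition tuple_ex :: "nat list \<Rightarrow> ('f, 'r) fm \<Rightarrow> ('f, 'r) fm" where
  "tuple_ex xs \<phi> =
     (let k = length xs; m = Suc (Max (insert 0 (fv \<phi> \<union> set xs))) in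
        exs [k..<k + m]
          (Conj (conjs (map (\<lambda>i. Eq (Var i) (Var (k + xs ! i))) [0..<k])) (sub \<phi> (\<lambda>i. k + i))))"

lemma tuple_ex_formulas:
  assumes "wf_fm L \<phi>"
  shows "tuple_ex xs \<phi> \<in> formulas L (length xs)"
proof -
  define m where "m = Suc (Max (insert 0 (fv \<phi> \<union> set xs)))"
  have m: "i < m" if "i \<in> fv \<phi> \<union> set xs" for i
    using Suc_Max_fresh[of "fv \<phi> \<union> set xs" i] that by (simp add: m_def)
  have "fv (sub \<phi> (\<lambda>i. length xs + i)) \<subseteq> {..<length xs + m}"
    using fv_sub[of \<phi> "\<lambda>i. length xs + i"] m by fastforce
  moreover have "xs ! i < m" if "i < length xs" for i
    using m that by simp
  ultimately show ?thesis
    using assms by (auto simp: tuple_ex_def Let_def m_def[symmetric] formulas_def)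
qed

lemma sat_tuple_ex:
  assumes s: "s \<in> assignments M"
  shows "sat M s (tuple_ex xs \<phi>) \<longleftrightarrow>
    (\<exists>t\<in>assignments M. (\<forall>i<length xs. s i = t (xs ! i)) \<and> sat M t \<phi>)"
proof -
  let ?k = "length xs"
  define m where "m = Suc (Max (insert 0 (fv \<phi> \<union> set xs)))"
  have m: "i < m" if "i \<in> fv \<phi> \<union> set xs" for i
    using Suc_Max_fresh[of "fv \<phi> \<union> set xs" i] that by (simp add: m_def)
  have "sat M s (tuple_ex xs \<phi>) \<longleftrightarrow>
    (\<exists>u\<in>assignments M. (\<forall>i. i \<notin> {?k..<?k + m} \<longrightarrow> u i = s i) \<and>
       (\<forall>i<?k. u i = u (?k + xs ! i)) \<and> sat M (u \<circ> (\<lambda>i. ?k + i)) \<phi>)"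
    using s unfolding tuple_ex_def Let_def m_def[symmetric]
    by (simp add: sat_exs sat_sub atLeast0LessThan Ball_def[of "{..<length xs}"])
  also have "\<dots> \<longleftrightarrow> (\<exists>t\<in>assignments M. (\<forall>i<?k. s i = t (xs ! i)) \<and> sat M t \<phi>)" (is "?A \<longleftrightarrow> ?B")
  proof
    assume ?A
    then obtain u where u: "u \<in> assignments M" "\<forall>i. i \<notin> {?k..<?k + m} \<longrightarrow> u i = s i"
       "\<forall>i<?k. u i = u (?k + xs ! i)" "sat M (u \<circ> (\<lambda>i. ?k + i)) \<phi>" by blast
    have "\<forall>i<?k. s i = (u \<circ> (\<lambda>i. ?k + i)) (xs ! i)" using u(2,3) by auto
    then show ?B using u by (intro bexI[of _ "u \<circ> (\<lambda>i. ?k + i)"]) auto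
  next
    assume ?B
    then obtain t where t: "t \<in> assignments M" "\<forall>i<?k. s i = t (xs ! i)" "sat M t \<phi>" by blast
    define u where "u i = (if i \<in> {?k..<?k + m} then t (i - ?k) else s i)" for i
    have "u \<in> assignments M" using s t(1) by (auto simp: u_def intro!: assignmentsI)
    moreover have "\<forall>i<?k. u i = u (?k + xs ! i)" using t(2) m by (auto simp: u_def)
    moreover have "sat M (u \<circ> (\<lambda>i. ?k + i)) \<phi> \<longleftrightarrow> sat M t \<phi>"
      using m by (intro sat_cong) (auto simp: u_def)
    ultimately show ?A using t(3) by (intro bexI[of _ u]) (auto simp: u_def)
  qed
  finally show ?thesis .
qed

instance trm :: (countable) countable by countable_datatype
instance fm :: (countable, countable) countable by countable_datatype

text \<open>Numbering the symbols of the language maps its formulas injectively into a countable datatype.\<close>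

lemma countable_formulas:
  assumes "countable_lang L"
  shows "countable {\<phi>. wf_fm L \<phi>}"
proof -
  have t: "set_trm t \<subseteq> funs L" if "wf_trm L t" for t :: "'a trm"
    using that by (induction t) auto
  have f: "set1_fm \<phi> \<subseteq> funs L \<and> set2_fm \<phi> \<subseteq> rels L" if "wf_fm L \<phi>" for \<phi> :: "('a, 'b) fm"
    using that t by (induction \<phi>) fastforce+
  let ?h = "map_fm (to_nat_on (funs L)) (to_nat_on (rels L))"
  have cf: "inj_on (to_nat_on (funs L)) (funs L)" "inj_on (to_nat_on (rels L)) (rels L)"
    using assms by (auto simp: countable_lang_def)
  have "inj_on ?h {\<phi>. wf_fm L \<phi>}"
  proof (rule inj_onI)
    fix \<phi> \<psi> assume a: "\<phi> \<in> {\<phi>. wf_fm L \<phi>}" "\<psi> \<in> {\<phi>. wf_fm L \<phi>}" "?h \<phi> = ?h \<psi>"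
    show "\<phi> = \<psi>"
      using f[of \<phi>] f[of \<psi>] a cf by (intro fm.inj_map_strong[OF _ _ a(3)]) (auto dest: inj_onD)
  qed
  then show ?thesis by (rule countableI')
qed

section \<open>Theories and elementary maps\<close>

lemma sat_sentence: "\<phi> \<in> formulas L 0 \<Longrightarrow> sat M s \<phi> \<longleftrightarrow> sat M t \<phi>"
  by (rule sat_formulas_cong) auto

lemma Th_iff:
  assumes "s \<in> assignments M"
  shows "\<phi> \<in> Th L M \<longleftrightarrow> \<phi> \<in> formulas L 0 \<and> sat M s \<phi>"
  unfolding Th_def using assms sat_sentence[of \<phi> L M s] by auto

lemma Th_eqI:
  assumes "s \<in> assignments M" "t \<in> assignments N"
    and "\<And>\<phi>. \<phi> \<in> formulas L 0 \<Longrightarrow> sat M s \<phi> \<longleftrightarrow> sat N t \<phi>"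
  shows "Th L M = Th L N"
  using assms by (auto simp: Th_iff[OF assms(1)] Th_iff[OF assms(2)])

lemma model_Th_iff:
  assumes "is_struct L M"
  shows "model L (Th L M) N \<longleftrightarrow> is_struct L N \<and> Th L N = Th L M"
proof (cases "is_struct L N")
  case True
  obtain s t where s: "s \<in> assignments M" and t: "t \<in> assignments N"
    using assms[THEN ex_assignment] True[THEN ex_assignment] by blast
  show ?thesis
  proof
    assume m: "model L (Th L M) N"
    have "sat N t \<phi> \<longleftrightarrow> sat M s \<phi>" if f: "\<phi> \<in> formulas L 0" for \<phi>
    proof -
      have imp: "sat N t \<psi>" if "\<psi> \<in> formulas L 0" "sat M s \<psi>" for \<psi>
        using m that t Th_iff[OF s, of \<psi> L] by (auto simp: model_def)
      show ?thesis using imp[of \<phi>] imp[of "Neg \<phi>"] f by auto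
    qed
    then show "is_struct L N \<and> Th L N = Th L M" using True Th_eqI[OF t s] by simp
  next
    assume "is_struct L N \<and> Th L N = Th L M"
    then show "model L (Th L M) N" by (auto simp: model_def Th_def)
  qed
qed (simp add: model_def)

text \<open>Satisfiability of a formula is expressed by a sentence, its existential closure.\<close>

lemma sat_ex_transfer:
  assumes "is_struct L M" "is_struct L N" "Th L M = Th L N" "wf_fm L \<phi>"
  shows "(\<exists>s\<in>assignments M. sat M s \<phi>) \<longleftrightarrow> (\<exists>t\<in>assignments N. sat N t \<phi>)"
proof -
  obtain s t where s: "s \<in> assignments M" and t: "t \<in> assignments N"
    using assms(1,2)[THEN ex_assignment] by blast
  have f: "tuple_ex [] \<phi> \<in> formulas L 0" using tuple_ex_formulas[OF assms(4), of "[]"] by simp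
  have "(\<exists>s\<in>assignments M. sat M s \<phi>) \<longleftrightarrow> tuple_ex [] \<phi> \<in> Th L M"
    using f sat_tuple_ex[OF s, of "[]" \<phi>] by (simp add: Th_iff[OF s])
  also have "\<dots> \<longleftrightarrow> tuple_ex [] \<phi> \<in> Th L N" using assms by simp
  also have "\<dots> \<longleftrightarrow> (\<exists>t\<in>assignments N. sat N t \<phi>)"
    using f sat_tuple_ex[OF t, of "[]" \<phi>] by (simp add: Th_iff[OF t])
  finally show ?thesis .
qed

lemma sat_all_transfer:
  assumes "is_struct L M" "is_struct L N" "Th L M = Th L N" "wf_fm L \<phi>"
  shows "(\<forall>s\<in>assignments M. sat M s \<phi>) \<longleftrightarrow> (\<forall>t\<in>assignments N. sat N t \<phi>)"
  using sat_ex_transfer[OF assms(1-3), of "Neg \<phi>"] assms(4) by auto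

text \<open>The two structures may have different universes, as is the case for a structure and its ultrapower.\<close>

definition elementary_map ::
  "('f, 'r) lang \<Rightarrow> ('f, 'r, 'u) struct \<Rightarrow> ('f, 'r, 'v) struct \<Rightarrow> ('u \<Rightarrow> 'v) \<Rightarrow> bool" where
  "elementary_map L M N h \<longleftrightarrow> is_struct L M \<and> is_struct L N \<and> h ` univ M \<subseteq> univ N \<and>
     (\<forall>\<phi>. wf_fm L \<phi> \<longrightarrow> (\<forall>s\<in>assignments M. sat M s \<phi> \<longleftrightarrow> sat N (h \<circ> s) \<phi>))"

lemma elementary_map_sat:
  "elementary_map L M N h \<Longrightarrow> wf_fm L \<phi> \<Longrightarrow> s \<in> assignments M \<Longrightarrow> sat N (h \<circ> s) \<phi> \<longleftrightarrow> sat M s \<phi>"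
  by (simp add: elementary_map_def)

lemma elementary_map_struct:
  assumes "elementary_map L M N h"
  shows "is_struct L M" "is_struct L N" "h ` univ M \<subseteq> univ N"
  using assms by (auto simp: elementary_map_def)

lemma elementary_map_assignment:
  "elementary_map L M N h \<Longrightarrow> s \<in> assignments M \<Longrightarrow> h \<circ> s \<in> assignments N"
  unfolding elementary_map_def assignments_def by auto

lemma elementary_map_comp:
  assumes "elementary_map L M N h" "elementary_map L N P g"
  shows "elementary_map L M P (g \<circ> h)"
proof -
  have "sat P (g \<circ> h \<circ> s) \<phi> \<longleftrightarrow> sat M s \<phi>" if "wf_fm L \<phi>" "s \<in> assignments M" for \<phi> s
    using elementary_map_sat[OF assms(1) that]
      elementary_map_sat[OF assms(2) that(1) elementary_map_assignment[OF assms(1) that(2)]]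
    by (simp add: comp_assoc)
  moreover have "(g \<circ> h) ` univ M \<subseteq> univ P" using assms unfolding elementary_map_def by fastforce
  ultimately show ?thesis using assms by (simp add: elementary_map_def)
qed

lemma elementary_map_Th:
  assumes "elementary_map L M N h"
  shows "Th L M = Th L N"
proof -
  obtain s where s: "s \<in> assignments M"
    using ex_assignment[OF elementary_map_struct(1)[OF assms]] by blast
  show ?thesis
    by (rule Th_eqI[OF s elementary_map_assignment[OF assms s]])
      (rule elementary_map_sat[OF assms formulas_wf s, symmetric])
qed

lemma assignment_of_list:
  assumes "is_struct L M" "set xs \<subseteq> univ M"
  obtains s where "s \<in> assignments M" "\<And>i. i < length xs \<Longrightarrow> s i = xs ! i"
proof -
  obtain s0 where s0: "s0 \<in> assignments M" using ex_assignment[OF assms(1)] by blast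
  show thesis
    using s0 assms(2) by (intro that[of "\<lambda>i. if i < length xs then xs ! i else s0 i"])
      (auto intro!: assignmentsI simp: subset_iff)
qed

lemma elementary_map_inj:
  assumes "elementary_map L M N h"
  shows "inj_on h (univ M)"
proof (rule inj_onI)
  fix x y assume xy: "x \<in> univ M" "y \<in> univ M" "h x = h y"
  obtain s where s: "s \<in> assignments M" "s 0 = x" "s 1 = y"
  proof (rule assignment_of_list[OF elementary_map_struct(1)[OF assms], of "[x, y]"])
    fix s assume "s \<in> assignments M" and e: "\<And>i. i < length [x, y] \<Longrightarrow> s i = [x, y] ! i"
    then show thesis using e[of 0] e[of 1] by (intro that[of s]) simp_all
  qed (use xy in auto)
  have "sat N (h \<circ> s) (Eq (Var 0) (Var 1)) \<longleftrightarrow> sat M s (Eq (Var 0) (Var 1))"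
    using assms s by (intro elementary_map_sat) auto
  then show "x = y" using s xy by simp
qed

lemma elementary_map_fint:
  assumes "elementary_map L M N h" "f \<in> funs L" "xs \<in> tuples (univ M) (far L f)"
  shows "h (fint M f xs) = fint N f (map h xs)"
proof -
  have M: "is_struct L M" using assms by (simp add: elementary_map_def)
  let ?ys = "fint M f xs # xs"
  have "set ?ys \<subseteq> univ M" using fint_in[OF M assms(2,3)] assms(3) by (auto simp: tuples_def)
  then obtain s where s: "s \<in> assignments M" "\<And>i. i < length ?ys \<Longrightarrow> s i = ?ys ! i"
    using assignment_of_list[OF M] by blast
  let ?\<phi> = "Eq (Var 0) (Fun f (map (\<lambda>i. Var (Suc i)) [0..<length xs]))"
  have l: "length xs = far L f" using assms(3) by (simp add: tuples_def)
  have e: "map (val M s) (map (\<lambda>i. Var (Suc i)) [0..<length xs]) = xs"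
    using s(2) by (intro nth_equalityI) auto
  have e': "map (val N (h \<circ> s)) (map (\<lambda>i. Var (Suc i)) [0..<length xs]) = map h xs"
    using s(2) by (intro nth_equalityI) auto
  have "sat N (h \<circ> s) ?\<phi> \<longleftrightarrow> sat M s ?\<phi>"
    using assms(2) l by (intro elementary_map_sat[OF assms(1)]) (auto simp: s)
  then show ?thesis unfolding sat.simps val.simps e e' using s(2)[of 0] by simp
qed

lemma elementary_map_rint:
  assumes "elementary_map L M N h" "r \<in> rels L" "xs \<in> tuples (univ M) (rar L r)"
  shows "xs \<in> rint M r \<longleftrightarrow> map h xs \<in> rint N r"
proof -
  have M: "is_struct L M" using assms by (simp add: elementary_map_def)
  have "set xs \<subseteq> univ M" using assms(3) by (auto simp: tuples_def)
  then obtain s where s: "s \<in> assignments M" "\<And>i. i < length xs \<Longrightarrow> s i = xs ! i"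
    using assignment_of_list[OF M] by blast
  let ?\<phi> = "Rel r (map Var [0..<length xs])"
  have l: "length xs = rar L r" using assms(3) by (simp add: tuples_def)
  have e: "map (val M s) (map Var [0..<length xs]) = xs"
    using s(2) by (intro nth_equalityI) auto
  have e': "map (val N (h \<circ> s)) (map Var [0..<length xs]) = map h xs"
    using s(2) by (intro nth_equalityI) auto
  have "sat N (h \<circ> s) ?\<phi> \<longleftrightarrow> sat M s ?\<phi>"
    using assms(2) l by (intro elementary_map_sat[OF assms(1)]) (auto simp: s)
  then show ?thesis unfolding sat.simps e e' by simp
qed

text \<open>Induction on formulas. In the quantifier step every element of the target is a value of \<open>h\<close>.\<close>

lemma iso_map_elementary:
  assumes M: "is_struct L M" and N: "is_struct L N" and h: "bij_betw h (univ M) (univ N)"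
    and f: "\<And>f xs. f \<in> funs L \<Longrightarrow> xs \<in> tuples (univ M) (far L f) \<Longrightarrow> h (fint M f xs) = fint N f (map h xs)"
    and r: "\<And>r xs. r \<in> rels L \<Longrightarrow> xs \<in> tuples (univ M) (rar L r) \<Longrightarrow> xs \<in> rint M r \<longleftrightarrow> map h xs \<in> rint N r"
  shows "elementary_map L M N h"
proof -
  have v: "h (val M s t) = val N (h \<circ> s) t" if "wf_trm L t" "s \<in> assignments M" for t s
    using that
  proof (induction t)
    case (Fun f ts)
    have "map (val M s) ts \<in> tuples (univ M) (far L f)"
      using Fun.prems val_in[OF M Fun.prems(2)] by (auto simp: tuples_def)
    then have "h (val M s (Fun f ts)) = fint N f (map h (map (val M s) ts))"
      using assms(4) Fun.prems by simp
    also have "map h (map (val M s) ts) = map (val N (h \<circ> s)) ts"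
      unfolding map_map
    proof (intro map_cong refl)
      fix u assume "u \<in> set ts"
      then show "(h \<circ> val M s) u = val N (h \<circ> s) u"
        unfolding comp_apply[of h "val M s"] by (intro Fun.IH) (use Fun.prems in auto)
    qed
    finally show ?case by (simp only: val.simps)
  qed simp
  have inj: "inj_on h (univ M)" and img: "h ` univ M = univ N" using h by (auto simp: bij_betw_def)
  have s: "sat M s \<phi> \<longleftrightarrow> sat N (h \<circ> s) \<phi>" if "wf_fm L \<phi>" "s \<in> assignments M" for \<phi> s
    using that
  proof (induction \<phi> arbitrary: s)
    case (Eq t u)
    then have "val M s t = val M s u \<longleftrightarrow> h (val M s t) = h (val M s u)"
      using inj val_in[OF M Eq.prems(2)] by (auto dest: inj_onD)
    then show ?case using v[OF _ Eq.prems(2)] Eq.prems by (simp del: comp_apply)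
  next
    case (Rel r ts)
    have "map (val M s) ts \<in> tuples (univ M) (rar L r)"
      using Rel.prems val_in[OF M Rel.prems(2)] by (auto simp: tuples_def)
    moreover have "map h (map (val M s) ts) = map (val N (h \<circ> s)) ts"
      using v[OF _ Rel.prems(2)] Rel.prems by auto
    ultimately show ?case using assms(5)[of r "map (val M s) ts"] Rel.prems
      by (metis sat.simps(2) wf_fm.simps(2))
  next
    case (All x \<phi>)
    have "sat M (s(x := a)) \<phi> \<longleftrightarrow> sat N ((h \<circ> s)(x := h a)) \<phi>" if "a \<in> univ M" for a
    proof -
      have "h \<circ> s(x := a) = (h \<circ> s)(x := h a)" by (auto simp: fun_eq_iff)
      then show ?thesis
        using All.IH[OF _ assignments_upd[OF All.prems(2) that]] All.prems(1) by (simp only: wf_fm.simps)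
    qed
    then have "sat M s (All x \<phi>) \<longleftrightarrow> (\<forall>a\<in>univ M. sat N ((h \<circ> s)(x := h a)) \<phi>)" by simp
    also have "\<dots> \<longleftrightarrow> sat N (h \<circ> s) (All x \<phi>)" unfolding sat.simps img[symmetric] by blast
    finally show ?case .
  qed (auto simp del: comp_apply)
  show ?thesis using M N s img by (auto simp: elementary_map_def)
qed

lemma iso_iff_elementary:
  "iso L M N \<longleftrightarrow> (\<exists>h. elementary_map L M N h \<and> h ` univ M = univ N)"
proof
  assume "iso L M N"
  then obtain h where "is_struct L M" "is_struct L N" "bij_betw h (univ M) (univ N)"
    "\<forall>f\<in>funs L. \<forall>xs\<in>tuples (univ M) (far L f). h (fint M f xs) = fint N f (map h xs)"
    "\<forall>r\<in>rels L. \<forall>xs\<in>tuples (univ M) (rar L r). xs \<in> rint M r \<longleftrightarrow> map h xs \<in> rint N r"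
    unfolding iso_def by blast
  then have "elementary_map L M N h \<and> h ` univ M = univ N"
    using iso_map_elementary[of L M N h] bij_betw_imp_surj_on by blast
  then show "\<exists>h. elementary_map L M N h \<and> h ` univ M = univ N" by blast
next
  assume "\<exists>h. elementary_map L M N h \<and> h ` univ M = univ N"
  then obtain h where h: "elementary_map L M N h" "h ` univ M = univ N" by blast
  then show "iso L M N"
    using elementary_map_inj[OF h(1)] elementary_map_fint[OF h(1)] elementary_map_rint[OF h(1)]
      elementary_map_struct(1,2)[OF h(1)]
    unfolding iso_def bij_betw_def by blast
qed

lemma iso_refl: "is_struct L M \<Longrightarrow> iso L M M"
  unfolding iso_iff_elementary elementary_map_def by (intro exI[of _ id]) simp

lemma iso_sym:
  assumes "iso L M N"
  shows "iso L N M"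
proof -
  obtain h where h: "elementary_map L M N h" "h ` univ M = univ N"
    using assms unfolding iso_iff_elementary by blast
  let ?g = "inv_into (univ M) h"
  have inj: "inj_on h (univ M)" by (rule elementary_map_inj[OF h(1)])
  have hg: "h \<circ> (?g \<circ> s) = s" if "s \<in> assignments N" for s
    using that h(2) by (auto simp: fun_eq_iff f_inv_into_f)
  have g: "?g \<circ> s \<in> assignments M" if "s \<in> assignments N" for s
    using that h(2) by (auto intro!: assignmentsI inv_into_into)
  have "sat N s \<phi> \<longleftrightarrow> sat M (?g \<circ> s) \<phi>" if "wf_fm L \<phi>" "s \<in> assignments N" for s \<phi>
    using elementary_map_sat[OF h(1) that(1) g[OF that(2)]] hg[OF that(2)] by simp
  moreover have "?g ` univ N = univ M" using inj h(2) by (metis inv_into_image_cancel order_refl)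
  ultimately have "elementary_map L N M ?g \<and> ?g ` univ N = univ M"
    using h(1) unfolding elementary_map_def by auto
  then show ?thesis unfolding iso_iff_elementary by blast
qed

lemma iso_trans: "iso L M N \<Longrightarrow> iso L N P \<Longrightarrow> iso L M P"
  unfolding iso_iff_elementary
proof (elim exE conjE)
  fix g h assume "elementary_map L M N g" "g ` univ M = univ N" "elementary_map L N P h" "h ` univ N = univ P"
  then have "elementary_map L M P (h \<circ> g) \<and> (h \<circ> g) ` univ M = univ P"
    using elementary_map_comp by (metis image_comp)
  then show "\<exists>h. elementary_map L M P h \<and> h ` univ M = univ P" by blast
qed

lemma iso_elem_equiv: "iso L M N \<Longrightarrow> elem_equiv L M N"
  unfolding iso_iff_elementary elem_equiv_def
  by (blast dest: elementary_map_Th elementary_map_struct)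

lemma iso_card: "iso L M N \<Longrightarrow> |univ M| =o |univ N|"
  unfolding iso_def using card_of_ordIso by blast

text \<open>The copy of a structure along a map that is injective on its domain. The inverse of the map
  recovers the arguments, and the restrictions make the interpretations extensional.\<close>

definition push :: "('f, 'r) lang \<Rightarrow> ('u \<Rightarrow> 'v) \<Rightarrow> ('f, 'r, 'u) struct \<Rightarrow> ('f, 'r, 'v) struct" where
  "push L h M =
     \<lparr>univ = h ` univ M,
      fint = (\<lambda>f\<in>funs L. \<lambda>xs\<in>tuples (h ` univ M) (far L f). h (fint M f (map (inv_into (univ M) h) xs))),
      rint = (\<lambda>r\<in>rels L. map h ` rint M r)\<rparr>"

lemma tuples_image: "tuples (h ` A) k = map h ` tuples A k"
proof
  show "tuples (h ` A) k \<subseteq> map h ` tuples A k"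
  proof
    fix xs assume "xs \<in> tuples (h ` A) k"
    then have "length xs = k" "set xs \<subseteq> h ` A" by (auto simp: tuples_def)
    then have "map h (map (inv_into A h) xs) = xs" "map (inv_into A h) xs \<in> tuples A k"
      by (auto simp: map_idI f_inv_into_f subset_iff tuples_def inv_into_into)
    then show "xs \<in> map h ` tuples A k" by (metis imageI)
  qed
  show "map h ` tuples A k \<subseteq> tuples (h ` A) k" unfolding tuples_def by fastforce
qed

lemma push_elementary:
  assumes M: "is_struct L M" and inj: "inj_on h (univ M)"
  shows "elementary_map L M (push L h M) h" and "univ (push L h M) = h ` univ M"
proof -
  have inv: "map (inv_into (univ M) h) (map h xs) = xs" if "xs \<in> tuples (univ M) k" for xs k
    using that inj by (auto simp: tuples_def map_idI inv_into_f_f subset_iff)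
  have u: "univ (push L h M) = h ` univ M" by (simp add: push_def)
  have "is_struct L (push L h M)"
    unfolding is_struct_def
  proof (intro conjI)
    show "univ (push L h M) \<noteq> {}" using M by (simp add: u is_struct_def)
    show "fint (push L h M) \<in> (\<Pi>\<^sub>E f\<in>funs L. tuples (univ (push L h M)) (far L f) \<rightarrow>\<^sub>E univ (push L h M))"
      using fint_in[OF M] inv by (auto simp: push_def tuples_image)
    show "rint (push L h M) \<in> (\<Pi>\<^sub>E r\<in>rels L. Pow (tuples (univ (push L h M)) (rar L r)))"
      using rint_tuples[OF M] by (auto simp: push_def tuples_image)
  qed
  moreover have "map h xs \<in> rint (push L h M) r \<longleftrightarrow> xs \<in> rint M r"
    if r: "r \<in> rels L" "xs \<in> tuples (univ M) (rar L r)" for xs r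
  proof -
    have "inj_on (map h) (tuples (univ M) (rar L r))"
      using inv by (metis inj_on_def)
    then show ?thesis
      using r rint_tuples[OF M r(1)] by (auto simp: push_def dest!: inj_onD)
  qed
  moreover have "h (fint M f xs) = fint (push L h M) f (map h xs)"
    if "f \<in> funs L" "xs \<in> tuples (univ M) (far L f)" for xs f
    using that inv[OF that(2)] by (simp add: push_def tuples_image)
  ultimately show "elementary_map L M (push L h M) h"
    using M inj u by (intro iso_map_elementary) (auto simp: bij_betw_def)
  show "univ (push L h M) = h ` univ M" by (rule u)
qed

lemma elem_sub_elementary: "elem_sub L E M \<Longrightarrow> elementary_map L E M id"
  unfolding elem_sub_def substruct_def elementary_map_def by auto

text \<open>The substructure is the copy of \<open>M\<close> along \<open>h\<close>: preserving the atomic formulas for a symbol means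
  that the copy interprets the symbol as \<open>N\<close> does.\<close>

lemma elementary_map_range:
  fixes M N :: "('f, 'r, 'u) struct"
  assumes h: "elementary_map L M N h"
  shows "\<exists>E. iso L M E \<and> elem_sub L E N"
proof -
  let ?E = "push L h M"
  have M: "is_struct L M" and N: "is_struct L N" and sub: "h ` univ M \<subseteq> univ N"
    using h by (auto simp: elementary_map_def)
  have e: "elementary_map L M ?E h" and u: "univ ?E = h ` univ M"
    using push_elementary[OF M elementary_map_inj[OF h]] by auto
  have E: "is_struct L ?E" using e by (simp add: elementary_map_def)
  have "iso L M ?E" unfolding iso_iff_elementary using e u by blast
  moreover have "substruct L ?E N"
    unfolding substruct_def
  proof (intro conjI ballI)
    show "is_struct L ?E" "is_struct L N" "univ ?E \<subseteq> univ N" using E N sub u by auto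
    fix f xs assume f: "f \<in> funs L" "xs \<in> tuples (univ ?E) (far L f)"
    then obtain ys where "ys \<in> tuples (univ M) (far L f)" "xs = map h ys"
      unfolding u tuples_image by blast
    then show "fint ?E f xs = fint N f xs"
      using elementary_map_fint[OF e f(1)] elementary_map_fint[OF h f(1)] by metis
  next
    fix r assume r: "r \<in> rels L"
    have "xs \<in> rint ?E r \<longleftrightarrow> xs \<in> rint N r" if "xs \<in> tuples (univ ?E) (rar L r)" for xs
    proof -
      obtain ys where "ys \<in> tuples (univ M) (rar L r)" "xs = map h ys"
        using \<open>xs \<in> tuples (univ ?E) (rar L r)\<close> unfolding u tuples_image by blast
      then show ?thesis
        using elementary_map_rint[OF e r] elementary_map_rint[OF h r] by metis
    qed
    then show "rint ?E r = rint N r \<inter> tuples (univ ?E) (rar L r)"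
      using rint_tuples[OF E r] by blast
  qed
  moreover have "sat ?E s \<phi> \<longleftrightarrow> sat N s \<phi>" if "wf_fm L \<phi>" "s \<in> assignments ?E" for \<phi> s
  proof -
    let ?t = "inv_into (univ M) h \<circ> s"
    have si: "s i \<in> h ` univ M" for i using assignments_in[OF that(2)] u by simp
    have t: "?t \<in> assignments M" "h \<circ> ?t = s"
      using si by (auto intro!: assignmentsI inv_into_into simp: fun_eq_iff f_inv_into_f)
    then show ?thesis
      using elementary_map_sat[OF e that(1) t(1)] elementary_map_sat[OF h that(1) t(1)] by simp
  qed
  ultimately show ?thesis unfolding elem_sub_def by blast
qed

text \<open>Equations make the map \<open>y i \<mapsto> b i\<close> well defined. Every assignment in \<open>M\<close> is a reindexing of \<open>y\<close>, so
  by substitution what it satisfies is determined by what \<open>y\<close> satisfies.\<close>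

lemma enumeration_elementary_map:
  assumes M: "is_struct L M" and N: "is_struct L N"
    and y: "range y = univ M" and b: "b \<in> assignments N"
    and same: "\<And>\<phi>. wf_fm L \<phi> \<Longrightarrow> sat M y \<phi> \<longleftrightarrow> sat N b \<phi>"
  shows "\<exists>h. elementary_map L M N h \<and> h ` univ M = range b"
proof -
  have eq: "y i = y j \<longleftrightarrow> b i = b j" for i j
    using same[of "Eq (Var i) (Var j)"] by simp
  define h where "h x = b (SOME i. y i = x)" for x
  have hy: "h (y i) = b i" for i
    unfolding h_def using eq someI[of "\<lambda>j. y j = y i" i] by auto
  have "sat M s \<phi> \<longleftrightarrow> sat N (h \<circ> s) \<phi>" if "wf_fm L \<phi>" "s \<in> assignments M" for \<phi> s
  proof -
    have "\<forall>i. \<exists>j. s i = y j" using that(2) y by (metis assignments_in rangeE)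
    then obtain \<sigma> where \<sigma>: "\<And>i. s i = y (\<sigma> i)" by metis
    then have "s = y \<circ> \<sigma>" "h \<circ> s = b \<circ> \<sigma>" by (auto simp: fun_eq_iff hy)
    then show ?thesis using same[of "sub \<phi> \<sigma>"] that(1) by (simp add: sat_sub)
  qed
  moreover have "h ` univ M = range b" unfolding y[symmetric] by (auto simp: hy image_iff)
  moreover have "range b \<subseteq> univ N" using b by (auto simp: assignments_def)
  ultimately show ?thesis using M N by (intro exI[of _ h]) (auto simp: elementary_map_def)
qed

section \<open>A free ultrafilter on the natural numbers\<close>

text \<open>A maximal filter \<open>F\<close> among those containing all tails decides every set \<open>S\<close>: if the complement of
  \<open>S\<close> is not in \<open>F\<close>, then \<open>F\<close> and \<open>S\<close> together generate a filter.\<close>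

lemma ex_free_ultrafilter:
  "\<exists>U :: nat filter. U \<noteq> bot \<and> U \<le> sequentially \<and>
     (\<forall>P. eventually P U \<or> eventually (\<lambda>i. \<not> P i) U)"
proof -
  define \<F> where "\<F> = {F :: nat set set. {} \<notin> F \<and> (\<forall>n. {n..} \<in> F) \<and>
    (\<forall>A\<in>F. \<forall>B\<in>F. A \<inter> B \<in> F) \<and> (\<forall>A\<in>F. \<forall>B. A \<subseteq> B \<longrightarrow> B \<in> F)}"
  have "{A. \<exists>n. {n..} \<subseteq> A} \<in> \<F>"
    unfolding \<F>_def
  proof (intro CollectI conjI ballI allI impI)
    fix A B :: "nat set" assume "A \<in> {A. \<exists>n. {n..} \<subseteq> A}" "B \<in> {A. \<exists>n. {n..} \<subseteq> A}"
    then obtain m n where "{m..} \<subseteq> A" "{n..} \<subseteq> B" by auto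
    then have "{max m n..} \<subseteq> A \<inter> B" by auto
    then show "\<exists>n. {n..} \<subseteq> A \<inter> B" by blast
  qed auto
  then have ne: "\<F> \<noteq> {}" by blast
  have "\<Union>\<C> \<in> \<F>" if ne': "\<C> \<noteq> {}" and chain: "subset.chain \<F> \<C>" for \<C>
  proof -
    have sub: "\<C> \<subseteq> \<F>" and ch: "\<And>F G. F \<in> \<C> \<Longrightarrow> G \<in> \<C> \<Longrightarrow> F \<subseteq> G \<or> G \<subseteq> F"
      using chain by (auto simp: subset_chain_def)
    have "A \<inter> B \<in> \<Union>\<C>" if AB: "A \<in> \<Union>\<C>" "B \<in> \<Union>\<C>" for A B
    proof -
      obtain F G where FG: "F \<in> \<C>" "A \<in> F" "G \<in> \<C>" "B \<in> G" using AB by blast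
      then obtain H where H: "H \<in> \<C>" "A \<in> H" "B \<in> H" using ch[of F G] by blast
      then have "H \<in> \<F>" using sub by blast
      then have "A \<inter> B \<in> H" using H by (simp add: \<F>_def)
      then show ?thesis using H(1) by blast
    qed
    moreover have "{} \<notin> \<Union>\<C>" using sub unfolding \<F>_def by blast
    moreover have "{n..} \<in> \<Union>\<C>" for n
    proof -
      obtain F where F: "F \<in> \<C>" using ne' by blast
      then have "F \<in> \<F>" using sub by blast
      then have "{n..} \<in> F" by (simp add: \<F>_def)
      then show ?thesis using F by blast
    qed
    moreover have "B \<in> \<Union>\<C>" if AB: "A \<in> \<Union>\<C>" "A \<subseteq> B" for A B
    proof -
      obtain F where "F \<in> \<C>" "A \<in> F" using AB(1) by blast
      then have "F \<in> \<F>" using sub by blast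
      then have "B \<in> F" using \<open>A \<in> F\<close> AB(2) by (simp add: \<F>_def)
      then show ?thesis using \<open>F \<in> \<C>\<close> by blast
    qed
    ultimately show ?thesis
      unfolding \<F>_def by (intro CollectI conjI ballI allI impI) simp_all
  qed
  from subset_Zorn_nonempty[OF ne this]
  obtain F where F: "F \<in> \<F>" and max: "\<And>G. G \<in> \<F> \<Longrightarrow> F \<subseteq> G \<Longrightarrow> G = F" by metis
  have F0: "{} \<notin> F" and Ftail: "\<And>n. {n..} \<in> F"
    and Fint: "\<And>A B. A \<in> F \<Longrightarrow> B \<in> F \<Longrightarrow> A \<inter> B \<in> F"
    and Fup: "\<And>A B. A \<in> F \<Longrightarrow> A \<subseteq> B \<Longrightarrow> B \<in> F"
    using F by (simp_all add: \<F>_def)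
  have ultra: "S \<in> F \<or> - S \<in> F" for S
  proof (rule ccontr)
    assume n: "\<not> (S \<in> F \<or> - S \<in> F)"
    let ?G = "{X. \<exists>Y\<in>F. Y \<inter> S \<subseteq> X}"
    have "?G \<in> \<F>"
      unfolding \<F>_def
    proof (intro CollectI conjI ballI allI impI)
      show "{} \<notin> ?G"
      proof
        assume "{} \<in> ?G"
        then obtain Y where "Y \<in> F" "Y \<subseteq> - S" by blast
        then show False using n Fup by blast
      qed
      fix A B assume "A \<in> ?G" "B \<in> ?G"
      then obtain Y Z where "Y \<in> F" "Y \<inter> S \<subseteq> A" "Z \<in> F" "Z \<inter> S \<subseteq> B" by blast
      then show "\<exists>Y\<in>F. Y \<inter> S \<subseteq> A \<inter> B" using Fint[of Y Z] by blast
    qed (use Ftail in blast)+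
    moreover have "F \<subseteq> ?G" by blast
    ultimately have "?G = F" by (rule max)
    moreover have "S \<in> ?G" using Ftail[of 0] by blast
    ultimately show False using n by blast
  qed
  have UF: "UNIV \<in> F" using Ftail[of 0] by simp
  define U where "U = Abs_filter (\<lambda>P. {i. P i} \<in> F)"
  have ev: "eventually P U \<longleftrightarrow> {i. P i} \<in> F" for P
    unfolding U_def
  proof (rule eventually_Abs_filter, unfold_locales)
    show "{i :: nat. True} \<in> F" using UF by simp
    fix P Q :: "nat \<Rightarrow> bool"
    show "{i. P i} \<in> F \<Longrightarrow> {i. Q i} \<in> F \<Longrightarrow> {i. P i \<and> Q i} \<in> F"
      using Fint[of "{i. P i}" "{i. Q i}"] by (simp add: Int_def)
    show "\<forall>i. P i \<longrightarrow> Q i \<Longrightarrow> {i. P i} \<in> F \<Longrightarrow> {i. Q i} \<in> F"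
      using Fup[of "{i. P i}" "{i. Q i}"] by blast
  qed
  have "U \<noteq> bot" using F0 by (simp add: trivial_limit_def ev)
  moreover have "U \<le> sequentially"
  proof (rule filter_leI)
    fix P :: "nat \<Rightarrow> bool" assume "eventually P sequentially"
    then obtain n where "\<And>i. i \<ge> n \<Longrightarrow> P i" by (auto simp: eventually_sequentially)
    then show "eventually P U" unfolding ev by (intro Fup[OF Ftail[of n]]) auto
  qed
  moreover have "\<forall>P. eventually P U \<or> eventually (\<lambda>i. \<not> P i) U"
    using ultra by (simp add: ev) (metis Collect_neg_eq)
  ultimately show ?thesis by blast
qed

definition \<U> :: "nat filter" where
  "\<U> = (SOME U. U \<noteq> bot \<and> U \<le> sequentially \<and>
     (\<forall>P. eventually P U \<or> eventually (\<lambda>i. \<not> P i) U))"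

lemma U_neq_bot: "\<U> \<noteq> bot"
  and U_le: "\<U> \<le> sequentially"
  and U_cases: "eventually P \<U> \<or> eventually (\<lambda>i. \<not> P i) \<U>"
  using someI_ex[OF ex_free_ultrafilter] unfolding \<U>_def by blast+

lemma U_not: "eventually (\<lambda>i. \<not> P i) \<U> \<longleftrightarrow> \<not> eventually P \<U>"
proof
  assume "eventually (\<lambda>i. \<not> P i) \<U>"
  then show "\<not> eventually P \<U>"
    using U_neq_bot eventually_conj[of "\<lambda>i. \<not> P i" \<U> P] by auto
qed (use U_cases in blast)

lemma U_imp: "eventually (\<lambda>i. P i \<longrightarrow> Q i) \<U> \<longleftrightarrow> (eventually P \<U> \<longrightarrow> eventually Q \<U>)"
proof
  assume "eventually (\<lambda>i. P i \<longrightarrow> Q i) \<U>"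
  then show "eventually P \<U> \<longrightarrow> eventually Q \<U>" using eventually_mp by blast
next
  assume a: "eventually P \<U> \<longrightarrow> eventually Q \<U>"
  show "eventually (\<lambda>i. P i \<longrightarrow> Q i) \<U>"
  proof (cases "eventually P \<U>")
    case True
    then show ?thesis using a by (auto elim: eventually_mono)
  next
    case False
    then have "eventually (\<lambda>i. \<not> P i) \<U>" by (simp add: U_not)
    then show ?thesis by (rule eventually_mono) simp
  qed
qed

lemma U_tail: "eventually (\<lambda>i. n \<le> i) \<U>"
  using U_le eventually_ge_at_top[of n] by (auto simp: le_filter_def)

lemma U_cong: "eventually (\<lambda>i. P i \<longleftrightarrow> Q i) \<U> \<Longrightarrow> eventually P \<U> \<longleftrightarrow> eventually Q \<U>"
  by (rule eventually_subst)

section \<open>The ultrapower\<close>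

text \<open>A canonical representative of the class of \<open>f\<close> modulo the ultrafilter. Representatives instead of
  classes have the advantage that elements of the ultrapower can be evaluated at a coordinate.\<close>

definition rep :: "'u set \<Rightarrow> (nat \<Rightarrow> 'u) \<Rightarrow> nat \<Rightarrow> 'u" where
  "rep A f = (SOME g. range g \<subseteq> A \<and> eventually (\<lambda>i. g i = f i) \<U>)"

definition upower :: "('f, 'r) lang \<Rightarrow> ('f, 'r, 'u) struct \<Rightarrow> ('f, 'r, nat \<Rightarrow> 'u) struct" where
  "upower L M = (let W = rep (univ M) ` {f. range f \<subseteq> univ M} in
     \<lparr>univ = W,
      fint = (\<lambda>f\<in>funs L. \<lambda>xs\<in>tuples W (far L f).
                rep (univ M) (\<lambda>i. fint M f (map (\<lambda>g. g i) xs))),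
      rint = (\<lambda>r\<in>rels L. {xs \<in> tuples W (rar L r).
                eventually (\<lambda>i. map (\<lambda>g. g i) xs \<in> rint M r) \<U>})\<rparr>)"

lemma rep:
  assumes "range f \<subseteq> A"
  shows "range (rep A f) \<subseteq> A" "eventually (\<lambda>i. rep A f i = f i) \<U>"
proof -
  have "\<exists>g. range g \<subseteq> A \<and> eventually (\<lambda>i. g i = f i) \<U>"
    using assms by (intro exI[of _ f]) auto
  from someI_ex[OF this] show "range (rep A f) \<subseteq> A" "eventually (\<lambda>i. rep A f i = f i) \<U>"
    unfolding rep_def by blast+
qed

lemma rep_cong:
  assumes "eventually (\<lambda>i. f i = g i) \<U>"
  shows "rep A f = rep A g"
proof -
  have "eventually (\<lambda>i. h i = f i) \<U> \<longleftrightarrow> eventually (\<lambda>i. h i = g i) \<U>" for h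
    by (rule U_cong) (use assms in \<open>auto elim: eventually_mono\<close>)
  then show ?thesis unfolding rep_def by simp
qed

lemma univ_upower: "univ (upower L M) = rep (univ M) ` {f. range f \<subseteq> univ M}"
  by (simp add: upower_def Let_def)

lemma upower_elem:
  assumes "g \<in> univ (upower L M)"
  shows "range g \<subseteq> univ M" "rep (univ M) g = g"
proof -
  obtain f where f: "range f \<subseteq> univ M" "g = rep (univ M) f" using assms by (auto simp: univ_upower)
  show "range g \<subseteq> univ M" using rep(1)[OF f(1)] f(2) by simp
  show "rep (univ M) g = g" using rep_cong[OF rep(2)[OF f(1)]] f(2) by simp
qed

lemma rep_in_upower: "range f \<subseteq> univ M \<Longrightarrow> rep (univ M) f \<in> univ (upower L M)"
  by (simp add: univ_upower)

lemma upower_eq_iff: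
  assumes "g \<in> univ (upower L M)" "h \<in> univ (upower L M)"
  shows "g = h \<longleftrightarrow> eventually (\<lambda>i. g i = h i) \<U>"
  using rep_cong[of g h "univ M"] upower_elem(2)[OF assms(1)] upower_elem(2)[OF assms(2)] by auto

lemma is_struct_upower:
  assumes M: "is_struct L M"
  shows "is_struct L (upower L M)"
  unfolding is_struct_def
proof (intro conjI)
  obtain a where "a \<in> univ M" using M by (auto simp: is_struct_def)
  then have "rep (univ M) (\<lambda>_. a) \<in> univ (upower L M)" by (intro rep_in_upower) auto
  then show "univ (upower L M) \<noteq> {}" by blast
  have "rep (univ M) (\<lambda>i. fint M f (map (\<lambda>g. g i) xs)) \<in> univ (upower L M)"
    if "f \<in> funs L" "xs \<in> tuples (univ (upower L M)) (far L f)" for f xs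
    using that upower_elem(1)
    by (intro rep_in_upower image_subsetI fint_in[OF M]) (fastforce simp: tuples_def)+
  then show "fint (upower L M) \<in>
      (\<Pi>\<^sub>E f\<in>funs L. tuples (univ (upower L M)) (far L f) \<rightarrow>\<^sub>E univ (upower L M))"
    by (auto simp: upower_def Let_def)
  show "rint (upower L M) \<in> (\<Pi>\<^sub>E r\<in>rels L. Pow (tuples (univ (upower L M)) (rar L r)))"
    by (auto simp: upower_def Let_def)
qed

definition slice :: "(nat \<Rightarrow> nat \<Rightarrow> 'u) \<Rightarrow> nat \<Rightarrow> nat \<Rightarrow> 'u" where
  "slice s i = (\<lambda>v. s v i)"

lemma val_upower:
  assumes M: "is_struct L M" and s: "s \<in> assignments (upower L M)" and t: "wf_trm L t"
  shows "eventually (\<lambda>i. val (upower L M) s t i = val M (slice s i) t) \<U>"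
  using t
proof (induction t)
  case (Var x)
  show ?case by (simp add: slice_def)
next
  case (Fun f ts)
  let ?P = "upower L M"
  let ?xs = "map (val ?P s) ts"
  have P: "is_struct L ?P" by (rule is_struct_upower[OF M])
  have xs: "?xs \<in> tuples (univ ?P) (far L f)"
    using Fun.prems val_in[OF P s] by (auto simp: tuples_def)
  have "eventually (\<lambda>i. \<forall>t\<in>set ts. val ?P s t i = val M (slice s i) t) \<U>"
    using Fun by (intro eventually_ball_finite) auto
  then have "eventually (\<lambda>i. map (\<lambda>g. g i) ?xs = map (val M (slice s i)) ts) \<U>"
    by (rule eventually_mono) auto
  moreover have "eventually (\<lambda>i. fint ?P f ?xs i = fint M f (map (\<lambda>g. g i) ?xs)) \<U>"
  proof -
    have "fint ?P f ?xs = rep (univ M) (\<lambda>i. fint M f (map (\<lambda>g. g i) ?xs))"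
      using xs Fun.prems unfolding univ_upower by (simp add: upower_def Let_def)
    moreover have "range (\<lambda>i. fint M f (map (\<lambda>g. g i) ?xs)) \<subseteq> univ M"
    proof (intro image_subsetI fint_in[OF M])
      show "f \<in> funs L" using Fun.prems by simp
      fix i
      show "map (\<lambda>g. g i) ?xs \<in> tuples (univ M) (far L f)"
        using xs upower_elem(1)[of _ L M] unfolding tuples_def by fastforce
    qed
    ultimately show ?thesis using rep(2) by simp
  qed
  ultimately show ?case
  proof eventually_elim
    case (elim i)
    then show ?case by (simp only: val.simps)
  qed
qed

lemma slice_upd: "slice (s(x := g)) i = (slice s i)(x := g i)"
  by (auto simp: slice_def)

lemma los_theorem:
  assumes M: "is_struct L M" and "s \<in> assignments (upower L M)" "wf_fm L \<phi>"
  shows "sat (upower L M) s \<phi> \<longleftrightarrow> eventually (\<lambda>i. sat M (slice s i) \<phi>) \<U>"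
  using assms(2-)
proof (induction \<phi> arbitrary: s)
  case (Eq t u)
  let ?P = "upower L M"
  have P: "is_struct L ?P" by (rule is_struct_upower[OF M])
  have wf: "wf_trm L t" "wf_trm L u" using Eq by auto
  have "sat ?P s (Eq t u) \<longleftrightarrow> eventually (\<lambda>i. val ?P s t i = val ?P s u i) \<U>"
    using upower_eq_iff[OF val_in[OF P Eq(1) wf(1)] val_in[OF P Eq(1) wf(2)]] by simp
  also have "\<dots> \<longleftrightarrow> eventually (\<lambda>i. sat M (slice s i) (Eq t u)) \<U>"
  proof (rule U_cong)
    show "eventually (\<lambda>i. val ?P s t i = val ?P s u i \<longleftrightarrow> sat M (slice s i) (Eq t u)) \<U>"
      using val_upower[OF M Eq(1) wf(1)] val_upower[OF M Eq(1) wf(2)] by eventually_elim simp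
  qed
  finally show ?case .
next
  case (Rel r ts)
  let ?P = "upower L M"
  let ?xs = "map (val ?P s) ts"
  have P: "is_struct L ?P" by (rule is_struct_upower[OF M])
  have xs: "?xs \<in> tuples (univ ?P) (rar L r)"
    using Rel.prems val_in[OF P Rel(1)] by (auto simp: tuples_def)
  have "eventually (\<lambda>i. \<forall>t\<in>set ts. val ?P s t i = val M (slice s i) t) \<U>"
    using Rel val_upower[OF M Rel(1)] by (intro eventually_ball_finite) auto
  then have "eventually (\<lambda>i. map (\<lambda>g. g i) ?xs \<in> rint M r \<longleftrightarrow>
      sat M (slice s i) (Rel r ts)) \<U>"
  proof (rule eventually_mono)
    fix i assume "\<forall>t\<in>set ts. val ?P s t i = val M (slice s i) t"
    then have "map (\<lambda>g. g i) ?xs = map (val M (slice s i)) ts" by auto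
    then show "map (\<lambda>g. g i) ?xs \<in> rint M r \<longleftrightarrow> sat M (slice s i) (Rel r ts)"
      by (simp only: sat.simps)
  qed
  then have "eventually (\<lambda>i. map (\<lambda>g. g i) ?xs \<in> rint M r) \<U> \<longleftrightarrow>
      eventually (\<lambda>i. sat M (slice s i) (Rel r ts)) \<U>"
    by (rule U_cong)
  moreover have "sat ?P s (Rel r ts) \<longleftrightarrow> eventually (\<lambda>i. map (\<lambda>g. g i) ?xs \<in> rint M r) \<U>"
    using xs Rel.prems unfolding univ_upower by (simp add: upower_def Let_def)
  ultimately show ?case by blast
next
  case (Neg \<phi>)
  then show ?case by (simp add: U_not)
next
  case (Imp \<phi> \<psi>)
  then show ?case by (simp add: U_imp)
next
  case (All x \<phi>)
  let ?P = "upower L M"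
  have "sat ?P s (All x \<phi>) \<longleftrightarrow>
      (\<forall>g\<in>univ ?P. eventually (\<lambda>i. sat M ((slice s i)(x := g i)) \<phi>) \<U>)"
  proof -
    have "sat ?P (s(x := g)) \<phi> \<longleftrightarrow> eventually (\<lambda>i. sat M ((slice s i)(x := g i)) \<phi>) \<U>"
      if "g \<in> univ ?P" for g
      using All.IH[OF assignments_upd[OF All.prems(1) that]] All.prems(2)
      unfolding slice_upd by (simp only: wf_fm.simps)
    then show ?thesis unfolding sat.simps by blast
  qed
  also have "\<dots> \<longleftrightarrow> eventually (\<lambda>i. \<forall>a\<in>univ M. sat M ((slice s i)(x := a)) \<phi>) \<U>"
  proof
    assume "eventually (\<lambda>i. \<forall>a\<in>univ M. sat M ((slice s i)(x := a)) \<phi>) \<U>"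
    moreover have "g i \<in> univ M" if "g \<in> univ ?P" for g i
      using upower_elem(1)[OF that] by auto
    ultimately show "\<forall>g\<in>univ ?P. eventually (\<lambda>i. sat M ((slice s i)(x := g i)) \<phi>) \<U>"
      by (auto elim!: eventually_mono)
  next
    assume a: "\<forall>g\<in>univ ?P. eventually (\<lambda>i. sat M ((slice s i)(x := g i)) \<phi>) \<U>"
    obtain a0 where a0: "a0 \<in> univ M" using M by (auto simp: is_struct_def)
    \<comment> \<open>pick a counterexample in every coordinate that has one\<close>
    define f where "f i = (if \<exists>a\<in>univ M. \<not> sat M ((slice s i)(x := a)) \<phi>
      then SOME a. a \<in> univ M \<and> \<not> sat M ((slice s i)(x := a)) \<phi> else a0)" for i
    have f: "f i \<in> univ M \<and> (\<forall>a\<in>univ M. \<not> sat M ((slice s i)(x := a)) \<phi> \<longrightarrow>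
        \<not> sat M ((slice s i)(x := f i)) \<phi>)" for i
      using a0 someI_ex[of "\<lambda>a. a \<in> univ M \<and> \<not> sat M ((slice s i)(x := a)) \<phi>"]
      unfolding f_def by auto
    then have rf: "range f \<subseteq> univ M" by auto
    have "eventually (\<lambda>i. sat M ((slice s i)(x := rep (univ M) f i)) \<phi>) \<U>"
      using a rep_in_upower[OF rf] by blast
    then show "eventually (\<lambda>i. \<forall>a\<in>univ M. sat M ((slice s i)(x := a)) \<phi>) \<U>"
      using rep(2)[OF rf] by eventually_elim (use f in metis)
  qed
  finally show ?case by simp
qed

text \<open>A sequence of assignments in \<open>M\<close>, read coordinatewise as one assignment in the ultrapower.\<close>

definition ulim :: "('f, 'r, 'u) struct \<Rightarrow> (nat \<Rightarrow> nat \<Rightarrow> 'u) \<Rightarrow> nat \<Rightarrow> nat \<Rightarrow> 'u" where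
  "ulim M t = (\<lambda>v. rep (univ M) (\<lambda>n. t n v))"

lemma ulim_range: "(\<And>n. t n \<in> assignments M) \<Longrightarrow> range (\<lambda>n. t n v) \<subseteq> univ M"
  by (auto simp: assignments_def)

lemma ulim_assignment: "(\<And>n. t n \<in> assignments M) \<Longrightarrow> ulim M t \<in> assignments (upower L M)"
  unfolding ulim_def by (intro assignmentsI rep_in_upower ulim_range) auto

lemma sat_ulim:
  assumes M: "is_struct L M" and t: "\<And>n. t n \<in> assignments M" and \<phi>: "wf_fm L \<phi>"
  shows "sat (upower L M) (ulim M t) \<phi> \<longleftrightarrow> eventually (\<lambda>n. sat M (t n) \<phi>) \<U>"
proof -
  have "eventually (\<lambda>n. \<forall>v\<in>fv \<phi>. slice (ulim M t) n v = t n v) \<U>"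
    using rep(2)[OF ulim_range[of t M]] t
    by (intro eventually_ball_finite) (auto simp: slice_def ulim_def)
  then have "eventually (\<lambda>n. sat M (slice (ulim M t) n) \<phi> \<longleftrightarrow> sat M (t n) \<phi>) \<U>"
    by (rule eventually_mono) (rule sat_cong, blast)
  then show ?thesis unfolding los_theorem[OF M ulim_assignment[OF t] \<phi>] by (rule U_cong)
qed

lemma Th_upower:
  assumes M: "is_struct L M"
  shows "Th L (upower L M) = Th L M"
proof -
  obtain s where s: "s \<in> assignments M" using ex_assignment[OF M] by blast
  show ?thesis
    using sat_ulim[OF M, of "\<lambda>_. s"] s ulim_assignment[of "\<lambda>_. s" M L] U_neq_bot
    by (intro Th_eqI[of "ulim M (\<lambda>_. s)" _ s]) (auto simp: formulas_def eventually_const)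
qed

text \<open>In coordinate \<open>i\<close>, choose an element that realizes an initial segment of an enumeration of the type
  that is as long as possible, but of length at most \<open>i\<close>. By Los's theorem every finite segment is
  realizable in almost all coordinates, so that each formula of the type holds almost everywhere.\<close>

lemma upower_saturated:
  assumes M: "is_struct L M" and p: "countable p" "\<And>\<phi>. \<phi> \<in> p \<Longrightarrow> wf_fm L \<phi>"
    and s: "s \<in> assignments (upower L M)"
    and fin: "\<And>F. finite F \<Longrightarrow> F \<subseteq> p \<Longrightarrow>
      \<exists>b\<in>univ (upower L M). \<forall>\<phi>\<in>F. sat (upower L M) (s(k := b)) \<phi>"
  shows "\<exists>b\<in>univ (upower L M). \<forall>\<phi>\<in>p. sat (upower L M) (s(k := b)) \<phi>"
proof (cases "p = {}")
  case True
  then show ?thesis using fin[of "{}"] by simp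
next
  case False
  let ?P = "upower L M"
  define e where "e = from_nat_into p"
  have e: "range e = p" using False p(1) by (simp add: e_def range_from_nat_into)
  then have we: "wf_fm L (e j)" for j using p(2) by auto
  define Q where "Q n m b \<longleftrightarrow> b \<in> univ M \<and> (\<forall>j<m. sat M ((slice s n)(k := b)) (e j))" for n m b
  obtain a where a: "a \<in> univ M" using M by (auto simp: is_struct_def)
  have "\<exists>b. b \<in> univ M \<and> (\<forall>m\<le>n. (\<exists>c. Q n m c) \<longrightarrow> Q n m b)" for n
  proof -
    define S where "S = {m. m \<le> n \<and> (\<exists>c. Q n m c)}"
    have fS: "finite S" by (simp add: S_def)
    moreover have "0 \<in> S" using a by (auto simp: Q_def S_def)
    ultimately have "Max S \<in> S" by (intro Max_in) auto
    then obtain b where b: "Q n (Max S) b" unfolding S_def by blast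
    have "Q n m b" if "m \<le> n" "\<exists>c. Q n m c" for m
    proof -
      have "m \<le> Max S" using Max_ge[OF fS, of m] that by (auto simp: S_def)
      then show ?thesis using b by (auto simp: Q_def)
    qed
    then show ?thesis using b by (auto simp: Q_def)
  qed
  then obtain f where f: "\<And>n. f n \<in> univ M" "\<And>n m. m \<le> n \<Longrightarrow> \<exists>c. Q n m c \<Longrightarrow> Q n m (f n)"
    by metis
  have rf: "range f \<subseteq> univ M" using f(1) by auto
  have "sat ?P (s(k := rep (univ M) f)) (e j)" for j
  proof -
    let ?\<psi> = "Exi k (conjs (map e [0..<Suc j]))"
    have "set (map e [0..<Suc j]) \<subseteq> p" using e by auto
    then have "sat ?P s ?\<psi>" unfolding sat_Exi sat_conjs by (intro fin) auto
    then have "eventually (\<lambda>n. sat M (slice s n) ?\<psi>) \<U>"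
      using los_theorem[OF M s, of ?\<psi>] we by auto
    then have "eventually (\<lambda>n. \<exists>c. Q n (Suc j) c) \<U>"
      by (rule eventually_mono) (auto simp: Q_def less_Suc_eq)
    then have "eventually (\<lambda>n. sat M ((slice s n)(k := f n)) (e j)) \<U>"
      using U_tail[of "Suc j"]
    proof eventually_elim
      case (elim n)
      then show ?case using f(2)[of "Suc j" n] by (auto simp: Q_def)
    qed
    then have "eventually (\<lambda>n. sat M (slice (s(k := rep (univ M) f)) n) (e j)) \<U>"
      using rep(2)[OF rf] by eventually_elim (simp add: slice_upd)
    then show ?thesis
      using los_theorem[OF M _ we] s rep_in_upower[OF rf] by (metis assignments_upd)
  qed
  then show ?thesis using rep_in_upower[OF rf] e by (intro bexI[of _ "rep (univ M) f"]) auto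
qed

section \<open>Countable elementary hulls\<close>

text \<open>The existence of a given finite number of distinct elements is expressed by a sentence.\<close>

lemma finite_subset_transfer:
  assumes N: "is_struct L N" and M: "is_struct L M" and Th: "Th L N = Th L M"
    and F: "finite F" "F \<subseteq> univ N"
  shows "\<exists>g. inj_on g F \<and> g ` F \<subseteq> univ M"
proof -
  obtain xs where xs: "set xs = F" "distinct xs" using finite_distinct_list[OF F(1)] by blast
  let ?\<phi> = "conjs (map (\<lambda>(i, j). Neg (Eq (Var i) (Var j)))
      (filter (\<lambda>(i, j). i \<noteq> j) (List.product [0..<length xs] [0..<length xs])))"
  have sat: "sat P s ?\<phi> \<longleftrightarrow> inj_on s {..<length xs}" for P :: "('a, 'b, 'e) struct" and s
    by (auto simp: inj_on_def)
  have sat': "sat P s ?\<phi> \<longleftrightarrow> inj_on s {..<length xs}" for P :: "('a, 'b, 'd) struct" and s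
    by (auto simp: inj_on_def)
  obtain s where s: "s \<in> assignments N" "\<And>i. i < length xs \<Longrightarrow> s i = xs ! i"
    using assignment_of_list[OF N, of xs] xs F by auto
  have "inj_on s {..<length xs}" using s(2) xs(2) by (auto simp: inj_on_def nth_eq_iff_index_eq)
  then have "\<exists>s\<in>assignments N. sat N s ?\<phi>" using s(1) unfolding sat sat' by blast
  then have "\<exists>t\<in>assignments M. sat M t ?\<phi>"
    using sat_ex_transfer[OF N M Th, of ?\<phi>] by auto
  then obtain t where t: "t \<in> assignments M" "inj_on t {..<length xs}" unfolding sat sat' by blast
  obtain h where h: "bij_betw h F {..<length xs}"
    using ex_bij_betw_finite_nat[OF F(1)] distinct_card[OF xs(2)] xs(1) by (auto simp: atLeast0LessThan)
  have "inj_on (t \<circ> h) F" using h t(2) by (auto simp: bij_betw_def intro: comp_inj_on)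
  moreover have "(t \<circ> h) ` F \<subseteq> univ M" using t(1) by auto
  ultimately show ?thesis by blast
qed

lemma finite_transfer:
  assumes N: "is_struct L N" and M: "is_struct L M" and Th: "Th L N = Th L M" and "finite (univ M)"
  shows "finite (univ N)"
proof (rule ccontr)
  assume "infinite (univ N)"
  then obtain F where F: "F \<subseteq> univ N" "finite F" "card F = Suc (card (univ M))"
    using infinite_arbitrarily_large by blast
  then obtain g where "inj_on g F" "g ` F \<subseteq> univ M" using finite_subset_transfer[OF N M Th] by blast
  then have "card F \<le> card (univ M)" using assms(4) by (metis card_inj_on_le)
  then show False using F by simp
qed

text \<open>If \<open>M\<close> is finite then so is \<open>N\<close>, and otherwise \<open>M\<close> has room for every countable set. Hence this holds for
  finite universes too.\<close>

lemma countable_subset_transfer: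
  assumes N: "is_struct L N" and M: "is_struct L M" and Th: "Th L N = Th L M"
    and A: "countable A" "A \<subseteq> univ N"
  shows "\<exists>g. inj_on g A \<and> g ` A \<subseteq> univ M"
proof (cases "finite A")
  case True
  then show ?thesis using finite_subset_transfer[OF N M Th] A by blast
next
  case False
  then have "infinite (univ M)" using finite_transfer[OF N M Th] A(2) finite_subset by blast
  then obtain e :: "nat \<Rightarrow> 'd" where e: "inj e" "range e \<subseteq> univ M"
    using infinite_countable_subset by blast
  have "inj_on (e \<circ> to_nat_on A) A"
    using e(1) inj_on_to_nat_on[OF A(1)] by (meson comp_inj_on inj_on_subset subset_UNIV)
  moreover have "(e \<circ> to_nat_on A) ` A \<subseteq> univ M" using e(2) by auto
  ultimately show ?thesis by blast
qed

definition restr :: "('f, 'r) lang \<Rightarrow> ('f, 'r, 'u) struct \<Rightarrow> 'u set \<Rightarrow> ('f, 'r, 'u) struct" where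
  "restr L M A =
     \<lparr>univ = A, fint = (\<lambda>f\<in>funs L. \<lambda>xs\<in>tuples A (far L f). fint M f xs),
      rint = (\<lambda>r\<in>rels L. rint M r \<inter> tuples A (rar L r))\<rparr>"

text \<open>The Tarski-Vaught test, for the assignment \<open>s\<close> alone. Every assignment into the range of \<open>s\<close> is a
  reindexing of \<open>s\<close>, and substitution turns formulas about it into formulas about \<open>s\<close>; in the quantifier
  step the substitution sends the quantified variable to a fresh one.\<close>

lemma tarski_vaught:
  assumes P: "is_struct L P" and s: "s \<in> assignments P"
    and tv: "\<And>\<phi> x a. wf_fm L \<phi> \<Longrightarrow> a \<in> univ P \<Longrightarrow> sat P (s(x := a)) \<phi> \<Longrightarrow>
      \<exists>y. sat P (s(x := s y)) \<phi>"
  shows "elementary_map L (restr L P (range s)) P id"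
proof -
  let ?R = "restr L P (range s)"
  have sub: "range s \<subseteq> univ P" using s by (auto simp: assignments_def)
  have lift: "\<exists>\<sigma>. t = s \<circ> \<sigma>" if "range t \<subseteq> range s" for t :: "nat \<Rightarrow> 'c"
  proof -
    have "\<forall>i. \<exists>j. t i = s j" using that by blast
    then obtain \<sigma> where "\<forall>i. t i = s (\<sigma> i)" by metis
    then show ?thesis by (auto simp: fun_eq_iff)
  qed
  have f: "fint P f xs \<in> range s" if "f \<in> funs L" "xs \<in> tuples (range s) (far L f)" for f xs
  proof -
    have xs: "length xs = far L f" "set xs \<subseteq> range s" using that by (auto simp: tuples_def)
    have "xs \<in> lists (range s)" using xs by auto
    then obtain js where js: "xs = map s js" by (metis lists_image imageE)
    define x where "x = Suc (Max (insert 0 (set js)))"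
    have x: "j \<noteq> x" if "j \<in> set js" for j
      using Suc_Max_fresh[of "set js" j] that by (auto simp: x_def)
    let ?\<phi> = "Eq (Var x) (Fun f (map Var js))"
    have e: "map (val P (s(x := a))) (map Var js) = xs" for a
      using x by (auto simp: js)
    have "fint P f xs \<in> univ P" using that sub by (intro fint_in[OF P]) (auto simp: tuples_def)
    moreover have "sat P (s(x := fint P f xs)) ?\<phi>" unfolding sat.simps val.simps e by simp
    moreover have "wf_fm L ?\<phi>" using that xs js by auto
    ultimately obtain y where "sat P (s(x := s y)) ?\<phi>" using tv by blast
    then have "s y = fint P f xs" unfolding sat.simps val.simps e by simp
    then show ?thesis by (metis rangeI)
  qed
  have R: "is_struct L ?R"
    unfolding is_struct_def using f by (auto simp: restr_def)
  have fR: "fint ?R f ys = fint P f ys" if "f \<in> funs L" "ys \<in> tuples (univ ?R) (far L f)" for f ys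
    using that by (simp add: restr_def)
  have rR: "ys \<in> rint ?R r \<longleftrightarrow> ys \<in> rint P r" if "r \<in> rels L" "ys \<in> tuples (univ ?R) (rar L r)" for r ys
    using that by (simp add: restr_def)
  have v: "val ?R t u = val P t u" if "wf_trm L u" "t \<in> assignments ?R" for t u
    using that
  proof (induction u)
    case (Fun f us)
    have "map (val ?R t) us = map (val P t) us" using Fun by auto
    moreover have "map (val ?R t) us \<in> tuples (univ ?R) (far L f)"
      using val_in[OF R Fun.prems(2)] Fun.prems(1) by (auto simp: tuples_def)
    ultimately show ?case using fR[of f "map (val ?R t) us"] Fun.prems
      by (metis val.simps(2) wf_trm.simps(2))
  qed simp
  have "sat ?R t \<phi> \<longleftrightarrow> sat P t \<phi>" if "wf_fm L \<phi>" "t \<in> assignments ?R" for t \<phi>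
    using that
  proof (induction \<phi> arbitrary: t)
    case (Rel r us)
    have "map (val ?R t) us = map (val P t) us" using Rel v by auto
    moreover have "map (val ?R t) us \<in> tuples (univ ?R) (rar L r)"
      using val_in[OF R Rel.prems(2)] Rel.prems(1) by (auto simp: tuples_def)
    ultimately show ?case using rR[of r "map (val ?R t) us"] Rel.prems
      by (metis sat.simps(2) wf_fm.simps(2))
  next
    case (All x \<phi>)
    have IH: "sat ?R (t(x := a)) \<phi> \<longleftrightarrow> sat P (t(x := a)) \<phi>" if "a \<in> range s" for a
      using All that by (intro All.IH assignments_upd) (auto simp: restr_def)
    obtain \<sigma> where \<sigma>: "t = s \<circ> \<sigma>"
      using lift[of t] All.prems(2) by (auto simp: assignments_def restr_def)
    define z where "z = Suc (Max (insert 0 (\<sigma> ` fv \<phi>)))"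
    have z: "\<sigma> y \<noteq> z" if "y \<in> fv \<phi>" for y
      using Suc_Max_fresh[of "\<sigma> ` fv \<phi>" "\<sigma> y"] that by (auto simp: z_def)
    have sw: "sat P (s(z := a)) (sub (Neg \<phi>) (\<sigma>(x := z))) \<longleftrightarrow> \<not> sat P (t(x := a)) \<phi>" for a
    proof -
      have "sat P (s(z := a) \<circ> \<sigma>(x := z)) \<phi> \<longleftrightarrow> sat P (t(x := a)) \<phi>"
        using z \<sigma> by (intro sat_cong) auto
      then show ?thesis by (simp add: sat_sub)
    qed
    have "\<exists>a\<in>range s. \<not> sat P (t(x := a)) \<phi>" if "a \<in> univ P" "\<not> sat P (t(x := a)) \<phi>" for a
      using tv[of "sub (Neg \<phi>) (\<sigma>(x := z))" a z] that All.prems(1) unfolding sw by auto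
    then have "sat P t (All x \<phi>) \<longleftrightarrow> (\<forall>a\<in>range s. sat P (t(x := a)) \<phi>)"
      using sub by (simp only: sat.simps) blast
    then show ?case using IH by (simp add: restr_def)
  qed (use v in auto)
  then show ?thesis using R P sub by (auto simp: elementary_map_def restr_def)
qed

text \<open>By the Tarski-Vaught test the range of \<open>s\<close> is an elementary substructure; being countable, it fits into the
  universe of \<open>M\<close>.\<close>

lemma countable_hull:
  fixes M :: "('f, 'r, 'u) struct" and P :: "('f, 'r, 'v) struct"
  assumes M: "is_struct L M" and P: "is_struct L P" and Th: "Th L P = Th L M"
    and s: "s \<in> assignments P"
    and tv: "\<And>\<phi> x a. wf_fm L \<phi> \<Longrightarrow> a \<in> univ P \<Longrightarrow> sat P (s(x := a)) \<phi> \<Longrightarrow>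
      \<exists>y. sat P (s(x := s y)) \<phi>"
  obtains N :: "('f, 'r, 'u) struct" and t where
    "is_struct L N" "Th L N = Th L M" "range t = univ N"
    "\<And>\<phi>. wf_fm L \<phi> \<Longrightarrow> sat N t \<phi> \<longleftrightarrow> sat P s \<phi>"
proof -
  let ?R = "restr L P (range s)"
  have R: "elementary_map L ?R P id" by (rule tarski_vaught[OF P s tv])
  have sub: "range s \<subseteq> univ P" using s by (auto simp: assignments_def)
  then obtain g where g: "inj_on g (range s)" "g ` range s \<subseteq> univ M"
    using countable_subset_transfer[OF P M Th, of "range s"] by auto
  let ?N = "push L g ?R"
  have uR: "univ ?R = range s" by (simp add: restr_def)
  have N: "elementary_map L ?R ?N g" "univ ?N = g ` range s"
    using push_elementary[OF elementary_map_struct(1)[OF R]] g(1) by (auto simp: uR)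
  have sR: "s \<in> assignments ?R" by (auto simp: assignments_def uR)
  show thesis
  proof (rule that[of ?N "g \<circ> s"])
    show "is_struct L ?N" by (rule elementary_map_struct(2)[OF N(1)])
    show "Th L ?N = Th L M"
      using elementary_map_Th[OF N(1)] elementary_map_Th[OF R] Th by simp
    show "range (g \<circ> s) = univ ?N" using N(2) by auto
    fix \<phi> assume "wf_fm L \<phi>"
    then show "sat ?N (g \<circ> s) \<phi> \<longleftrightarrow> sat P s \<phi>"
      using elementary_map_sat[OF N(1) _ sR] elementary_map_sat[OF R _ sR] by simp
  qed
qed

section \<open>Generic models\<close>

definition agree :: "nat \<Rightarrow> (nat \<Rightarrow> 'u) \<Rightarrow> (nat \<Rightarrow> 'u) \<Rightarrow> bool" where
  "agree k s t \<longleftrightarrow> (\<forall>i<k. s i = t i)"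

definition tp :: "('f, 'r) lang \<Rightarrow> ('f, 'r, 'u) struct \<Rightarrow> nat \<Rightarrow> (nat \<Rightarrow> 'u) \<Rightarrow> ('f, 'r) fm set" where
  "tp L M k s = {\<phi> \<in> formulas L k. sat M s \<phi>}"

definition finsat :: "('f, 'r, 'u) struct \<Rightarrow> ('f, 'r) fm set \<Rightarrow> bool" where
  "finsat M p \<longleftrightarrow> (\<forall>F. finite F \<longrightarrow> F \<subseteq> p \<longrightarrow> (\<exists>t\<in>assignments M. \<forall>\<phi>\<in>F. sat M t \<phi>))"

lemma agree_0 [simp]: "agree 0 s t"
  by (simp add: agree_def)

lemma agree_refl [simp]: "agree k s s"
  by (simp add: agree_def)

lemma agree_upd [simp]: "agree k (s(k := a)) t \<longleftrightarrow> agree k s t" "agree k s (t(k := a)) \<longleftrightarrow> agree k s t"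
  by (auto simp: agree_def)

lemma agree_Suc: "agree (Suc k) s t \<longleftrightarrow> agree k s t \<and> s k = t k"
  by (auto simp: agree_def less_Suc_eq)

lemma agree_sym: "agree k s t \<Longrightarrow> agree k t s"
  by (simp add: agree_def)

lemma agree_trans: "agree k s t \<Longrightarrow> agree k t u \<Longrightarrow> agree k s u"
  by (simp add: agree_def)

lemma sat_agree: "\<phi> \<in> formulas L k \<Longrightarrow> agree k s t \<Longrightarrow> sat M s \<phi> \<longleftrightarrow> sat M t \<phi>"
  by (rule sat_formulas_cong) (auto simp: agree_def)

lemma tp_agree: "agree k s t \<Longrightarrow> tp L M k s = tp L M k t"
  using sat_agree by (fastforce simp: tp_def)

lemma tp_formulas: "tp L M k s \<subseteq> formulas L k"
  by (auto simp: tp_def)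

lemma finsat_tp:
  assumes "s \<in> assignments M"
  shows "finsat M (tp L M k s)"
  unfolding finsat_def using assms by (auto simp: tp_def)

lemma finsat_realized: "s \<in> assignments M \<Longrightarrow> \<forall>\<phi>\<in>p. sat M s \<phi> \<Longrightarrow> finsat M p"
  unfolding finsat_def by blast

lemma finsat_transfer:
  assumes "is_struct L M" "is_struct L N" "Th L M = Th L N" and p: "\<And>\<phi>. \<phi> \<in> p \<Longrightarrow> wf_fm L \<phi>"
    and "finsat M p"
  shows "finsat N p"
  unfolding finsat_def
proof (intro allI impI)
  fix F assume F: "finite F" "F \<subseteq> p"
  then obtain fs where fs: "set fs = F" using finite_list by blast
  have "\<exists>s\<in>assignments M. sat M s (conjs fs)" using assms(5) F fs unfolding finsat_def by simp
  then have "\<exists>s\<in>assignments N. sat N s (conjs fs)"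
    using sat_ex_transfer[OF assms(1-3), of "conjs fs"] p F fs by auto
  then show "\<exists>s\<in>assignments N. \<forall>\<phi>\<in>F. sat N s \<phi>" using fs by simp
qed

lemma sat_witness:
  "x \<noteq> y \<Longrightarrow> s \<in> assignments M \<Longrightarrow>
   sat M s (Exi x (Conj (Eq (Var x) (Var y)) \<phi>)) \<longleftrightarrow> sat M (s(x := s y)) \<phi>"
  by auto

text \<open>The requirements \<open>D j\<close> are dense among the formulas that are finitely satisfiable together with \<open>p\<close>.
  They are met one after the other, alternating with requirements that provide Henkin witnesses: for
  each formula \<open>\<psi>\<close> and variable \<open>x\<close>, a fresh variable \<open>y\<close> shall satisfy \<open>\<exists>x. \<psi> \<longrightarrow> \<psi>[y/x]\<close>. The latter are
  dense since finitely many variables occur in \<open>p\<close>. If \<open>t n\<close> satisfies the \<open>n\<close>-th formula of the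
  resulting decreasing sequence and the first \<open>n\<close> formulas of \<open>p\<close>, then the sequence \<open>t\<close>, read as one
  assignment in the ultrapower, satisfies everything, and its range passes the Tarski-Vaught test.\<close>

lemma generic_model:
  fixes M :: "('f, 'r, 'u) struct" and D :: "nat \<Rightarrow> ('f, 'r) fm \<Rightarrow> bool"
  assumes L: "countable_lang L" and M: "is_struct L M"
    and p: "p \<subseteq> formulas L k" "finsat M p"
    and dense: "\<And>j \<phi>. wf_fm L \<phi> \<Longrightarrow> finsat M (insert \<phi> p) \<Longrightarrow>
      \<exists>\<chi>. wf_fm L \<chi> \<and> finsat M (insert (Conj \<phi> \<chi>) p) \<and> D j \<chi>"
  obtains N :: "('f, 'r, 'u) struct" and t where
    "is_struct L N" "Th L N = Th L M" "range t = univ N" "\<And>\<phi>. \<phi> \<in> p \<Longrightarrow> sat N t \<phi>"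
    "\<And>j. \<exists>\<chi>. wf_fm L \<chi> \<and> D j \<chi> \<and> sat N t \<chi>"
proof -
  let ?W = "{\<phi>. wf_fm L \<phi>} \<times> (UNIV :: nat set)"
  define e where "e = from_nat_into ?W"
  have "(Tr, 0) \<in> ?W" by simp
  then have "?W \<noteq> {}" by blast
  moreover have "countable ?W" by (intro countable_SIGMA countable_formulas[OF L]) auto
  ultimately have e: "range e = ?W" unfolding e_def by (intro range_from_nat_into)
  \<comment> \<open>a Henkin witness for the \<open>j\<close>-th pair of a formula and a variable; even steps of the
    construction serve \<open>D\<close>, odd ones serve \<open>H\<close>\<close>
  define H where "H j \<chi> \<longleftrightarrow> (\<exists>y. snd (e j) \<noteq> y \<and> \<chi> = Imp (Exi (snd (e j)) (fst (e j)))
      (Exi (snd (e j)) (Conj (Eq (Var (snd (e j))) (Var y)) (fst (e j)))))" for j \<chi>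
  define D' where "D' j = (if even j then D (j div 2) else H (j div 2))" for j
  have denseH: "\<exists>\<chi>. wf_fm L \<chi> \<and> finsat M (insert (Conj \<phi> \<chi>) p) \<and> H j \<chi>"
    if \<phi>: "wf_fm L \<phi>" "finsat M (insert \<phi> p)" for \<phi> j
  proof -
    obtain \<psi> x where ej: "e j = (\<psi>, x)" by fastforce
    have "(\<psi>, x) \<in> ?W" unfolding e[symmetric] ej[symmetric] by (rule rangeI)
    then have \<psi>: "wf_fm L \<psi>" by simp
    let ?X = "fv \<phi> \<union> fv \<psi> \<union> {x} \<union> {..<k}"
    \<comment> \<open>the variable of the witness must be new to \<open>p\<close> as well\<close>
    obtain y where y: "y \<notin> ?X" using ex_new_if_finite[of ?X] by (auto simp: infinite_UNIV_nat)
    let ?\<chi> = "Imp (Exi x \<psi>) (Exi x (Conj (Eq (Var x) (Var y)) \<psi>))"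
    have "finsat M (insert (Conj \<phi> ?\<chi>) p)"
      unfolding finsat_def
    proof (intro allI impI)
      fix F assume F: "finite F" "F \<subseteq> insert (Conj \<phi> ?\<chi>) p"
      then obtain t where t: "t \<in> assignments M" "\<forall>\<theta>\<in>insert \<phi> (F \<inter> p). sat M t \<theta>"
        using \<phi>(2) unfolding finsat_def by (metis finite_Int finite_insert inf_le2 insert_mono)
      have "\<exists>t'\<in>assignments M. sat M t' ?\<chi> \<and> (\<forall>i. i \<noteq> y \<longrightarrow> t' i = t i)"
      proof (cases "sat M t (Exi x \<psi>)")
        case True
        then obtain b where b: "b \<in> univ M" "sat M (t(x := b)) \<psi>" by auto
        have t': "t(y := b) \<in> assignments M" using t(1) b(1) by simp
        have "sat M ((t(y := b))(x := b)) \<psi> \<longleftrightarrow> sat M (t(x := b)) \<psi>"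
          by (rule sat_cong) (use y in auto)
        then have "sat M ((t(y := b))(x := b)) \<psi>" using b(2) by blast
        then have "sat M (t(y := b)) (Exi x (Conj (Eq (Var x) (Var y)) \<psi>))"
          using sat_witness[OF _ t', of x y \<psi>] y by simp
        then have "sat M (t(y := b)) ?\<chi>" by simp
        then show ?thesis using t' by (metis fun_upd_other)
      qed (use t(1) in auto)
      then obtain t' where t': "t' \<in> assignments M" "sat M t' ?\<chi>" "\<And>i. i \<noteq> y \<Longrightarrow> t' i = t i"
        by blast
      have "sat M t' \<theta> \<longleftrightarrow> sat M t \<theta>" if "y \<notin> fv \<theta>" for \<theta>
        using that t'(3) by (intro sat_cong) metis
      moreover have "y \<notin> fv \<theta>" if "\<theta> \<in> p" for \<theta>
        using that p(1) y unfolding formulas_def by blast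
      ultimately have "sat M t' \<theta>" if "\<theta> \<in> insert \<phi> (F \<inter> p)" for \<theta>
        using that t(2) y by blast
      then show "\<exists>t\<in>assignments M. \<forall>\<theta>\<in>F. sat M t \<theta>"
      proof (intro bexI[of _ t'] ballI)
        fix \<theta> assume "\<theta> \<in> F"
        then consider "\<theta> = Conj \<phi> ?\<chi>" | "\<theta> \<in> F \<inter> p" using F(2) by blast
        then show "sat M t' \<theta>"
        proof cases
          case 1
          then show ?thesis using t'(2) \<open>\<And>\<theta>. \<theta> \<in> insert \<phi> (F \<inter> p) \<Longrightarrow> sat M t' \<theta>\<close>[of \<phi>]
            by (simp only: sat_Conj insert_iff) blast
        qed (simp add: \<open>\<And>\<theta>. \<theta> \<in> insert \<phi> (F \<inter> p) \<Longrightarrow> sat M t' \<theta>\<close>)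
      qed (rule t'(1))
    qed
    moreover have "wf_fm L ?\<chi>" using \<psi> by simp
    moreover have "H j ?\<chi>" using y by (auto simp: H_def ej)
    ultimately show ?thesis by blast
  qed
  have dense': "\<exists>\<chi>. wf_fm L \<chi> \<and> finsat M (insert (Conj \<phi> \<chi>) p) \<and> D' j \<chi>"
    if "wf_fm L \<phi>" "finsat M (insert \<phi> p)" for \<phi> j
    using dense denseH that unfolding D'_def by (cases "even j") auto
  have "finsat M (insert Tr p)"
    unfolding finsat_def
  proof (intro allI impI)
    fix F assume "finite F" "F \<subseteq> insert Tr p"
    then have "finite (F - {Tr})" "F - {Tr} \<subseteq> p" by auto
    then obtain t where "t \<in> assignments M" "\<forall>\<phi>\<in>F - {Tr}. sat M t \<phi>"
      using p(2) unfolding finsat_def by blast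
    then show "\<exists>t\<in>assignments M. \<forall>\<phi>\<in>F. sat M t \<phi>" by (intro bexI[of _ t]) auto
  qed
  then have start: "\<exists>\<phi>. wf_fm L \<phi> \<and> finsat M (insert \<phi> p)" by (intro exI[of _ Tr]) simp
  have step: "\<exists>\<phi>'. (wf_fm L \<phi>' \<and> finsat M (insert \<phi>' p)) \<and>
      (\<exists>\<chi>. wf_fm L \<chi> \<and> \<phi>' = Conj \<phi> \<chi> \<and> D' n \<chi>)"
    if "wf_fm L \<phi> \<and> finsat M (insert \<phi> p)" for \<phi> n
    using dense'[of \<phi> n] that wf_Conj by blast
  have "\<exists>\<Phi>. \<forall>n. (wf_fm L (\<Phi> n) \<and> finsat M (insert (\<Phi> n) p)) \<and>
      (\<exists>\<chi>. wf_fm L \<chi> \<and> \<Phi> (Suc n) = Conj (\<Phi> n) \<chi> \<and> D' n \<chi>)"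
    using dependent_nat_choice[of "\<lambda>_ \<phi>. wf_fm L \<phi> \<and> finsat M (insert \<phi> p)"
      "\<lambda>n \<phi> \<phi>'. \<exists>\<chi>. wf_fm L \<chi> \<and> \<phi>' = Conj \<phi> \<chi> \<and> D' n \<chi>", OF start step] by blast
  then obtain \<Phi> \<chi> where \<Phi>: "\<And>n. wf_fm L (\<Phi> n)" "\<And>n. finsat M (insert (\<Phi> n) p)"
    and \<chi>: "\<And>n. wf_fm L (\<chi> n)" "\<And>n. \<Phi> (Suc n) = Conj (\<Phi> n) (\<chi> n)" "\<And>n. D' n (\<chi> n)"
    by metis
  have mono: "sat M t (\<Phi> n)" if "n \<le> m" "sat M t (\<Phi> m)" for t n m
    using that by (induction m rule: dec_induct) (auto simp: \<chi>(2))
  have cp: "countable p"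
    using p(1) by (intro countable_subset[OF _ countable_formulas[OF L]]) (auto simp: formulas_def)
  have "\<exists>t\<in>assignments M. sat M t (\<Phi> n) \<and> (\<forall>i<n. p \<noteq> {} \<longrightarrow> sat M t (from_nat_into p i))" for n
  proof -
    let ?F = "insert (\<Phi> n) (if p = {} then {} else from_nat_into p ` {..<n})"
    have "?F \<subseteq> insert (\<Phi> n) p" using from_nat_into[of p] by auto
    moreover have "finite ?F" by simp
    ultimately obtain t where "t \<in> assignments M" "\<forall>\<phi>\<in>?F. sat M t \<phi>"
      using \<Phi>(2)[of n] unfolding finsat_def by meson
    then show ?thesis by (intro bexI[of _ t]) auto
  qed
  then obtain t where t: "\<And>n. t n \<in> assignments M" "\<And>n. sat M (t n) (\<Phi> n)"
    "\<And>n i. i < n \<Longrightarrow> p \<noteq> {} \<Longrightarrow> sat M (t n) (from_nat_into p i)" by metis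
  let ?P = "upower L M"
  let ?s = "ulim M t"
  have P: "is_struct L ?P" by (rule is_struct_upower[OF M])
  have s: "?s \<in> assignments ?P" by (rule ulim_assignment[OF t(1)])
  have sp: "sat ?P ?s \<phi>" if "\<phi> \<in> p" for \<phi>
  proof -
    obtain i where i: "from_nat_into p i = \<phi>" using from_nat_into_surj[OF cp \<open>\<phi> \<in> p\<close>] by blast
    have "wf_fm L \<phi>" using that p(1) by (auto simp: formulas_def)
    moreover have "eventually (\<lambda>n. sat M (t n) \<phi>) \<U>"
      using U_tail[of "Suc i"]
    proof eventually_elim
      case (elim n)
      then have "i < n" "p \<noteq> {}" using that by auto
      then show ?case using t(3) i by blast
    qed
    ultimately show ?thesis using sat_ulim[of L M t, OF M t(1)] by blast
  qed
  have s\<chi>: "sat ?P ?s (\<chi> j)" for j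
  proof -
    have "eventually (\<lambda>n. sat M (t n) (\<chi> j)) \<U>"
      using U_tail[of "Suc j"]
    proof eventually_elim
      case (elim n)
      then show ?case using mono[OF _ t(2), of "Suc j" n] by (simp add: \<chi>(2))
    qed
    then show ?thesis using sat_ulim[of L M t, OF M t(1) \<chi>(1)] by blast
  qed
  have tv: "\<exists>y. sat ?P (?s(x := ?s y)) \<phi>"
    if "wf_fm L \<phi>" "a \<in> univ ?P" "sat ?P (?s(x := a)) \<phi>" for \<phi> x a
  proof -
    have "(\<phi>, x) \<in> range e" unfolding e using \<open>wf_fm L \<phi>\<close> by simp
    then obtain j where "(\<phi>, x) = e j" by (rule imageE)
    then have j: "e j = (\<phi>, x)" by simp
    have "H j (\<chi> (2 * j + 1))" using \<chi>(3)[of "2 * j + 1"] by (simp add: D'_def)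
    then obtain y where y: "x \<noteq> y" "\<chi> (2 * j + 1) = Imp (Exi x \<phi>) (Exi x (Conj (Eq (Var x) (Var y)) \<phi>))"
      by (auto simp: H_def j)
    have "sat ?P ?s (Exi x \<phi>)" using that(2,3) by auto
    then have "sat ?P ?s (Exi x (Conj (Eq (Var x) (Var y)) \<phi>))"
      using s\<chi>[of "2 * j + 1"] y(2) by simp
    then show ?thesis using sat_witness[OF y(1) s] by blast
  qed
  obtain N :: "('f, 'r, 'u) struct" and u where N: "is_struct L N" "Th L N = Th L M" "range u = univ N"
    "\<And>\<phi>. wf_fm L \<phi> \<Longrightarrow> sat N u \<phi> \<longleftrightarrow> sat ?P ?s \<phi>"
    by (rule countable_hull[OF M P Th_upower[OF M] s]) (use tv in blast)+
  show thesis
  proof (rule that[OF N(1-3)])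
    show "sat N u \<phi>" if "\<phi> \<in> p" for \<phi>
      using sp[OF that] N(4)[of \<phi>] that p(1) by (auto simp: formulas_def)
    show "\<exists>\<chi>. wf_fm L \<chi> \<and> D j \<chi> \<and> sat N u \<chi>" for j
      using \<chi>(3)[of "2 * j"] s\<chi>[of "2 * j"] N(4)[OF \<chi>(1)[of "2 * j"]] \<chi>(1)[of "2 * j"]
      by (auto simp: D'_def)
  qed
qed

text \<open>The construction of a generic model without further requirements.\<close>

lemma compactness:
  fixes M :: "('f, 'r, 'u) struct"
  assumes "countable_lang L" "is_struct L M" "p \<subseteq> formulas L k" "finsat M p"
  obtains N :: "('f, 'r, 'u) struct" and t where
    "is_struct L N" "Th L N = Th L M" "range t = univ N" "\<And>\<phi>. \<phi> \<in> p \<Longrightarrow> sat N t \<phi>"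
proof (rule generic_model[OF assms, where D = "\<lambda>_ _. True"])
  fix \<phi> assume "wf_fm L \<phi>" and f: "finsat M (insert \<phi> p)"
  have "finsat M (insert (Conj \<phi> Tr) p)"
    unfolding finsat_def
  proof (intro allI impI)
    fix F assume F: "finite F" "F \<subseteq> insert (Conj \<phi> Tr) p"
    then obtain t where t: "t \<in> assignments M" "\<forall>\<theta>\<in>insert \<phi> (F \<inter> p). sat M t \<theta>"
      using f unfolding finsat_def by (metis finite_Int finite_insert inf_le2 insert_mono)
    then show "\<exists>t\<in>assignments M. \<forall>\<theta>\<in>F. sat M t \<theta>"
      using F by (intro bexI[of _ t]) auto
  qed
  then show "\<exists>\<chi>. wf_fm L \<chi> \<and> finsat M (insert (Conj \<phi> \<chi>) p) \<and> True"
    by (intro exI[of _ Tr]) simp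
qed (use that in blast)

lemma consistent_with_iff:
  fixes M :: "('f, 'r, 'u) struct"
  assumes L: "countable_lang L" and M: "is_struct L M" and p: "p \<subseteq> formulas L k"
  shows "consistent_with TYPE('u) L (Th L M) p \<longleftrightarrow> finsat M p"
proof
  assume "consistent_with TYPE('u) L (Th L M) p"
  then obtain N :: "('f, 'r, 'u) struct" where "is_struct L N" "Th L N = Th L M" "realizes N p"
    unfolding consistent_with_def model_Th_iff[OF M] by blast
  then show "finsat M p"
    using finsat_transfer[of L N M p] M finsat_realized p unfolding realizes_def formulas_def by blast
next
  assume "finsat M p"
  then obtain N :: "('f, 'r, 'u) struct" and t where N: "is_struct L N" "Th L N = Th L M" "range t = univ N"
    "\<And>\<phi>. \<phi> \<in> p \<Longrightarrow> sat N t \<phi>"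
    using compactness[OF L M p] by metis
  have "t \<in> assignments N" using N(3) by (simp add: assignments_def)
  then show "consistent_with TYPE('u) L (Th L M) p"
    unfolding consistent_with_def model_Th_iff[OF M] realizes_def using N by blast
qed

section \<open>Isolated types and omitting types\<close>

text \<open>Complete formulas in \<open>k\<close> variables, with the first \<open>m\<close> entries of \<open>a\<close> as parameters in place of the
  first \<open>m\<close> variables. For \<open>m = 0\<close> there are no parameters, so the abbreviation below can leave \<open>a\<close>
  undefined.\<close>

definition isolating :: "('f, 'r) lang \<Rightarrow> ('f, 'r, 'u) struct \<Rightarrow> nat \<Rightarrow> (nat \<Rightarrow> 'u) \<Rightarrow> nat \<Rightarrow> ('f, 'r) fm \<Rightarrow> bool" where
  "isolating L M m a k \<chi> \<longleftrightarrow> \<chi> \<in> formulas L k \<and>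
     (\<exists>s\<in>assignments M. agree m s a \<and> sat M s \<chi>) \<and>
     (\<forall>\<psi>\<in>formulas L k. (\<forall>s\<in>assignments M. agree m s a \<longrightarrow> sat M s \<chi> \<longrightarrow> sat M s \<psi>) \<or>
        (\<forall>s\<in>assignments M. agree m s a \<longrightarrow> sat M s \<chi> \<longrightarrow> \<not> sat M s \<psi>))"

abbreviation complete_in :: "('f, 'r) lang \<Rightarrow> ('f, 'r, 'u) struct \<Rightarrow> nat \<Rightarrow> ('f, 'r) fm \<Rightarrow> bool" where
  "complete_in L M k \<chi> \<equiv> isolating L M 0 undefined k \<chi>"

lemma isolating_decides:
  assumes "isolating L M m a k \<chi>" "\<psi> \<in> formulas L k"
    "s \<in> assignments M" "agree m s a" "sat M s \<chi>" "sat M s \<psi>"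
    "t \<in> assignments M" "agree m t a" "sat M t \<chi>"
  shows "sat M t \<psi>"
  using assms unfolding isolating_def by blast

lemma complete_in_transfer:
  assumes M: "is_struct L M" and N: "is_struct L N" and Th: "Th L M = Th L N"
  shows "complete_in L M k \<chi> \<longleftrightarrow> complete_in L N k \<chi>"
proof (cases "\<chi> \<in> formulas L k")
  case True
  have "(\<exists>s\<in>assignments M. sat M s \<chi>) \<longleftrightarrow> (\<exists>s\<in>assignments N. sat N s \<chi>)"
    by (rule sat_ex_transfer[OF M N Th formulas_wf[OF True]])
  moreover have "(\<forall>s\<in>assignments M. sat M s \<chi> \<longrightarrow> sat M s \<psi>) \<longleftrightarrow>
      (\<forall>s\<in>assignments N. sat N s \<chi> \<longrightarrow> sat N s \<psi>)" if "\<psi> \<in> formulas L k" for \<psi>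
    using sat_all_transfer[OF M N Th, of "Imp \<chi> \<psi>"] formulas_wf[OF True] formulas_wf[OF that] by simp
  moreover have "(\<forall>s\<in>assignments M. sat M s \<chi> \<longrightarrow> \<not> sat M s \<psi>) \<longleftrightarrow>
      (\<forall>s\<in>assignments N. sat N s \<chi> \<longrightarrow> \<not> sat N s \<psi>)" if "\<psi> \<in> formulas L k" for \<psi>
    using sat_all_transfer[OF M N Th, of "Imp \<chi> (Neg \<psi>)"] formulas_wf[OF True] formulas_wf[OF that] by simp
  ultimately show ?thesis by (auto simp: isolating_def)
qed (simp add: isolating_def)

lemma sat_tuple_prefix:
  assumes "s \<in> assignments M"
  shows "sat M s (tuple_ex [0..<k] \<phi>) \<longleftrightarrow> (\<exists>t\<in>assignments M. agree k t s \<and> sat M t \<phi>)"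
  unfolding sat_tuple_ex[OF assms] by (simp add: agree_def) metis

lemma tuple_prefix_formulas: "wf_fm L \<phi> \<Longrightarrow> tuple_ex [0..<k] \<phi> \<in> formulas L k"
  using tuple_ex_formulas[of L \<phi> "[0..<k]"] by simp

text \<open>For each \<open>j\<close> and each tuple of variables that begins with those of the parameters there is a requirement:
  some formula of \<open>\<Theta> j\<close> fails at this tuple. It is dense because no formula in \<open>K j\<close> variables that is
  satisfiable over the parameters implies all of \<open>\<Theta> j\<close>; in particular, the formula that defines the
  possible values of the tuple does not.\<close>

lemma omitting_types:
  fixes M :: "('f, 'r, 'u) struct" and \<Theta> :: "nat \<Rightarrow> ('f, 'r) fm set"
  assumes L: "countable_lang L" and M: "is_struct L M" and a: "a \<in> assignments M"
    and \<Theta>: "\<And>j. m \<le> K j" "\<And>j. \<Theta> j \<subseteq> formulas L (K j)"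
    and nonprincipal: "\<And>j \<phi> s. \<phi> \<in> formulas L (K j) \<Longrightarrow> s \<in> assignments M \<Longrightarrow> agree m s a \<Longrightarrow>
      sat M s \<phi> \<Longrightarrow> \<exists>\<psi>\<in>\<Theta> j. \<exists>s\<in>assignments M. agree m s a \<and> sat M s \<phi> \<and> \<not> sat M s \<psi>"
  obtains N :: "('f, 'r, 'u) struct" and t where
    "is_struct L N" "Th L N = Th L M" "range t = univ N" "tp L N m t = tp L M m a"
    "\<And>j s. s \<in> assignments N \<Longrightarrow> agree m s t \<Longrightarrow> \<exists>\<psi>\<in>\<Theta> j. \<not> sat N s \<psi>"
proof -
  let ?p = "tp L M m a"
  define D where "D i \<chi> = (case from_nat i :: nat \<times> nat list of (j, ys) \<Rightarrow>
      length ys = K j - m \<longrightarrow> (\<exists>\<psi>\<in>\<Theta> j. \<chi> = Neg (sub \<psi> (\<lambda>i. ([0..<m] @ ys) ! i))))" for i \<chi>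
  have dense: "\<exists>\<chi>. wf_fm L \<chi> \<and> finsat M (insert (Conj \<phi> \<chi>) ?p) \<and> D i \<chi>"
    if \<phi>: "wf_fm L \<phi>" "finsat M (insert \<phi> ?p)" for \<phi> i
  proof -
    have "\<exists>t\<in>assignments M. agree m t a \<and> sat M t \<phi>"
    proof (rule ccontr)
      assume "\<not> ?thesis"
      then have "Neg (tuple_ex [0..<m] \<phi>) \<in> ?p"
        using sat_tuple_prefix[OF a, of m \<phi>] tuple_prefix_formulas[OF \<phi>(1), of m] by (simp add: tp_def)
      then obtain t where t: "t \<in> assignments M" "\<forall>\<theta>\<in>{\<phi>, Neg (tuple_ex [0..<m] \<phi>)}. sat M t \<theta>"
        using \<phi>(2) unfolding finsat_def by (metis (no_types, lifting) empty_subsetI finite.emptyI finite.insertI insert_mono insert_subset)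
      then show False using sat_tuple_prefix[OF t(1), of m \<phi>] by auto
    qed
    then obtain t where t: "t \<in> assignments M" "agree m t a" "sat M t \<phi>" by blast
    obtain j ys where jys: "from_nat i = (j :: nat, ys :: nat list)" by fastforce
    have fin: "finsat M (insert (Conj \<phi> \<chi>) ?p)"
      if "t' \<in> assignments M" "agree m t' a" "sat M t' \<phi>" "sat M t' \<chi>" for t' \<chi>
      using that sat_agree[of _ L m t' a M] by (intro finsat_realized[of t']) (auto simp: tp_def)
    show ?thesis
    proof (cases "length ys = K j - m")
      case True
      let ?zs = "[0..<m] @ ys"
      have lz: "length ?zs = K j" using True \<Theta>(1)[of j] by simp
      let ?s = "t \<circ> (\<lambda>i. ?zs ! i)"
      have s: "?s \<in> assignments M" using t(1) by simp
      have "sat M ?s (tuple_ex ?zs \<phi>)" unfolding sat_tuple_ex[OF s] using t by auto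
      moreover have "agree m ?s a" using t(2) by (auto simp: agree_def nth_append)
      moreover have "tuple_ex ?zs \<phi> \<in> formulas L (K j)" using tuple_ex_formulas[OF \<phi>(1), of ?zs] lz by simp
      ultimately obtain \<psi> s' where s': "\<psi> \<in> \<Theta> j" "s' \<in> assignments M" "agree m s' a"
        "sat M s' (tuple_ex ?zs \<phi>)" "\<not> sat M s' \<psi>" using nonprincipal[of _ j] s by blast
      then obtain t' where t': "t' \<in> assignments M" "\<forall>i<K j. s' i = t' (?zs ! i)" "sat M t' \<phi>"
        unfolding sat_tuple_ex[OF s'(2)] lz by blast
      let ?\<chi> = "Neg (sub \<psi> (\<lambda>i. ?zs ! i))"
      have "sat M s' \<psi> \<longleftrightarrow> sat M (t' \<circ> (\<lambda>i. ?zs ! i)) \<psi>"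
        using s'(1) \<Theta>(2) t'(2) by (intro sat_formulas_cong[of \<psi> L "K j"]) auto
      then have "sat M t' ?\<chi>" using s'(5) by (simp add: sat_sub)
      moreover have "agree m t' a"
        unfolding agree_def
      proof (intro allI impI)
        fix i assume "i < m"
        then show "t' i = a i" using t'(2) s'(3) \<Theta>(1)[of j] by (auto simp: agree_def nth_append)
      qed
      moreover have "wf_fm L ?\<chi>" using s'(1) \<Theta>(2)[of j] by (auto simp: formulas_def)
      moreover have "D i ?\<chi>" using s'(1) by (auto simp: D_def jys)
      ultimately show ?thesis using fin[OF t'(1) _ t'(3)] by blast
    next
      case False
      then show ?thesis using fin[OF t, of Tr] by (intro exI[of _ Tr]) (auto simp: D_def jys)
    qed
  qed
  obtain N :: "('f, 'r, 'u) struct" and t where N: "is_struct L N" "Th L N = Th L M" "range t = univ N"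
    "\<And>\<phi>. \<phi> \<in> ?p \<Longrightarrow> sat N t \<phi>" "\<And>i. \<exists>\<chi>. wf_fm L \<chi> \<and> D i \<chi> \<and> sat N t \<chi>"
    by (rule generic_model[OF L M tp_formulas[of L M m a] finsat_tp[OF a], of D]) (use dense in blast)+
  have t: "t \<in> assignments N" using N(3) by (simp add: assignments_def)
  show thesis
  proof (rule that[OF N(1-3)])
    have "sat N t \<phi> \<longleftrightarrow> sat M a \<phi>" if "\<phi> \<in> formulas L m" for \<phi>
      using N(4)[of \<phi>] N(4)[of "Neg \<phi>"] that by (auto simp: tp_def)
    then show "tp L N m t = ?p" by (auto simp: tp_def)
  next
    fix j s assume s: "s \<in> assignments N" "agree m s t"
    have "\<forall>i. \<exists>v. s i = t v" using s(1) N(3) by (metis assignments_in rangeE)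
    then obtain \<sigma> where \<sigma>: "\<And>i. s i = t (\<sigma> i)" by metis
    let ?ys = "map \<sigma> [m..<K j]"
    obtain \<chi> where \<chi>: "D (to_nat (j, ?ys)) \<chi>" "sat N t \<chi>" using N(5) by blast
    then obtain \<psi> where \<psi>: "\<psi> \<in> \<Theta> j" "\<chi> = Neg (sub \<psi> (\<lambda>i. ([0..<m] @ ?ys) ! i))"
      by (auto simp: D_def)
    have "sat N s \<psi> \<longleftrightarrow> sat N (t \<circ> (\<lambda>i. ([0..<m] @ ?ys) ! i)) \<psi>"
      using \<psi>(1) \<Theta>(2)[of j] s(2)
      by (intro sat_formulas_cong[of \<psi> L "K j"]) (auto simp: nth_append \<sigma>[symmetric] agree_def)
    then show "\<exists>\<psi>\<in>\<Theta> j. \<not> sat N s \<psi>" using \<psi> \<chi>(2) by (auto simp: sat_sub)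
  qed
qed

section \<open>Back and forth\<close>

text \<open>One step of the back-and-forth game between tuples of the same type.\<close>

definition extends :: "('f, 'r) lang \<Rightarrow> ('f, 'r, 'u) struct \<Rightarrow> ('f, 'r, 'v) struct \<Rightarrow> bool" where
  "extends L M N \<longleftrightarrow> (\<forall>k. \<forall>y\<in>assignments M. \<forall>b\<in>assignments N. tp L M k y = tp L N k b \<longrightarrow>
     (\<forall>c\<in>univ M. \<exists>d\<in>univ N. tp L M (Suc k) (y(k := c)) = tp L N (Suc k) (b(k := d))))"

lemma tp_eq_iff: "tp L M k y = tp L N k b \<longleftrightarrow> (\<forall>\<phi>\<in>formulas L k. sat M y \<phi> \<longleftrightarrow> sat N b \<phi>)"
  by (auto simp: tp_def)

text \<open>The flag \<open>Q\<close> covers two constructions at once. If it holds, the odd steps choose elements of \<open>N\<close> and the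
  resulting map is onto; otherwise all steps choose elements of \<open>M\<close>.\<close>

lemma back_and_forth:
  fixes M :: "('f, 'r, 'u) struct" and N :: "('f, 'r, 'v) struct"
  assumes M: "is_struct L M" "countable (univ M)" and N: "is_struct L N" "countable (univ N)"
    and Th: "Th L M = Th L N" and forth: "extends L M N" and backward: "Q \<Longrightarrow> extends L N M"
  obtains h where "elementary_map L M N h" "Q \<Longrightarrow> h ` univ M = univ N"
proof -
  have ne: "univ M \<noteq> {}" "univ N \<noteq> {}" using M N by (auto simp: is_struct_def)
  define eM eN where "eM = from_nat_into (univ M)" and "eN = from_nat_into (univ N)"
  have eM: "range eM = univ M" and eN: "range eN = univ N"
    using M N ne by (auto simp: eM_def eN_def range_from_nat_into)
  obtain y0 b0 where y0: "y0 \<in> assignments M" and b0: "b0 \<in> assignments N"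
    using ex_assignment[OF M(1)] ex_assignment[OF N(1)] by blast
  have "tp L M 0 y0 = tp L N 0 b0"
    using Th_iff[OF y0, of _ L] Th_iff[OF b0, of _ L] Th unfolding tp_eq_iff by auto
  then have start: "\<exists>yb. fst yb \<in> assignments M \<and> snd yb \<in> assignments N \<and> tp L M 0 (fst yb) = tp L N 0 (snd yb)"
    using y0 b0 by (intro exI[of _ "(y0, b0)"]) simp
  have step: "\<exists>yb'. (fst yb' \<in> assignments M \<and> snd yb' \<in> assignments N \<and>
        tp L M (Suc n) (fst yb') = tp L N (Suc n) (snd yb')) \<and>
      (agree n (fst yb') (fst yb) \<and> agree n (snd yb') (snd yb) \<and>
       (even n \<longrightarrow> fst yb' n = eM (n div 2)) \<and> (odd n \<and> Q \<longrightarrow> snd yb' n = eN (n div 2)))"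
    if yb: "fst yb \<in> assignments M \<and> snd yb \<in> assignments N \<and> tp L M n (fst yb) = tp L N n (snd yb)" for yb n
  proof (cases "odd n \<and> Q")
    case True
    let ?d = "eN (n div 2)"
    have d: "?d \<in> univ N" using eN by blast
    then obtain c where "c \<in> univ M" "tp L N (Suc n) ((snd yb)(n := ?d)) = tp L M (Suc n) ((fst yb)(n := c))"
      using backward True yb unfolding extends_def by metis
    then show ?thesis using True d yb
      by (intro exI[of _ "((fst yb)(n := c), (snd yb)(n := ?d))"]) auto
  next
    case False
    let ?c = "eM (n div 2)"
    have c: "?c \<in> univ M" using eM by blast
    then obtain d where "d \<in> univ N" "tp L M (Suc n) ((fst yb)(n := ?c)) = tp L N (Suc n) ((snd yb)(n := d))"
      using forth yb unfolding extends_def by metis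
    then show ?thesis using False c yb
      by (intro exI[of _ "((fst yb)(n := ?c), (snd yb)(n := d))"]) auto
  qed
  obtain f where f: "\<And>n. fst (f n) \<in> assignments M \<and> snd (f n) \<in> assignments N \<and>
        tp L M n (fst (f n)) = tp L N n (snd (f n))"
    "\<And>n. agree n (fst (f (Suc n))) (fst (f n)) \<and> agree n (snd (f (Suc n))) (snd (f n)) \<and>
       (even n \<longrightarrow> fst (f (Suc n)) n = eM (n div 2)) \<and> (odd n \<and> Q \<longrightarrow> snd (f (Suc n)) n = eN (n div 2))"
    using dependent_nat_choice[of "\<lambda>n yb. fst yb \<in> assignments M \<and> snd yb \<in> assignments N \<and>
        tp L M n (fst yb) = tp L N n (snd yb)"
      "\<lambda>n yb yb'. agree n (fst yb') (fst yb) \<and> agree n (snd yb') (snd yb) \<and>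
        (even n \<longrightarrow> fst yb' n = eM (n div 2)) \<and> (odd n \<and> Q \<longrightarrow> snd yb' n = eN (n div 2))",
      OF start step] by blast
  define y b where "y i = fst (f (Suc i)) i" and "b i = snd (f (Suc i)) i" for i
  have ag: "agree n y (fst (f n)) \<and> agree n b (snd (f n))" for n
  proof (induction n)
    case (Suc n)
    have "agree n y (fst (f (Suc n)))" "agree n b (snd (f (Suc n)))"
      using Suc f(2)[of n] agree_trans agree_sym by blast+
    moreover have "y n = fst (f (Suc n)) n" "b n = snd (f (Suc n)) n"
      by (simp_all add: y_def b_def)
    ultimately show ?case by (simp add: agree_Suc)
  qed simp
  have y: "y \<in> assignments M" and b: "b \<in> assignments N"
    using f(1) by (auto intro!: assignmentsI simp: y_def b_def)
  have same: "sat M y \<phi> \<longleftrightarrow> sat N b \<phi>" if \<phi>: "wf_fm L \<phi>" for \<phi>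
  proof -
    obtain n where n: "\<phi> \<in> formulas L n" using ex_formulas[OF \<phi>] by blast
    then show ?thesis
      using f(1)[of n] sat_agree[OF n, of y "fst (f n)" M] sat_agree[OF n, of b "snd (f n)" N] ag[of n]
      unfolding tp_eq_iff by blast
  qed
  have "y (2 * j) = eM j" for j using f(2)[of "2 * j"] by (simp add: y_def)
  then have "eM j \<in> range y" for j by (metis rangeI)
  then have "range eM \<subseteq> range y" by blast
  then have ry: "range y = univ M" using eM y by (simp add: assignments_def)
  have rb: "range b = univ N" if Q
  proof -
    have "b (2 * j + 1) = eN j" for j using f(2)[of "2 * j + 1"] that by (simp add: b_def)
    then have "eN j \<in> range b" for j by (metis rangeI)
    then have "range eN \<subseteq> range b" by blast
    then show ?thesis using eN b by (simp add: assignments_def)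
  qed
  obtain h where "elementary_map L M N h" "h ` univ M = range b"
    using enumeration_elementary_map[OF M(1) N(1) ry b same] by blast
  then show thesis using that rb by metis
qed

definition isolated_tuples :: "('f, 'r) lang \<Rightarrow> ('f, 'r, 'u) struct \<Rightarrow> bool" where
  "isolated_tuples L M \<longleftrightarrow> (\<forall>k. \<forall>s\<in>assignments M. \<exists>\<chi>. complete_in L M k \<chi> \<and> sat M s \<chi>)"

text \<open>Let \<open>\<chi>\<close> isolate the type of the extended tuple. That the shorter tuple extends to a solution of \<open>\<chi>\<close> is
  part of its type, and every solution of \<open>\<chi>\<close> in \<open>N\<close> has the type isolated by \<open>\<chi>\<close>.\<close>

lemma isolated_tuples_extends:
  assumes M: "is_struct L M" and N: "is_struct L N" and Th: "Th L M = Th L N"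
    and iso: "isolated_tuples L M"
  shows "extends L M N"
  unfolding extends_def
proof (intro allI ballI impI)
  fix k y b c assume y: "y \<in> assignments M" and b: "b \<in> assignments N"
    and same: "tp L M k y = tp L N k b" and c: "c \<in> univ M"
  let ?y = "y(k := c)"
  have y': "?y \<in> assignments M" using y c by simp
  obtain \<chi> where \<chi>: "complete_in L M (Suc k) \<chi>" "sat M ?y \<chi>"
    using iso y' unfolding isolated_tuples_def by blast
  have f: "\<chi> \<in> formulas L (Suc k)" using \<chi>(1) by (simp add: isolating_def)
  have "sat M y (tuple_ex [0..<k] \<chi>)" unfolding sat_tuple_prefix[OF y] using y' \<chi>(2) by (intro bexI[of _ ?y]) auto
  then have "sat N b (tuple_ex [0..<k] \<chi>)"
    using same tuple_prefix_formulas[OF formulas_wf[OF f]] unfolding tp_eq_iff by blast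
  then obtain t where t: "t \<in> assignments N" "agree k t b" "sat N t \<chi>" unfolding sat_tuple_prefix[OF b] by blast
  let ?b = "b(k := t k)"
  have b': "?b \<in> assignments N" using b t(1) by simp
  have "sat N ?b \<chi>" using sat_agree[OF f, of ?b t N] t agree_sym[OF t(2)] by (auto simp: agree_Suc)
  then have "sat N ?b \<psi>" if "\<psi> \<in> formulas L (Suc k)" "sat M ?y \<psi>" for \<psi>
  proof -
    have "\<forall>s\<in>assignments M. sat M s (Imp \<chi> \<psi>)"
      using isolating_decides[OF \<chi>(1) that(1) y' _ \<chi>(2) that(2)] by simp
    then have "\<forall>s\<in>assignments N. sat N s (Imp \<chi> \<psi>)"
      using sat_all_transfer[OF M N Th, of "Imp \<chi> \<psi>"] formulas_wf[OF f] formulas_wf[OF that(1)] by simp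
    then show ?thesis using b' \<open>sat N ?b \<chi>\<close> by auto
  qed
  from this this[of "Neg _"] have "tp L M (Suc k) ?y = tp L N (Suc k) ?b"
    unfolding tp_eq_iff by (metis formulas_Neg sat.simps(3))
  then show "\<exists>d\<in>univ N. tp L M (Suc k) ?y = tp L N (Suc k) (b(k := d))" using t(1) by auto
qed

lemma isolated_tuples_isoI:
  assumes M: "is_struct L M" "countable (univ M)" "isolated_tuples L M"
    and N: "is_struct L N" "countable (univ N)" "isolated_tuples L N" and Th: "Th L M = Th L N"
  shows "iso L M N"
  using back_and_forth[OF M(1,2) N(1,2) Th isolated_tuples_extends[OF M(1) N(1) Th M(3)], of True]
    isolated_tuples_extends[OF N(1) M(1) Th[symmetric] N(3)] unfolding iso_iff_elementary by blast

lemma isolated_tuples_prime: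
  assumes M: "is_struct L M" "countable (univ M)" "isolated_tuples L M"
    and N: "is_struct L N" "countable (univ N)" and Th: "Th L M = Th L N"
  obtains h where "elementary_map L M N h"
  using back_and_forth[OF M(1,2) N Th isolated_tuples_extends[OF M(1) N(1) Th M(3)], of False] by blast

text \<open>A non-isolated type of a tuple of \<open>M\<close> is omitted by some countable model, which contradicts the
  elementary map from \<open>M\<close> into this model.\<close>

lemma prime_isolated_tuples:
  fixes M :: "('f, 'r, 'u) struct"
  assumes L: "countable_lang L" and M: "is_struct L M"
    and prime: "\<And>N :: ('f, 'r, 'u) struct. is_struct L N \<Longrightarrow> countable (univ N) \<Longrightarrow> Th L N = Th L M \<Longrightarrow>
      \<exists>h. elementary_map L M N h"
  shows "isolated_tuples L M"
proof (rule ccontr)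
  assume "\<not> isolated_tuples L M"
  then obtain k s where s: "s \<in> assignments M" "\<And>\<chi>. complete_in L M k \<chi> \<Longrightarrow> \<not> sat M s \<chi>"
    unfolding isolated_tuples_def by blast
  let ?p = "tp L M k s"
  have np: "\<exists>\<psi>\<in>?p. \<exists>u\<in>assignments M. agree 0 u s \<and> sat M u \<phi> \<and> \<not> sat M u \<psi>"
    if \<phi>: "\<phi> \<in> formulas L k" "t \<in> assignments M" "sat M t \<phi>" for \<phi> t
  proof (rule ccontr)
    assume "\<not> ?thesis"
    then have imp: "sat M u \<psi>" if "\<psi> \<in> ?p" "u \<in> assignments M" "sat M u \<phi>" for u \<psi>
      using that by auto
    have mem: "\<psi> \<in> ?p \<or> Neg \<psi> \<in> ?p" if "\<psi> \<in> formulas L k" for \<psi> using that by (auto simp: tp_def)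
    have "(\<forall>u\<in>assignments M. sat M u \<phi> \<longrightarrow> sat M u \<psi>) \<or> (\<forall>u\<in>assignments M. sat M u \<phi> \<longrightarrow> \<not> sat M u \<psi>)"
      if "\<psi> \<in> formulas L k" for \<psi>
      using imp[of \<psi>] imp[of "Neg \<psi>"] mem[OF that] by auto
    then have "complete_in L M k \<phi>" using \<phi> by (auto simp: isolating_def)
    moreover have "sat M s \<phi>"
    proof (rule ccontr)
      assume "\<not> sat M s \<phi>"
      then have "Neg \<phi> \<in> ?p" using \<phi>(1) by (simp add: tp_def)
      from imp[OF this \<phi>(2,3)] show False using \<phi>(3) by simp
    qed
    ultimately show False using s(2) by blast
  qed
  obtain N :: "('f, 'r, 'u) struct" and t :: "nat \<Rightarrow> 'u" where N: "is_struct L N" "Th L N = Th L M" "range t = univ N"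
    "\<And>u. u \<in> assignments N \<Longrightarrow> \<exists>\<psi>\<in>?p. \<not> sat N u \<psi>"
  proof (rule omitting_types[OF L M s(1), of 0 "\<lambda>_. k" "\<lambda>_. ?p"])
    show "?p \<subseteq> formulas L k" by (rule tp_formulas)
    show "\<exists>\<psi>\<in>?p. \<exists>u\<in>assignments M. agree 0 u s \<and> sat M u \<phi> \<and> \<not> sat M u \<psi>"
      if "\<phi> \<in> formulas L k" "t \<in> assignments M" "sat M t \<phi>" for \<phi> t
      by (rule np[OF that])
    fix N :: "('f, 'r, 'u) struct" and t :: "nat \<Rightarrow> 'u"
    assume "is_struct L N" "Th L N = Th L M" "range t = univ N"
      "\<And>(j :: nat) u. u \<in> assignments N \<Longrightarrow> agree 0 u t \<Longrightarrow> \<exists>\<psi>\<in>?p. \<not> sat N u \<psi>"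
    then show thesis by (intro that[of N t]) simp_all
  qed simp
  obtain h where h: "elementary_map L M N h"
    using prime[OF N(1) _ N(2)] N(3) by (metis countable_image countableI_type)
  have "sat N (h \<circ> s) \<psi>" if "\<psi> \<in> ?p" for \<psi>
    using elementary_map_sat[OF h _ s(1), of \<psi>] that by (auto simp: tp_def formulas_def)
  then show False using N(4)[OF elementary_map_assignment[OF h s(1)]] by blast
qed

section \<open>Saturated structures\<close>

text \<open>\<open>\<omega>\<close>-saturation without constants: the variables below \<open>k\<close> stand for the parameters, and variable \<open>k\<close> is to
  be realized.\<close>

definition omega_saturated :: "('f, 'r) lang \<Rightarrow> ('f, 'r, 'u) struct \<Rightarrow> bool" where
  "omega_saturated L M \<longleftrightarrow> (\<forall>k. \<forall>s\<in>assignments M. \<forall>p \<subseteq> formulas L (Suc k).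
     (\<forall>F. finite F \<longrightarrow> F \<subseteq> p \<longrightarrow> (\<exists>b\<in>univ M. \<forall>\<phi>\<in>F. sat M (s(k := b)) \<phi>)) \<longrightarrow>
     (\<exists>b\<in>univ M. \<forall>\<phi>\<in>p. sat M (s(k := b)) \<phi>))"

lemma omega_saturatedD:
  "omega_saturated L M \<Longrightarrow> s \<in> assignments M \<Longrightarrow> p \<subseteq> formulas L (Suc k) \<Longrightarrow>
   (\<And>F. finite F \<Longrightarrow> F \<subseteq> p \<Longrightarrow> \<exists>b\<in>univ M. \<forall>\<phi>\<in>F. sat M (s(k := b)) \<phi>) \<Longrightarrow>
   \<exists>b\<in>univ M. \<forall>\<phi>\<in>p. sat M (s(k := b)) \<phi>"
  unfolding omega_saturated_def by blast

text \<open>If each of the finitely many elements violates a formula of the type, then these formulas form a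
  finite part of the type that is not realized.\<close>

lemma finite_omega_saturated:
  assumes "finite (univ M)" and M: "is_struct L M"
  shows "omega_saturated L M"
  unfolding omega_saturated_def
proof (intro allI ballI impI)
  fix k s p
  assume a: "\<forall>F. finite F \<longrightarrow> F \<subseteq> p \<longrightarrow> (\<exists>b\<in>univ M. \<forall>\<phi>\<in>F. sat M (s(k := b)) \<phi>)"
  show "\<exists>b\<in>univ M. \<forall>\<phi>\<in>p. sat M (s(k := b)) \<phi>"
  proof (rule ccontr)
    assume "\<not> ?thesis"
    then obtain f where f: "\<And>b. b \<in> univ M \<Longrightarrow> f b \<in> p \<and> \<not> sat M (s(k := b)) (f b)" by metis
    have "finite (f ` univ M)" "f ` univ M \<subseteq> p" using assms(1) f by auto
    then obtain b where "b \<in> univ M" "\<forall>\<phi>\<in>f ` univ M. sat M (s(k := b)) \<phi>" using a by blast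
    then show False using f by blast
  qed
qed

lemma omega_saturated_extends:
  assumes M: "is_struct L M" and N: "is_struct L N" and sat: "omega_saturated L N"
  shows "extends L M N"
  unfolding extends_def
proof (intro allI ballI impI)
  fix k y b c assume y: "y \<in> assignments M" and b: "b \<in> assignments N"
    and same: "tp L M k y = tp L N k b" and c: "c \<in> univ M"
  let ?y = "y(k := c)"
  have y': "?y \<in> assignments M" using y c by simp
  have "\<exists>d\<in>univ N. \<forall>\<phi>\<in>tp L M (Suc k) ?y. sat N (b(k := d)) \<phi>"
  proof (rule omega_saturatedD[OF sat b tp_formulas])
    fix F assume F: "finite F" "F \<subseteq> tp L M (Suc k) ?y"
    obtain fs where fs: "set fs = F" using F(1) finite_list by blast
    have wf: "conjs fs \<in> formulas L (Suc k)" using F(2) fs by (auto simp: tp_def)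
    have "sat M y (tuple_ex [0..<k] (conjs fs))"
      unfolding sat_tuple_prefix[OF y] using y' F(2) fs by (intro bexI[of _ ?y]) (auto simp: tp_def)
    then have "sat N b (tuple_ex [0..<k] (conjs fs))"
      using same tuple_prefix_formulas[OF formulas_wf[OF wf]] unfolding tp_eq_iff by blast
    then obtain t where t: "t \<in> assignments N" "agree k t b" "sat N t (conjs fs)"
      unfolding sat_tuple_prefix[OF b] by blast
    have "agree (Suc k) (b(k := t k)) t" using agree_sym[OF t(2)] by (simp add: agree_Suc)
    then have "sat N (b(k := t k)) (conjs fs)" using sat_agree[OF wf] t(3) by blast
    then show "\<exists>d\<in>univ N. \<forall>\<phi>\<in>F. sat N (b(k := d)) \<phi>" using t(1) fs by (intro bexI[of _ "t k"]) auto
  qed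
  then obtain d where d: "d \<in> univ N" "\<And>\<phi>. \<phi> \<in> tp L M (Suc k) ?y \<Longrightarrow> sat N (b(k := d)) \<phi>" by blast
  have "sat M ?y \<phi> \<longleftrightarrow> sat N (b(k := d)) \<phi>" if "\<phi> \<in> formulas L (Suc k)" for \<phi>
    using d(2)[of \<phi>] d(2)[of "Neg \<phi>"] that unfolding tp_def by (cases "sat M ?y \<phi>") simp_all
  then have "tp L M (Suc k) ?y = tp L N (Suc k) (b(k := d))" unfolding tp_eq_iff by blast
  then show "\<exists>d\<in>univ N. tp L M (Suc k) ?y = tp L N (Suc k) (b(k := d))" using d(1) by blast
qed

lemma omega_saturated_universal:
  assumes M: "is_struct L M" "countable (univ M)"
    and N: "is_struct L N" "countable (univ N)" "omega_saturated L N" and Th: "Th L M = Th L N"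
  obtains h where "elementary_map L M N h"
  using back_and_forth[OF M N(1,2) Th omega_saturated_extends[OF M(1) N(1,3)], of False] by blast

lemma finite_elem_equiv_iso:
  assumes M: "is_struct L M" "finite (univ M)" and N: "is_struct L N" and Th: "Th L M = Th L N"
  shows "iso L M N"
proof -
  have fN: "finite (univ N)" by (rule finite_transfer[OF N M(1) Th[symmetric] M(2)])
  have "extends L M N" "extends L N M"
    using omega_saturated_extends finite_omega_saturated M N fN by blast+
  then obtain h where "elementary_map L M N h" "h ` univ M = univ N"
    using back_and_forth[OF M(1) _ N _ Th, of True] M(2) fN by (metis countable_finite)
  then show ?thesis unfolding iso_iff_elementary by blast
qed

lemma omega_saturated_iso:
  assumes "iso L M N" "omega_saturated L M"
  shows "omega_saturated L N"
  unfolding omega_saturated_def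
proof (intro allI ballI impI)
  obtain h where h: "elementary_map L M N h" "h ` univ M = univ N"
    using assms(1) unfolding iso_iff_elementary by blast
  fix k s p assume s: "s \<in> assignments N" and p: "p \<subseteq> formulas L (Suc k)"
    and fin: "\<forall>F. finite F \<longrightarrow> F \<subseteq> p \<longrightarrow> (\<exists>b\<in>univ N. \<forall>\<phi>\<in>F. sat N (s(k := b)) \<phi>)"
  have "\<forall>i. \<exists>x. x \<in> univ M \<and> s i = h x" using s h(2) by (metis assignments_in imageE)
  then obtain t where t: "\<And>i. t i \<in> univ M" "\<And>i. s i = h (t i)" by metis
  have ta: "t \<in> assignments M" using t(1) by (rule assignmentsI)
  have eq: "sat N (s(k := h b)) \<phi> \<longleftrightarrow> sat M (t(k := b)) \<phi>" if "b \<in> univ M" "\<phi> \<in> p" for b \<phi>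
  proof -
    have "h \<circ> t(k := b) = s(k := h b)" by (auto simp: fun_eq_iff t(2))
    then show ?thesis
      using elementary_map_sat[OF h(1) _ assignments_upd[OF ta that(1)], of \<phi> k] p that(2)
      by (auto simp: formulas_def)
  qed
  have "\<exists>b\<in>univ M. \<forall>\<phi>\<in>p. sat M (t(k := b)) \<phi>"
  proof (rule omega_saturatedD[OF assms(2) ta p])
    fix F assume F: "finite F" "F \<subseteq> p"
    then obtain b where b: "b \<in> univ N" "\<forall>\<phi>\<in>F. sat N (s(k := b)) \<phi>" using fin by blast
    then obtain c where "c \<in> univ M" "b = h c" unfolding h(2)[symmetric] by blast
    then have "c \<in> univ M" "\<forall>\<phi>\<in>F. sat N (s(k := h c)) \<phi>" using b(2) by auto
    then show "\<exists>b\<in>univ M. \<forall>\<phi>\<in>F. sat M (t(k := b)) \<phi>" using eq F(2) by blast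
  qed
  then obtain b where "b \<in> univ M" "\<forall>\<phi>\<in>p. sat M (t(k := b)) \<phi>" by blast
  then show "\<exists>b\<in>univ N. \<forall>\<phi>\<in>p. sat N (s(k := b)) \<phi>" using eq h(2) by blast
qed

text \<open>The entries of the tuple are found one at a time. The next one realizes the formulas saying that
  finite parts of \<open>p\<close> can be satisfied by a suitable choice of the remaining entries.\<close>

lemma omega_saturated_tuples:
  assumes M: "is_struct L M" "omega_saturated L M"
    and "s \<in> assignments M" "p \<subseteq> formulas L (k + l)"
    and "\<And>F. finite F \<Longrightarrow> F \<subseteq> p \<Longrightarrow> \<exists>t\<in>assignments M. agree k t s \<and> (\<forall>\<phi>\<in>F. sat M t \<phi>)"
  shows "\<exists>t\<in>assignments M. agree k t s \<and> (\<forall>\<phi>\<in>p. sat M t \<phi>)"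
  using assms(3-)
proof (induction l arbitrary: k s)
  case 0
  have "sat M s \<phi>" if "\<phi> \<in> p" for \<phi>
  proof -
    obtain t where "t \<in> assignments M" "agree k t s" "sat M t \<phi>" using 0(3)[of "{\<phi>}"] \<open>\<phi> \<in> p\<close> by auto
    then show ?thesis using sat_agree[of \<phi> L k t s M] 0(2) that by auto
  qed
  then show ?case using 0(1) by (intro bexI[of _ s]) auto
next
  case (Suc l)
  define q where "q = {tuple_ex [0..<Suc k] (conjs fs) | fs. set fs \<subseteq> p}"
  have wf: "wf_fm L (conjs fs)" if "set fs \<subseteq> p" for fs
    using that Suc.prems(2) by (auto simp: formulas_def)
  have "q \<subseteq> formulas L (Suc k)" unfolding q_def using tuple_prefix_formulas[OF wf] by blast
  then have "\<exists>b\<in>univ M. \<forall>\<phi>\<in>q. sat M (s(k := b)) \<phi>"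
  proof (rule omega_saturatedD[OF M(2) Suc.prems(1)])
    fix F assume F: "finite F" "F \<subseteq> q"
    then obtain g where g: "\<And>\<phi>. \<phi> \<in> F \<Longrightarrow> \<phi> = tuple_ex [0..<Suc k] (conjs (g \<phi>)) \<and> set (g \<phi>) \<subseteq> p"
      unfolding q_def subset_iff mem_Collect_eq by metis
    have "finite (\<Union>\<phi>\<in>F. set (g \<phi>))" "(\<Union>\<phi>\<in>F. set (g \<phi>)) \<subseteq> p" using F(1) g by auto
    then obtain t where t: "t \<in> assignments M" "agree k t s" "\<forall>\<psi>\<in>(\<Union>\<phi>\<in>F. set (g \<phi>)). sat M t \<psi>"
      using Suc.prems(3) by blast
    have s': "s(k := t k) \<in> assignments M" using Suc.prems(1) t(1) by simp
    have "agree (Suc k) t (s(k := t k))" using t(2) by (simp add: agree_Suc)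
    then have "sat M (s(k := t k)) \<phi>" if "\<phi> \<in> F" for \<phi>
      using g[OF that] t(1,3) that sat_tuple_prefix[OF s', of "Suc k" "conjs (g \<phi>)"] by auto
    then show "\<exists>b\<in>univ M. \<forall>\<phi>\<in>F. sat M (s(k := b)) \<phi>" using t(1) by (intro bexI[of _ "t k"]) auto
  qed
  then obtain b where b: "b \<in> univ M" "\<And>\<phi>. \<phi> \<in> q \<Longrightarrow> sat M (s(k := b)) \<phi>" by blast
  have s': "s(k := b) \<in> assignments M" using Suc.prems(1) b(1) by simp
  have "\<exists>t\<in>assignments M. agree (Suc k) t (s(k := b)) \<and> (\<forall>\<phi>\<in>p. sat M t \<phi>)"
  proof (rule Suc.IH[OF s'])
    show "p \<subseteq> formulas L (Suc k + l)" using Suc.prems(2) by simp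
    fix F assume F: "finite F" "F \<subseteq> p"
    then obtain fs where fs: "set fs = F" using finite_list by blast
    then have "sat M (s(k := b)) (tuple_ex [0..<Suc k] (conjs fs))"
      using F(2) by (intro b(2)) (auto simp: q_def simp del: upt_Suc)
    then show "\<exists>t\<in>assignments M. agree (Suc k) t (s(k := b)) \<and> (\<forall>\<phi>\<in>F. sat M t \<phi>)"
      unfolding sat_tuple_prefix[OF s'] using fs by auto
  qed
  then show ?case by (auto simp: agree_Suc)
qed

lemma omega_saturated_realizes:
  assumes M: "is_struct L M" "omega_saturated L M" and p: "p \<subseteq> formulas L k" "finsat M p"
  obtains t where "t \<in> assignments M" "\<And>\<phi>. \<phi> \<in> p \<Longrightarrow> sat M t \<phi>"
proof -
  obtain s where s: "s \<in> assignments M" using ex_assignment[OF M(1)] by blast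
  have "\<exists>t\<in>assignments M. agree 0 t s \<and> (\<forall>\<phi>\<in>p. sat M t \<phi>)"
  proof (rule omega_saturated_tuples[OF M s, of p 0 k])
    show "p \<subseteq> formulas L (0 + k)" using p(1) by simp
    fix F assume "finite F" "F \<subseteq> p"
    then show "\<exists>t\<in>assignments M. agree 0 t s \<and> (\<forall>\<phi>\<in>F. sat M t \<phi>)"
      using p(2) by (simp add: finsat_def)
  qed
  then show thesis using that by blast
qed

section \<open>Small theories\<close>

lemma tp_complete_type:
  fixes M :: "('f, 'r, 'u) struct" and P :: "('f, 'r, 'v) struct"
  assumes L: "countable_lang L" and M: "is_struct L M"
    and P: "is_struct L P" "Th L P = Th L M" "s \<in> assignments P"
  shows "tp L P k s \<in> complete_types TYPE('u) L (Th L M) k"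
proof -
  have "finsat M (tp L P k s)"
    using finsat_transfer[OF P(1) M P(2) _ finsat_tp[OF P(3)]] by (auto simp: tp_def formulas_def)
  then have "consistent_with TYPE('u) L (Th L M) (tp L P k s)"
    using consistent_with_iff[OF L M tp_formulas] by blast
  then show ?thesis by (auto simp: complete_types_def tp_def)
qed

lemma countable_realized_types:
  assumes "countable (univ M)"
  shows "countable {tp L M k s | k s. s \<in> assignments M}"
proof -
  let ?g = "\<lambda>xs. tp L M (length xs) (\<lambda>i. if i < length xs then xs ! i else undefined)"
  have "{tp L M k s | k s. s \<in> assignments M} \<subseteq> ?g ` lists (univ M)"
  proof clarify
    fix k s assume s: "s \<in> assignments M"
    let ?xs = "map s [0..<k]"
    have "tp L M k s = ?g ?xs"
      unfolding length_map length_upt diff_zero by (rule tp_agree) (simp add: agree_def)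
    moreover have "?xs \<in> lists (univ M)" using s by auto
    ultimately show "tp L M k s \<in> ?g ` lists (univ M)" by (rule image_eqI)
  qed
  then show ?thesis using assms by (meson countable_image countable_lists countable_subset)
qed

text \<open>By compactness all types are realized in countable models. So there are at most as many types as
  there are finite tuples in the countably many countable structures \<open>Z j\<close>.\<close>

lemma small_if_types_realized:
  fixes M :: "('f, 'r, 'u) struct"
  assumes L: "countable_lang L" and M: "is_struct L M" and J: "countable J"
    and Z: "\<And>j. j \<in> J \<Longrightarrow> countable (univ (Z j))"
    and real: "\<And>(N :: ('f, 'r, 'u) struct) k s. is_struct L N \<Longrightarrow> countable (univ N) \<Longrightarrow> Th L N = Th L M \<Longrightarrow>
      s \<in> assignments N \<Longrightarrow> \<exists>j\<in>J. \<exists>t\<in>assignments (Z j). tp L N k s = tp L (Z j) k t"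
  shows "small_theory TYPE('u) L (Th L M)"
proof -
  have "complete_types TYPE('u) L (Th L M) k \<subseteq> (\<Union>j\<in>J. {tp L (Z j) k s | k s. s \<in> assignments (Z j)})" for k
  proof
    fix p assume "p \<in> complete_types TYPE('u) L (Th L M) k"
    then have p: "p \<subseteq> formulas L k" "\<forall>\<phi>\<in>formulas L k. \<phi> \<in> p \<or> Neg \<phi> \<in> p"
      "consistent_with TYPE('u) L (Th L M) p" by (auto simp: complete_types_def)
    then obtain N :: "('f, 'r, 'u) struct" and t where N: "is_struct L N" "Th L N = Th L M" "range t = univ N"
      "\<And>\<phi>. \<phi> \<in> p \<Longrightarrow> sat N t \<phi>"
      using compactness[OF L M p(1)] consistent_with_iff[OF L M p(1)] by metis
    have t: "t \<in> assignments N" using N(3) by (simp add: assignments_def)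
    have "p = tp L N k t" using p(1,2) N(4) unfolding tp_def by fastforce
    moreover have "countable (univ N)" unfolding N(3)[symmetric] by simp
    ultimately show "p \<in> (\<Union>j\<in>J. {tp L (Z j) k s | k s. s \<in> assignments (Z j)})"
      using real[OF N(1) _ N(2) t, of k] by blast
  qed
  then have "(\<Union>k. complete_types TYPE('u) L (Th L M) k) \<subseteq>
      (\<Union>j\<in>J. {tp L (Z j) k s | k s. s \<in> assignments (Z j)})" by blast
  then show ?thesis unfolding small_theory_def
    by (rule countable_subset) (intro countable_UN J countable_realized_types Z)
qed

lemma omega_saturated_small:
  fixes M :: "('f, 'r, 'u) struct"
  assumes L: "countable_lang L" and M: "is_struct L M" "countable (univ M)" "omega_saturated L M"
  shows "small_theory TYPE('u) L (Th L M)"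
proof (rule small_if_types_realized[OF L M(1), of "{()}" "\<lambda>_. M"])
  fix N :: "('f, 'r, 'u) struct" and k s
  assume N: "is_struct L N" "countable (univ N)" "Th L N = Th L M" and s: "s \<in> assignments N"
  obtain h where h: "elementary_map L N M h"
    using omega_saturated_universal[OF N(1,2) M N(3)] by blast
  have "tp L N k s = tp L M k (h \<circ> s)"
    unfolding tp_eq_iff using elementary_map_sat[OF h _ s] by (auto simp: formulas_def)
  then show "\<exists>j\<in>{()}. \<exists>t\<in>assignments M. tp L N k s = tp L M k t"
    using elementary_map_assignment[OF h s] by blast
qed (use M in auto)

text \<open>The ultrapower realizes all types over finite tuples. Since there are only countably many types, a
  countable subset of it can be closed under realizing those types over its finite tuples that are
  realized in the ultrapower; the closure is then elementary, and saturated.\<close>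

lemma small_saturated_model:
  fixes M :: "('f, 'r, 'u) struct"
  assumes L: "countable_lang L" and M: "is_struct L M" and small: "small_theory TYPE('u) L (Th L M)"
  obtains N :: "('f, 'r, 'u) struct" where
    "is_struct L N" "countable (univ N)" "Th L N = Th L M" "omega_saturated L N"
proof -
  let ?P = "upower L M"
  have P: "is_struct L ?P" by (rule is_struct_upower[OF M])
  have Th: "Th L ?P = Th L M" by (rule Th_upower[OF M])
  obtain a where a: "a \<in> univ ?P" using P by (auto simp: is_struct_def)
  define \<T> where "\<T> = {tp L ?P k s | k s. s \<in> assignments ?P}"
  have c\<T>: "countable \<T>"
  proof (rule countable_subset)
    show "\<T> \<subseteq> (\<Union>k. complete_types TYPE('u) L (Th L M) k)"
      unfolding \<T>_def using tp_complete_type[OF L M P Th] by blast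
    show "countable (\<Union>k. complete_types TYPE('u) L (Th L M) k)"
      using small by (simp add: small_theory_def)
  qed
  define asg where "asg xs i = (if i < length xs then xs ! i else a)" for xs and i :: nat
  \<comment> \<open>a realization in the ultrapower of a type over a finite tuple\<close>
  define w where "w xs q = (SOME d. d \<in> univ ?P \<and>
    ((\<exists>d\<in>univ ?P. \<forall>\<phi>\<in>q. sat ?P ((asg xs)(length xs := d)) \<phi>) \<longrightarrow>
      (\<forall>\<phi>\<in>q. sat ?P ((asg xs)(length xs := d)) \<phi>)))" for xs q
  have w: "w xs q \<in> univ ?P \<and> ((\<exists>d\<in>univ ?P. \<forall>\<phi>\<in>q. sat ?P ((asg xs)(length xs := d)) \<phi>) \<longrightarrow>
      (\<forall>\<phi>\<in>q. sat ?P ((asg xs)(length xs := w xs q)) \<phi>))" for xs q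
  proof -
    let ?R = "\<lambda>d. \<forall>\<phi>\<in>q. sat ?P ((asg xs)(length xs := d)) \<phi>"
    have "\<exists>d. d \<in> univ ?P \<and> ((\<exists>d\<in>univ ?P. ?R d) \<longrightarrow> ?R d)" using a by blast
    from someI_ex[OF this] show ?thesis unfolding w_def .
  qed
  define step where "step B = B \<union> (\<lambda>(xs, q). w xs q) ` (lists B \<times> \<T>)" for B
  define A where "A = (\<Union>n. (step ^^ n) {a})"
  have cstep: "countable B \<Longrightarrow> countable (step B)" for B
    unfolding step_def using c\<T> by auto
  have cA: "countable A"
  proof -
    have "countable ((step ^^ n) {a})" for n by (induction n) (auto intro: cstep)
    then show ?thesis by (auto simp: A_def)
  qed
  have AP: "A \<subseteq> univ ?P"
  proof -
    have "(step ^^ n) {a} \<subseteq> univ ?P" for n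
      by (induction n) (use a w in \<open>auto simp: step_def\<close>)
    then show ?thesis by (auto simp: A_def)
  qed
  have aA: "a \<in> A" unfolding A_def by (intro UN_I[of 0]) auto
  have mono: "m \<le> n \<Longrightarrow> (step ^^ m) {a} \<subseteq> (step ^^ n) {a}" for m n
    by (rule lift_Suc_mono_le) (auto simp: step_def)
  have lA: "\<exists>n. set xs \<subseteq> (step ^^ n) {a}" if "set xs \<subseteq> A" for xs
    using that
  proof (induction xs)
    case (Cons x xs)
    then obtain m n where "set xs \<subseteq> (step ^^ n) {a}" "x \<in> (step ^^ m) {a}" by (auto simp: A_def)
    then have "set (x # xs) \<subseteq> (step ^^ (max m n)) {a}"
      using mono[of m "max m n"] mono[of n "max m n"] by auto
    then show ?case by blast
  qed simp
  have wA: "w xs q \<in> A" if xs: "set xs \<subseteq> A" and q: "q \<in> \<T>" for xs q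
  proof -
    obtain n where "set xs \<subseteq> (step ^^ n) {a}" using lA[OF xs] by blast
    then have "w xs q \<in> (step ^^ Suc n) {a}"
      using q by (force simp: step_def in_lists_conv_set)
    then show ?thesis unfolding A_def by blast
  qed
  have realize: "\<exists>d\<in>A. \<forall>\<phi>\<in>p. sat ?P (s(k := d)) \<phi>"
    if s: "range s \<subseteq> A" and p: "p \<subseteq> formulas L (Suc k)"
      and fin: "\<And>F. finite F \<Longrightarrow> F \<subseteq> p \<Longrightarrow> \<exists>b\<in>univ ?P. \<forall>\<phi>\<in>F. sat ?P (s(k := b)) \<phi>" for s p k
  proof -
    have sP: "s \<in> assignments ?P" using s AP by (auto simp: assignments_def)
    have cp: "countable p"
      using p by (intro countable_subset[OF _ countable_formulas[OF L]]) (auto simp: formulas_def)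
    have wp: "wf_fm L \<phi>" if "\<phi> \<in> p" for \<phi> using that p by (auto simp: formulas_def)
    obtain d where d: "d \<in> univ ?P" "\<forall>\<phi>\<in>p. sat ?P (s(k := d)) \<phi>"
      using upower_saturated[OF M cp wp sP fin] by blast
    let ?q = "tp L ?P (Suc k) (s(k := d))" and ?xs = "map s [0..<k]"
    have ag: "agree (Suc k) ((asg ?xs)(k := e)) (s(k := e))" for e
      by (auto simp: agree_def asg_def)
    have "\<forall>\<phi>\<in>?q. sat ?P ((asg ?xs)(length ?xs := d)) \<phi>"
      using sat_agree[OF _ ag[of d]] by (auto simp: tp_def)
    then have "\<forall>\<phi>\<in>?q. sat ?P ((asg ?xs)(length ?xs := w ?xs ?q)) \<phi>" using w[of ?xs ?q] d(1) by blast
    then have "\<forall>\<phi>\<in>?q. sat ?P (s(k := w ?xs ?q)) \<phi>"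
      using sat_agree[OF _ ag[of "w ?xs ?q"]] by (auto simp: tp_def)
    moreover have "p \<subseteq> ?q" using p d(2) by (auto simp: tp_def)
    moreover have "?q \<in> \<T>" unfolding \<T>_def using sP d(1) by (auto intro!: exI[of _ "Suc k"] exI[of _ "s(k := d)"])
    then have "w ?xs ?q \<in> A" using s by (intro wA) auto
    ultimately show ?thesis by blast
  qed
  define s where "s = from_nat_into A"
  have s: "range s = A" unfolding s_def using aA cA by (intro range_from_nat_into) auto
  have sP: "s \<in> assignments ?P" using s AP by (simp add: assignments_def)
  have tv: "\<exists>y. sat ?P (s(x := s y)) \<phi>"
    if \<phi>: "wf_fm L \<phi>" "b \<in> univ ?P" "sat ?P (s(x := b)) \<phi>" for \<phi> x b
  proof -
    obtain k where k: "fv \<phi> \<subseteq> {..<k}" using finite_nat_iff_bounded[of "fv \<phi>"] by auto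
    let ?\<psi> = "sub \<phi> (id(x := k))"
    have e: "sat ?P (s(k := c)) ?\<psi> \<longleftrightarrow> sat ?P (s(x := c)) \<phi>" for c
      unfolding sat_sub using k by (intro sat_cong) auto
    have "fv ?\<psi> \<subseteq> {..<Suc k}" using fv_sub[of \<phi> "id(x := k)"] k by fastforce
    then have "{?\<psi>} \<subseteq> formulas L (Suc k)" using \<phi>(1) by (simp add: formulas_def)
    then have "\<exists>d\<in>A. \<forall>\<theta>\<in>{?\<psi>}. sat ?P (s(k := d)) \<theta>"
      by (rule realize[rotated]) (use s \<phi>(2,3) e in auto)
    then show ?thesis using e s by auto
  qed
  obtain N :: "('f, 'r, 'u) struct" and t where N: "is_struct L N" "Th L N = Th L M" "range t = univ N"
    "\<And>\<phi>. wf_fm L \<phi> \<Longrightarrow> sat N t \<phi> \<longleftrightarrow> sat ?P s \<phi>"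
    by (rule countable_hull[OF M P Th sP]) (use tv in blast)+
  have sub: "sat N (t \<circ> \<sigma>) \<phi> \<longleftrightarrow> sat ?P (s \<circ> \<sigma>) \<phi>" if "wf_fm L \<phi>" for \<sigma> \<phi>
    using N(4)[of "sub \<phi> \<sigma>"] that by (simp add: sat_sub)
  have "omega_saturated L N"
    unfolding omega_saturated_def
  proof (intro allI ballI impI)
    fix k r p assume r: "r \<in> assignments N" and p: "p \<subseteq> formulas L (Suc k)"
      and fin: "\<forall>F. finite F \<longrightarrow> F \<subseteq> p \<longrightarrow> (\<exists>b\<in>univ N. \<forall>\<phi>\<in>F. sat N (r(k := b)) \<phi>)"
    have "\<forall>i. \<exists>j. r i = t j" using r N(3) by (metis assignments_in rangeE)
    then obtain \<sigma> where \<sigma>: "\<And>i. r i = t (\<sigma> i)" by metis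
    have e: "sat N (r(k := t j)) \<phi> \<longleftrightarrow> sat ?P ((s \<circ> \<sigma>)(k := s j)) \<phi>" if "\<phi> \<in> p" for j \<phi>
    proof -
      have "t \<circ> \<sigma>(k := j) = r(k := t j)" "s \<circ> \<sigma>(k := j) = (s \<circ> \<sigma>)(k := s j)"
        by (auto simp: fun_eq_iff \<sigma>)
      then show ?thesis using sub[of \<phi> "\<sigma>(k := j)"] that p by (auto simp: formulas_def)
    qed
    have "\<exists>d\<in>A. \<forall>\<phi>\<in>p. sat ?P ((s \<circ> \<sigma>)(k := d)) \<phi>"
    proof (rule realize[OF _ p])
      show "range (s \<circ> \<sigma>) \<subseteq> A" using s by auto
      fix F assume F: "finite F" "F \<subseteq> p"
      then obtain b where b: "b \<in> univ N" "\<forall>\<phi>\<in>F. sat N (r(k := b)) \<phi>" using fin by blast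
      then obtain j where "b = t j" using N(3) by blast
      then have "\<forall>\<phi>\<in>F. sat ?P ((s \<circ> \<sigma>)(k := s j)) \<phi>" using b(2) e F(2) by blast
      then show "\<exists>b\<in>univ ?P. \<forall>\<phi>\<in>F. sat ?P ((s \<circ> \<sigma>)(k := b)) \<phi>" using sP by (meson assignments_in)
    qed
    then obtain j where "\<forall>\<phi>\<in>p. sat ?P ((s \<circ> \<sigma>)(k := s j)) \<phi>" using s by blast
    then have "\<forall>\<phi>\<in>p. sat N (r(k := t j)) \<phi>" using e by blast
    then show "\<exists>b\<in>univ N. \<forall>\<phi>\<in>p. sat N (r(k := b)) \<phi>" using N(3) by blast
  qed
  moreover have "countable (univ N)" unfolding N(3)[symmetric] by simp
  ultimately show thesis using that N by blast
qed

section \<open>Vaught's never-two theorem\<close>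

text \<open>Being isolating over \<open>a\<close> is expressed by formulas about \<open>a\<close>.\<close>

lemma isolating_transfer:
  assumes a: "a \<in> assignments M" and t: "t \<in> assignments N" and same: "tp L M m a = tp L N m t"
    and iso: "isolating L M m a k \<chi>"
  shows "isolating L N m t k \<chi>"
proof -
  have \<chi>: "\<chi> \<in> formulas L k" using iso by (simp add: isolating_def)
  have ex: "(\<exists>s\<in>assignments M. agree m s a \<and> sat M s \<phi>) \<longleftrightarrow> (\<exists>s\<in>assignments N. agree m s t \<and> sat N s \<phi>)"
    if "wf_fm L \<phi>" for \<phi>
    using same tuple_prefix_formulas[OF that, of m]
    unfolding tp_eq_iff sat_tuple_prefix[OF a, symmetric] sat_tuple_prefix[OF t, symmetric] by blast
  have "(\<forall>s\<in>assignments N. agree m s t \<longrightarrow> sat N s \<chi> \<longrightarrow> sat N s \<psi>) \<or>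
      (\<forall>s\<in>assignments N. agree m s t \<longrightarrow> sat N s \<chi> \<longrightarrow> \<not> sat N s \<psi>)" if "\<psi> \<in> formulas L k" for \<psi>
  proof -
    have "(\<forall>s\<in>assignments M. agree m s a \<longrightarrow> sat M s \<chi> \<longrightarrow> sat M s \<psi>) \<or>
      (\<forall>s\<in>assignments M. agree m s a \<longrightarrow> sat M s \<chi> \<longrightarrow> \<not> sat M s \<psi>)"
      using iso that by (simp add: isolating_def)
    then show ?thesis
      using ex[of "Conj \<chi> \<psi>"] ex[of "Conj \<chi> (Neg \<psi>)"] \<chi> that unfolding formulas_def by auto
  qed
  then show ?thesis
    using iso ex[OF formulas_wf[OF \<chi>]] unfolding isolating_def by blast
qed

lemma isolated_tuples_pullback:
  assumes h: "elementary_map L N M h" and iso: "isolated_tuples L M"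
  shows "isolated_tuples L N"
  unfolding isolated_tuples_def
proof (intro allI ballI)
  fix k s assume s: "s \<in> assignments N"
  have hs: "h \<circ> s \<in> assignments M" by (rule elementary_map_assignment[OF h s])
  then obtain \<chi> where \<chi>: "complete_in L M k \<chi>" "sat M (h \<circ> s) \<chi>"
    using iso unfolding isolated_tuples_def by blast
  have "complete_in L N k \<chi>"
    using \<chi>(1) complete_in_transfer[of L N M] elementary_map_struct[OF h] elementary_map_Th[OF h] by blast
  moreover have "sat N s \<chi>"
    using elementary_map_sat[OF h _ s, of \<chi>] \<chi> by (auto simp: isolating_def formulas_def)
  ultimately show "\<exists>\<chi>. complete_in L N k \<chi> \<and> sat N s \<chi>" by blast
qed

text \<open>In the countable structure \<open>S\<close> only countably many types over \<open>a\<close> are realized, so the non-isolated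
  ones can be omitted simultaneously. This suffices because, \<open>S\<close> being saturated, every type over \<open>t\<close> that
  is realized in \<open>N\<close> is realized over \<open>a\<close> in \<open>S\<close>.\<close>

lemma model_atomic_over:
  fixes S :: "('f, 'r, 'u) struct"
  assumes L: "countable_lang L" and S: "is_struct L S" "countable (univ S)" "omega_saturated L S"
    and a: "a \<in> assignments S"
  obtains N :: "('f, 'r, 'u) struct" and t where
    "is_struct L N" "Th L N = Th L S" "range t = univ N" "tp L N m t = tp L S m a"
    "\<And>l s. m \<le> l \<Longrightarrow> s \<in> assignments N \<Longrightarrow> agree m s t \<Longrightarrow> \<exists>\<chi>. isolating L N m t l \<chi> \<and> sat N s \<chi>"
proof -
  \<comment> \<open>the pair with \<open>Neg Tr\<close> makes \<open>\<Omega>\<close> nonempty, so that it can be enumerated\<close>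
  define \<Omega> where "\<Omega> = insert (m, {Neg Tr}) {(l, tp L S l b) | l b. m \<le> l \<and> b \<in> assignments S \<and> agree m b a \<and>
     (\<forall>\<chi>. isolating L S m a l \<chi> \<longrightarrow> \<not> sat S b \<chi>)}"
  have "\<Omega> \<subseteq> insert (m, {Neg Tr}) (UNIV \<times> {tp L S l b | l b. b \<in> assignments S})"
    unfolding \<Omega>_def by blast
  then have c: "countable \<Omega>"
    by (rule countable_subset) (intro countable_insert countable_SIGMA countable_realized_types S, auto)
  define e where "e = from_nat_into \<Omega>"
  have "\<Omega> \<noteq> {}" by (simp add: \<Omega>_def)
  then have e: "range e = \<Omega>" unfolding e_def by (rule range_from_nat_into[OF _ c])
  then have e\<Omega>: "e j \<in> \<Omega>" for j by blast
  obtain N :: "('f, 'r, 'u) struct" and t where N: "is_struct L N" "Th L N = Th L S" "range t = univ N"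
    "tp L N m t = tp L S m a"
    and omit: "\<And>j s. s \<in> assignments N \<Longrightarrow> agree m s t \<Longrightarrow> \<exists>\<psi>\<in>snd (e j). \<not> sat N s \<psi>"
  proof (rule omitting_types[OF L S(1) a, of m "\<lambda>j. fst (e j)" "\<lambda>j. snd (e j)"])
    show "m \<le> fst (e j)" for j using e\<Omega>[of j] by (auto simp: \<Omega>_def)
    show "snd (e j) \<subseteq> formulas L (fst (e j))" for j
      using e\<Omega>[of j] by (auto simp: \<Omega>_def tp_def) (simp add: formulas_def)
    fix j \<phi> s
    assume \<phi>: "\<phi> \<in> formulas L (fst (e j))" "s \<in> assignments S" "agree m s a" "sat S s \<phi>"
    consider "e j = (m, {Neg Tr})" | l b where "e j = (l, tp L S l b)" "m \<le> l" "b \<in> assignments S" "agree m b a"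
      "\<And>\<chi>. isolating L S m a l \<chi> \<Longrightarrow> \<not> sat S b \<chi>" using e\<Omega>[of j] unfolding \<Omega>_def by blast
    then show "\<exists>\<psi>\<in>snd (e j). \<exists>s\<in>assignments S. agree m s a \<and> sat S s \<phi> \<and> \<not> sat S s \<psi>"
    proof cases
      case 1
      then show ?thesis using \<phi> by auto
    next
      case 2
      show ?thesis
      proof (rule ccontr)
        assume "\<not> ?thesis"
        then have imp: "sat S u \<psi>" if "\<psi> \<in> tp L S l b" "u \<in> assignments S" "agree m u a" "sat S u \<phi>" for u \<psi>
          using that 2(1) by auto
        have mem: "\<psi> \<in> tp L S l b \<or> Neg \<psi> \<in> tp L S l b" if "\<psi> \<in> formulas L l" for \<psi>
          using that by (auto simp: tp_def)
        have "isolating L S m a l \<phi>"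
          unfolding isolating_def
        proof (intro conjI ballI)
          show "\<phi> \<in> formulas L l" using \<phi>(1) 2(1) by simp
          show "\<exists>s\<in>assignments S. agree m s a \<and> sat S s \<phi>" using \<phi> by blast
          fix \<psi> assume "\<psi> \<in> formulas L l"
          then show "(\<forall>s\<in>assignments S. agree m s a \<longrightarrow> sat S s \<phi> \<longrightarrow> sat S s \<psi>) \<or>
            (\<forall>s\<in>assignments S. agree m s a \<longrightarrow> sat S s \<phi> \<longrightarrow> \<not> sat S s \<psi>)"
            using imp[of \<psi>] imp[of "Neg \<psi>"] mem by auto
        qed
        then have "\<not> sat S b \<phi>" by (rule 2(5))
        then have "Neg \<phi> \<in> tp L S l b" using \<phi>(1) 2(1) by (simp add: tp_def)
        from imp[OF this \<phi>(2-4)] show False using \<phi>(4) by simp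
      qed
    qed
  qed blast
  have t: "t \<in> assignments N" using N(3) by (simp add: assignments_def)
  show thesis
  proof (rule that[OF N])
    fix l s assume l: "m \<le> l" and s: "s \<in> assignments N" "agree m s t"
    have "\<exists>b\<in>assignments S. agree m b a \<and> (\<forall>\<phi>\<in>tp L N l s. sat S b \<phi>)"
    proof (rule omega_saturated_tuples[OF S(1,3) a, of _ m "l - m"])
      show "tp L N l s \<subseteq> formulas L (m + (l - m))" using tp_formulas[of L N l s] l by simp
      fix F assume F: "finite F" "F \<subseteq> tp L N l s"
      then obtain fs where fs: "set fs = F" using finite_list by blast
      have wf: "wf_fm L (conjs fs)" using F(2) fs by (auto simp: tp_def formulas_def)
      have "sat N t (tuple_ex [0..<m] (conjs fs))"
        unfolding sat_tuple_prefix[OF t] using s F(2) fs by (intro bexI[of _ s]) (auto simp: tp_def)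
      then have "sat S a (tuple_ex [0..<m] (conjs fs))"
        using N(4) tuple_prefix_formulas[OF wf, of m] unfolding tp_eq_iff by blast
      then show "\<exists>b\<in>assignments S. agree m b a \<and> (\<forall>\<phi>\<in>F. sat S b \<phi>)"
        unfolding sat_tuple_prefix[OF a] using fs by auto
    qed
    then obtain b where b: "b \<in> assignments S" "agree m b a" "\<And>\<phi>. \<phi> \<in> tp L N l s \<Longrightarrow> sat S b \<phi>" by blast
    have "sat N s \<phi> \<longleftrightarrow> sat S b \<phi>" if "\<phi> \<in> formulas L l" for \<phi>
      using b(3)[of \<phi>] b(3)[of "Neg \<phi>"] that unfolding tp_def by (cases "sat N s \<phi>") simp_all
    then have eq: "tp L N l s = tp L S l b" unfolding tp_eq_iff by blast
    have "\<exists>\<chi>. isolating L S m a l \<chi> \<and> sat S b \<chi>"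
    proof (rule ccontr)
      assume "\<not> ?thesis"
      then have "(l, tp L S l b) \<in> \<Omega>" using l b(1,2) unfolding \<Omega>_def by blast
      then obtain j where "e j = (l, tp L S l b)" using e by (metis rangeE)
      then obtain \<psi> where "\<psi> \<in> tp L S l b" "\<not> sat N s \<psi>" using omit[OF s, of j] by auto
      then show False unfolding eq[symmetric] by (simp add: tp_def)
    qed
    then obtain \<chi> where \<chi>: "isolating L S m a l \<chi>" "sat S b \<chi>" by blast
    then have "sat N s \<chi>" using eq unfolding tp_eq_iff by (auto simp: isolating_def)
    then show "\<exists>\<chi>. isolating L N m t l \<chi> \<and> sat N s \<chi>"
      using isolating_transfer[OF a t N(4)[symmetric] \<chi>(1)] by blast
  qed
qed

text \<open>Saturation makes finitely many formulas isolating over \<open>t\<close> cover all \<open>k\<close>-tuples, so that only finitely many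
  types of \<open>k\<close>-tuples are realized. The type of \<open>t\<close> is isolated by a conjunction of formulas that
  separate it from each of the other types.\<close>

lemma isolated_over_imp_isolated:
  assumes N: "is_struct L N" "omega_saturated L N" and t: "t \<in> assignments N"
    and iso: "\<And>s. s \<in> assignments N \<Longrightarrow> agree k s t \<Longrightarrow> \<exists>\<chi>. isolating L N k t (k + k) \<chi> \<and> sat N s \<chi>"
  shows "\<exists>\<theta>. complete_in L N k \<theta> \<and> sat N t \<theta>"
proof -
  let ?\<Gamma> = "{\<chi>. isolating L N k t (k + k) \<chi>}"
  have "\<exists>F. finite F \<and> F \<subseteq> Neg ` ?\<Gamma> \<and> (\<forall>s\<in>assignments N. agree k s t \<longrightarrow> (\<exists>\<phi>\<in>F. \<not> sat N s \<phi>))"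
  proof (rule ccontr)
    assume "\<not> ?thesis"
    then have fin: "\<exists>s\<in>assignments N. agree k s t \<and> (\<forall>\<phi>\<in>F. sat N s \<phi>)"
      if "finite F" "F \<subseteq> Neg ` ?\<Gamma>" for F
      using that by meson
    have "Neg ` ?\<Gamma> \<subseteq> formulas L (k + k)" by (auto simp: isolating_def)
    from omega_saturated_tuples[OF N t this fin]
    obtain s where "s \<in> assignments N" "agree k s t" "\<forall>\<phi>\<in>Neg ` ?\<Gamma>. sat N s \<phi>" by meson
    then show False using iso[of s] by auto
  qed
  then obtain F where F: "finite F" "F \<subseteq> Neg ` ?\<Gamma>"
    "\<And>s. s \<in> assignments N \<Longrightarrow> agree k s t \<Longrightarrow> \<exists>\<phi>\<in>F. \<not> sat N s \<phi>" by blast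
  obtain G where G: "G \<subseteq> ?\<Gamma>" "finite G" "F = Neg ` G" using finite_subset_image[OF F(1,2)] by blast
  let ?p = "tp L N k t"
  \<comment> \<open>the variables below \<open>k\<close> are taken by \<open>t\<close>; the tuples to be covered come behind them\<close>
  let ?sh = "\<lambda>\<psi>. sub \<psi> (\<lambda>i. k + i)"
  have sh: "?sh \<psi> \<in> formulas L (k + k)" if "\<psi> \<in> formulas L k" for \<psi>
    using that fv_sub[of \<psi> "\<lambda>i. k + i"] by (fastforce simp: formulas_def)
  \<comment> \<open>\<open>\<psi>\<close> holds at \<open>t\<close>, but not at the tuples described by \<open>\<chi>\<close>\<close>
  define bad where "bad \<chi> \<psi> \<longleftrightarrow> \<psi> \<in> ?p \<and>
    (\<forall>s\<in>assignments N. agree k s t \<longrightarrow> sat N s \<chi> \<longrightarrow> \<not> sat N s (?sh \<psi>))" for \<chi> \<psi>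
  define f where "f \<chi> = (SOME \<psi>. bad \<chi> \<psi>)" for \<chi>
  have f: "bad \<chi> (f \<chi>)" if "\<exists>\<psi>. bad \<chi> \<psi>" for \<chi>
    unfolding f_def using someI_ex[OF that] .
  obtain xs where xs: "set xs = f ` {\<chi> \<in> G. \<exists>\<psi>. bad \<chi> \<psi>}"
    using finite_list[of "f ` {\<chi> \<in> G. \<exists>\<psi>. bad \<chi> \<psi>}"] G(2) by auto
  let ?\<theta> = "conjs xs"
  have fp: "f \<chi> \<in> ?p" if "\<exists>\<psi>. bad \<chi> \<psi>" for \<chi> using f[OF that] by (simp add: bad_def)
  have \<theta>: "?\<theta> \<in> formulas L k" "sat N t ?\<theta>" using xs fp by (auto simp: tp_def)
  have main: "sat N u \<psi>" if u: "u \<in> assignments N" "sat N u ?\<theta>" and \<psi>: "\<psi> \<in> ?p" for u \<psi>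
  proof -
    define s where "s i = (if i < k then t i else u (i - k))" for i
    have s: "s \<in> assignments N" using t u(1) by (auto simp: s_def intro!: assignmentsI)
    have ag: "agree k s t" by (auto simp: agree_def s_def)
    have ssh: "sat N s (?sh \<xi>) \<longleftrightarrow> sat N u \<xi>" for \<xi>
      unfolding sat_sub by (intro sat_cong) (simp add: s_def)
    obtain \<chi> where \<chi>: "\<chi> \<in> G" "sat N s \<chi>" using F(3)[OF s ag] G(3) by auto
    have "\<not> (\<exists>\<psi>. bad \<chi> \<psi>)"
    proof
      assume b: "\<exists>\<psi>. bad \<chi> \<psi>"
      then have "sat N u (f \<chi>)" using u(2) xs \<chi>(1) by auto
      moreover have "\<not> sat N s (?sh (f \<chi>))" using f[OF b] s ag \<chi>(2) by (simp add: bad_def)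
      ultimately show False using ssh by blast
    qed
    then obtain s' where s': "s' \<in> assignments N" "agree k s' t" "sat N s' \<chi>" "sat N s' (?sh \<psi>)"
      using \<psi> unfolding bad_def by blast
    have "isolating L N k t (k + k) \<chi>" using \<chi>(1) G(1) by blast
    then have "sat N s (?sh \<psi>)"
      by (rule isolating_decides[OF _ sh s'(1,2,3,4) s ag \<chi>(2)]) (use \<psi> in \<open>simp add: tp_def\<close>)
    then show ?thesis using ssh by blast
  qed
  have "complete_in L N k ?\<theta>"
    unfolding isolating_def
  proof (intro conjI ballI)
    show "?\<theta> \<in> formulas L k" by (rule \<theta>(1))
    show "\<exists>s\<in>assignments N. agree 0 s undefined \<and> sat N s ?\<theta>" using t \<theta>(2) by auto
    fix \<psi> assume "\<psi> \<in> formulas L k"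
    then have "\<psi> \<in> ?p \<or> Neg \<psi> \<in> ?p" by (auto simp: tp_def)
    then show "(\<forall>s\<in>assignments N. agree 0 s undefined \<longrightarrow> sat N s ?\<theta> \<longrightarrow> sat N s \<psi>) \<or>
        (\<forall>s\<in>assignments N. agree 0 s undefined \<longrightarrow> sat N s ?\<theta> \<longrightarrow> \<not> sat N s \<psi>)"
      using main[of _ \<psi>] main[of _ "Neg \<psi>"] by auto
  qed
  then show ?thesis using \<theta>(2) by blast
qed

text \<open>A countable model isomorphic to neither \<open>A\<close> nor \<open>B\<close> is the third one. If there is none, then every type is
  realized in \<open>A\<close> or in \<open>B\<close>, so the theory is small. Let \<open>P\<close> be a countable atomic and \<open>S\<close> a countable
  saturated model. If all tuples in all models were isolated, then any two countable models would be
  isomorphic; so some tuple \<open>a\<close> of \<open>S\<close> has a non-isolated type. Let \<open>N\<close> be atomic over a tuple of the same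
  type as \<open>a\<close>. Neither \<open>S\<close> nor \<open>N\<close> is atomic, and \<open>N\<close> is not saturated, because otherwise that tuple would be
  isolated. Hence \<open>P\<close>, \<open>S\<close> and \<open>N\<close> are pairwise non-isomorphic.\<close>

theorem never_two:
  fixes A B :: "('f, 'r, 'u) struct"
  assumes L: "countable_lang L" and A: "is_struct L A" "countable (univ A)"
    and B: "is_struct L B" "countable (univ B)" and Th: "Th L A = Th L B" and AB: "\<not> iso L A B"
  shows "\<exists>X Y Z :: ('f, 'r, 'u) struct. (\<forall>W\<in>{X, Y, Z}. is_struct L W \<and> countable (univ W) \<and> Th L W = Th L A) \<and>
    \<not> iso L X Y \<and> \<not> iso L X Z \<and> \<not> iso L Y Z"
proof (cases "\<forall>C :: ('f, 'r, 'u) struct. is_struct L C \<longrightarrow> countable (univ C) \<longrightarrow> Th L C = Th L A \<longrightarrow> iso L C A \<or> iso L C B")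
  case False
  then obtain C :: "('f, 'r, 'u) struct" where C: "is_struct L C" "countable (univ C)" "Th L C = Th L A"
    "\<not> iso L C A" "\<not> iso L C B" by blast
  then show ?thesis using A B Th AB by (intro exI[of _ C] exI[of _ A] exI[of _ B]) auto
next
  case two: True
  have "small_theory TYPE('u) L (Th L A)"
  proof (rule small_if_types_realized[OF L A(1), of "{A, B}" "\<lambda>Z. Z"])
    fix N :: "('f, 'r, 'u) struct" and k s
    assume N: "is_struct L N" "countable (univ N)" "Th L N = Th L A" and s: "s \<in> assignments N"
    then obtain Z where Z: "Z \<in> {A, B}" "iso L N Z" using two by blast
    then obtain h where h: "elementary_map L N Z h" unfolding iso_iff_elementary by blast
    have "tp L N k s = tp L Z k (h \<circ> s)"
      unfolding tp_eq_iff using elementary_map_sat[OF h _ s] by (auto simp: formulas_def)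
    then show "\<exists>Z\<in>{A, B}. \<exists>t\<in>assignments Z. tp L N k s = tp L Z k t"
      using elementary_map_assignment[OF h s] Z(1) by blast
  qed (use A B in auto)
  then obtain S :: "('f, 'r, 'u) struct" where S: "is_struct L S" "countable (univ S)" "Th L S = Th L A" "omega_saturated L S"
    using small_saturated_model[OF L A(1)] by blast
  obtain s0 where s0: "s0 \<in> assignments S" using ex_assignment[OF S(1)] by blast
  obtain P :: "('f, 'r, 'u) struct" and u where P: "is_struct L P" "Th L P = Th L S" "range u = univ P"
    and Piso: "\<And>l s. 0 \<le> l \<Longrightarrow> s \<in> assignments P \<Longrightarrow> agree 0 s u \<Longrightarrow> \<exists>\<chi>. isolating L P 0 u l \<chi> \<and> sat P s \<chi>"
    by (rule model_atomic_over[OF L S(1,2,4) s0, of 0]) blast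
  have Pat: "isolated_tuples L P"
    using Piso unfolding isolated_tuples_def isolating_def by simp
  have "\<not> isolated_tuples L A \<or> \<not> isolated_tuples L B"
    using isolated_tuples_isoI[OF A _ B _ Th] AB by blast
  then obtain R :: "('f, 'r, 'u) struct" where R: "is_struct L R" "Th L R = Th L A" "\<not> isolated_tuples L R"
    using A B Th by metis
  then obtain k r where r: "r \<in> assignments R" "\<And>\<chi>. complete_in L R k \<chi> \<Longrightarrow> \<not> sat R r \<chi>"
    unfolding isolated_tuples_def by blast
  have "finsat S (tp L R k r)"
    using finsat_transfer[OF R(1) S(1) _ _ finsat_tp[OF r(1)]] R(2) S(3) by (auto simp: tp_def formulas_def)
  then obtain a where a: "a \<in> assignments S" "\<And>\<phi>. \<phi> \<in> tp L R k r \<Longrightarrow> sat S a \<phi>"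
    using omega_saturated_realizes[OF S(1,4) tp_formulas] by blast
  have "sat R r \<phi> \<longleftrightarrow> sat S a \<phi>" if "\<phi> \<in> formulas L k" for \<phi>
    using a(2)[of \<phi>] a(2)[of "Neg \<phi>"] that unfolding tp_def by (cases "sat R r \<phi>") simp_all
  then have ra: "tp L R k r = tp L S k a" unfolding tp_eq_iff by blast
  obtain N :: "('f, 'r, 'u) struct" and t where N: "is_struct L N" "Th L N = Th L S" "range t = univ N"
    "tp L N k t = tp L S k a"
    and Niso: "\<And>l s. k \<le> l \<Longrightarrow> s \<in> assignments N \<Longrightarrow> agree k s t \<Longrightarrow> \<exists>\<chi>. isolating L N k t l \<chi> \<and> sat N s \<chi>"
    by (rule model_atomic_over[OF L S(1,2,4) a(1), of k]) blast
  have t: "t \<in> assignments N" using N(3) by (simp add: assignments_def)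
  have nonisolated: "\<not> (\<exists>\<chi>. complete_in L W k \<chi> \<and> sat W w \<chi>)"
    if W: "is_struct L W" "Th L W = Th L A" "tp L W k w = tp L R k r" for W :: "('f, 'r, 'u) struct" and w
  proof
    assume "\<exists>\<chi>. complete_in L W k \<chi> \<and> sat W w \<chi>"
    then obtain \<chi> where \<chi>: "complete_in L W k \<chi>" "sat W w \<chi>" by blast
    have "complete_in L R k \<chi>" using complete_in_transfer[OF W(1) R(1)] W(2) R(2) \<chi>(1) by simp
    moreover have "sat R r \<chi>" using W(3) \<chi> unfolding tp_eq_iff isolating_def by blast
    ultimately show False using r(2) by blast
  qed
  have "\<not> isolated_tuples L S" "\<not> isolated_tuples L N"
    using nonisolated[OF S(1,3) ra[symmetric]] nonisolated[OF N(1), of t] N(2,4) S(3) ra a(1) t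
    unfolding isolated_tuples_def by metis+
  then have PS: "\<not> iso L P S" "\<not> iso L P N"
    using Pat isolated_tuples_pullback iso_sym unfolding iso_iff_elementary by metis+
  have SN: "\<not> iso L S N"
  proof
    assume "iso L S N"
    then have "omega_saturated L N" using omega_saturated_iso S(4) by blast
    then have "\<exists>\<theta>. complete_in L N k \<theta> \<and> sat N t \<theta>"
      using isolated_over_imp_isolated[OF N(1) _ t] Niso[of "k + k"] by simp
    then show False using nonisolated[OF N(1)] N(2,4) S(3) ra by simp
  qed
  have "countable (univ P)" "countable (univ N)" unfolding N(3)[symmetric] P(3)[symmetric] by simp_all
  then show ?thesis
    using P N S PS SN by (intro exI[of _ P] exI[of _ S] exI[of _ N]) auto
qed

section \<open>Saturation with constants and with variables\<close>

lemma countable_expand_lang: "countable_lang L \<Longrightarrow> finite A \<Longrightarrow> countable_lang (expand_lang L A)"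
  by (auto simp: countable_lang_def expand_lang_def countable_finite)

lemma univ_expand [simp]: "univ (expand_struct L M A) = univ M"
  by (simp add: expand_struct_def)

lemma assignments_expand [simp]: "assignments (expand_struct L M A) = assignments M"
  by (simp add: assignments_def)

lemma fint_expand:
  "f \<in> funs L \<Longrightarrow> fint (expand_struct L M A) (Inl f) xs = fint M f xs"
  "a \<in> A \<Longrightarrow> fint (expand_struct L M A) (Inr a) [] = a"
  by (simp_all add: expand_struct_def expand_lang_def)

lemma expand_lang_simps [simp]:
  "Inl f \<in> funs (expand_lang L A) \<longleftrightarrow> f \<in> funs L"
  "Inr a \<in> funs (expand_lang L A) \<longleftrightarrow> a \<in> A"
  "far (expand_lang L A) (Inl f) = far L f"
  "far (expand_lang L A) (Inr a) = 0"
  "rels (expand_lang L A) = rels L" "rar (expand_lang L A) = rar L"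
  "rint (expand_struct L M A) = rint M"
  by (auto simp: expand_lang_def expand_struct_def)

lemma is_struct_expand:
  assumes M: "is_struct L M" and A: "A \<subseteq> univ M"
  shows "is_struct (expand_lang L A) (expand_struct L M A)"
proof -
  have "fint (expand_struct L M A) g xs \<in> univ M"
    if "g \<in> funs (expand_lang L A)" "xs \<in> tuples (univ M) (far (expand_lang L A) g)" for g xs
    using that A fint_in[OF M] by (auto simp: expand_struct_def expand_lang_def tuples_def)
  moreover have "fint (expand_struct L M A) g xs = undefined"
    if "g \<in> funs (expand_lang L A)" "xs \<notin> tuples (univ M) (far (expand_lang L A) g)" for g xs
  proof -
    have "fint M f xs = undefined" if f: "f \<in> funs L" "xs \<notin> tuples (univ M) (far L f)" for f
    proof -
      have "fint M f \<in> tuples (univ M) (far L f) \<rightarrow>\<^sub>E univ M"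
        using M f(1) unfolding is_struct_def by (blast dest: PiE_mem)
      then show ?thesis using f(2) by (rule PiE_arb)
    qed
    then show ?thesis
      using that by (cases g) (auto simp: expand_struct_def tuples_def split: if_splits)
  qed
  ultimately have "fint (expand_struct L M A) \<in>
      (\<Pi>\<^sub>E g\<in>funs (expand_lang L A). tuples (univ M) (far (expand_lang L A) g) \<rightarrow>\<^sub>E univ M)"
    by (intro PiE_I) (auto simp: expand_struct_def)
  then show ?thesis using M by (simp add: is_struct_def)
qed

text \<open>The constants become variables below \<open>k\<close>; all variables, free or bound, are shifted by \<open>k\<close> to make room
  for them.\<close>

fun vars_of_consts_trm :: "nat \<Rightarrow> ('u \<Rightarrow> nat) \<Rightarrow> ('f + 'u) trm \<Rightarrow> 'f trm" where
  "vars_of_consts_trm k c (Var x) = Var (k + x)"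
| "vars_of_consts_trm k c (Fun (Inl f) ts) = Fun f (map (vars_of_consts_trm k c) ts)"
| "vars_of_consts_trm k c (Fun (Inr a) ts) = Var (c a)"

primrec vars_of_consts :: "nat \<Rightarrow> ('u \<Rightarrow> nat) \<Rightarrow> ('f + 'u, 'r) fm \<Rightarrow> ('f, 'r) fm" where
  "vars_of_consts k c (Eq t u) = Eq (vars_of_consts_trm k c t) (vars_of_consts_trm k c u)"
| "vars_of_consts k c (Rel r ts) = Rel r (map (vars_of_consts_trm k c) ts)"
| "vars_of_consts k c (Neg \<phi>) = Neg (vars_of_consts k c \<phi>)"
| "vars_of_consts k c (Imp \<phi> \<psi>) = Imp (vars_of_consts k c \<phi>) (vars_of_consts k c \<psi>)"
| "vars_of_consts k c (All x \<phi>) = All (k + x) (vars_of_consts k c \<phi>)"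

lemma vars_of_consts_trm:
  assumes "wf_trm (expand_lang L A) t"
  shows "wf_trm L (vars_of_consts_trm k c t)"
    and "fv_trm (vars_of_consts_trm k c t) \<subseteq> (+) k ` fv_trm t \<union> c ` A"
    and "(\<And>x. s' (k + x) = s x) \<Longrightarrow> (\<And>a. a \<in> A \<Longrightarrow> s' (c a) = a) \<Longrightarrow>
      val M s' (vars_of_consts_trm k c t) = val (expand_struct L M A) s t"
proof -
  show "wf_trm L (vars_of_consts_trm k c t)"
    using assms by (induction k c t rule: vars_of_consts_trm.induct) auto
  show "fv_trm (vars_of_consts_trm k c t) \<subseteq> (+) k ` fv_trm t \<union> c ` A"
    using assms
  proof (induction k c t rule: vars_of_consts_trm.induct)
    case (2 k c f ts)
    have "fv_trm (vars_of_consts_trm k c u) \<subseteq> (+) k ` fv_trm u \<union> c ` A" if "u \<in> set ts" for u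
      using 2(1)[OF that] 2(2) that by simp
    then have "(\<Union>u\<in>set ts. fv_trm (vars_of_consts_trm k c u)) \<subseteq>
        (+) k ` (\<Union>u\<in>set ts. fv_trm u) \<union> c ` A" by blast
    then show ?case by simp
  qed auto
  assume "\<And>x. s' (k + x) = s x" "\<And>a. a \<in> A \<Longrightarrow> s' (c a) = a"
  then show "val M s' (vars_of_consts_trm k c t) = val (expand_struct L M A) s t"
    using assms
  proof (induction k c t rule: vars_of_consts_trm.induct)
    case (2 k c f ts)
    have "map (val M s') (map (vars_of_consts_trm k c) ts) = map (val (expand_struct L M A) s) ts"
      using 2(1)[OF _ 2(2,3)] 2(4) by simp
    then show ?case using 2(4) fint_expand(1)[of f L M A] by (simp del: map_map)
  next
    case (3 k c a ts)
    then show ?case by (simp add: fint_expand)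
  qed simp
qed

lemma vars_of_consts_wf_fv:
  assumes "wf_fm (expand_lang L A) \<phi>"
  shows "wf_fm L (vars_of_consts k c \<phi>)"
    and "fv (vars_of_consts k c \<phi>) \<subseteq> (+) k ` fv \<phi> \<union> c ` A"
proof -
  show "wf_fm L (vars_of_consts k c \<phi>)"
    using assms by (induction \<phi>) (auto intro: vars_of_consts_trm)
  show "fv (vars_of_consts k c \<phi>) \<subseteq> (+) k ` fv \<phi> \<union> c ` A"
    using assms
  proof (induction \<phi>)
    case (Eq t u)
    then show ?case using vars_of_consts_trm(2)[of L A t k c] vars_of_consts_trm(2)[of L A u k c] by auto
  next
    case (Rel r ts)
    have "fv_trm (vars_of_consts_trm k c u) \<subseteq> (+) k ` fv_trm u \<union> c ` A" if "u \<in> set ts" for u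
      by (rule vars_of_consts_trm(2)[of L]) (use Rel that in simp)
    then have "(\<Union>u\<in>set ts. fv_trm (vars_of_consts_trm k c u)) \<subseteq>
        (+) k ` (\<Union>u\<in>set ts. fv_trm u) \<union> c ` A" by blast
    then show ?case by simp
  qed auto
qed

lemma sat_vars_of_consts:
  assumes "wf_fm (expand_lang L A) \<phi>" and c: "\<And>a. a \<in> A \<Longrightarrow> c a < k"
    and "\<And>x. s' (k + x) = s x" and "\<And>a. a \<in> A \<Longrightarrow> s' (c a) = a"
  shows "sat M s' (vars_of_consts k c \<phi>) \<longleftrightarrow> sat (expand_struct L M A) s \<phi>"
  using assms(1,3,4)
proof (induction \<phi> arbitrary: s s')
  case (Eq t u)
  then show ?case
    using vars_of_consts_trm(3)[of L A t s' k s c M] vars_of_consts_trm(3)[of L A u s' k s c M] by simp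
next
  case (Rel r ts)
  have "map (val M s') (map (vars_of_consts_trm k c) ts) = map (val (expand_struct L M A) s) ts"
    using Rel vars_of_consts_trm(3)[of L A _ s' k s c M] by auto
  then show ?case by (simp del: map_map)
next
  case (Neg \<phi>)
  have "sat M s' (vars_of_consts k c \<phi>) = sat (expand_struct L M A) s \<phi>"
    by (rule Neg.IH) (use Neg.prems in auto)
  then show ?case by simp
next
  case (Imp \<phi> \<psi>)
  have "sat M s' (vars_of_consts k c \<phi>) = sat (expand_struct L M A) s \<phi>"
    by (rule Imp.IH(1)) (use Imp.prems in auto)
  moreover have "sat M s' (vars_of_consts k c \<psi>) = sat (expand_struct L M A) s \<psi>"
    by (rule Imp.IH(2)) (use Imp.prems in auto)
  ultimately show ?case by simp
next
  case (All x \<phi>)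
  have "sat M (s'(k + x := b)) (vars_of_consts k c \<phi>) = sat (expand_struct L M A) (s(x := b)) \<phi>" for b
  proof (rule All.IH)
    show "(s'(k + x := b)) (c a) = a" if "a \<in> A" for a
      using c[OF that] All.prems(3)[OF that] by simp
  qed (use All.prems in auto)
  then show ?case by simp
qed

text \<open>The partial map \<open>\<rho>\<close> tells which variables become constants. A quantifier removes its variable from
  the domain of \<open>\<rho>\<close>; as constants contain no variables, nothing can be captured.\<close>

primrec consts_of_vars_trm :: "(nat \<Rightarrow> 'u option) \<Rightarrow> 'f trm \<Rightarrow> ('f + 'u) trm" where
  "consts_of_vars_trm \<rho> (Var x) = (case \<rho> x of None \<Rightarrow> Var x | Some a \<Rightarrow> Fun (Inr a) [])"
| "consts_of_vars_trm \<rho> (Fun f ts) = Fun (Inl f) (map (consts_of_vars_trm \<rho>) ts)"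

primrec consts_of_vars :: "('f, 'r) fm \<Rightarrow> (nat \<Rightarrow> 'u option) \<Rightarrow> ('f + 'u, 'r) fm" where
  "consts_of_vars (Eq t u) \<rho> = Eq (consts_of_vars_trm \<rho> t) (consts_of_vars_trm \<rho> u)"
| "consts_of_vars (Rel r ts) \<rho> = Rel r (map (consts_of_vars_trm \<rho>) ts)"
| "consts_of_vars (Neg \<phi>) \<rho> = Neg (consts_of_vars \<phi> \<rho>)"
| "consts_of_vars (Imp \<phi> \<psi>) \<rho> = Imp (consts_of_vars \<phi> \<rho>) (consts_of_vars \<psi> \<rho>)"
| "consts_of_vars (All x \<phi>) \<rho> = All x (consts_of_vars \<phi> (\<rho>(x := None)))"

lemma consts_of_vars_trm:
  assumes "wf_trm L t" "ran \<rho> \<subseteq> A"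
  shows "wf_trm (expand_lang L A) (consts_of_vars_trm \<rho> t)"
    and "fv_trm (consts_of_vars_trm \<rho> t) \<subseteq> fv_trm t - dom \<rho>"
    and "val (expand_struct L M A) s (consts_of_vars_trm \<rho> t) =
      val M (\<lambda>x. case \<rho> x of None \<Rightarrow> s x | Some a \<Rightarrow> a) t"
proof -
  show "wf_trm (expand_lang L A) (consts_of_vars_trm \<rho> t)"
    using assms by (induction t) (auto split: option.split intro: ranI)
  show "fv_trm (consts_of_vars_trm \<rho> t) \<subseteq> fv_trm t - dom \<rho>"
    by (induction t) (auto split: option.split)
  show "val (expand_struct L M A) s (consts_of_vars_trm \<rho> t) =
      val M (\<lambda>x. case \<rho> x of None \<Rightarrow> s x | Some a \<Rightarrow> a) t"
    using assms(1)
  proof (induction t)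
    case (Var x)
    then show ?case using assms(2) by (auto split: option.split simp: fint_expand ranI subset_iff)
  next
    case (Fun f ts)
    have "map (val (expand_struct L M A) s) (map (consts_of_vars_trm \<rho>) ts) =
        map (val M (\<lambda>x. case \<rho> x of None \<Rightarrow> s x | Some a \<Rightarrow> a)) ts"
      using Fun by auto
    then show ?case using Fun.prems fint_expand(1)[of f L M A] by (simp del: map_map)
  qed
qed

lemma ran_upd_None: "ran \<rho> \<subseteq> A \<Longrightarrow> ran (\<rho>(x := None)) \<subseteq> A"
  by (auto simp: ran_def split: if_splits)

lemma consts_of_vars:
  assumes "wf_fm L \<phi>" "ran \<rho> \<subseteq> A"
  shows "wf_fm (expand_lang L A) (consts_of_vars \<phi> \<rho>)"
    and "fv (consts_of_vars \<phi> \<rho>) \<subseteq> fv \<phi> - dom \<rho>"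
    and "sat (expand_struct L M A) s (consts_of_vars \<phi> \<rho>) \<longleftrightarrow>
      sat M (\<lambda>x. case \<rho> x of None \<Rightarrow> s x | Some a \<Rightarrow> a) \<phi>"
proof -
  show "wf_fm (expand_lang L A) (consts_of_vars \<phi> \<rho>)"
    using assms
  proof (induction \<phi> arbitrary: \<rho>)
    case (All x \<phi>)
    then show ?case using ran_upd_None[of \<rho> A x] by simp
  qed (auto intro: consts_of_vars_trm)
  show "fv (consts_of_vars \<phi> \<rho>) \<subseteq> fv \<phi> - dom \<rho>"
    using assms
  proof (induction \<phi> arbitrary: \<rho>)
    case (Eq t u)
    then show ?case using consts_of_vars_trm(2)[of L t \<rho> A] consts_of_vars_trm(2)[of L u \<rho> A] by auto
  next
    case (Rel r ts)
    have "fv_trm (consts_of_vars_trm \<rho> t) \<subseteq> fv_trm t - dom \<rho>" if "t \<in> set ts" for t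
      by (rule consts_of_vars_trm(2)[of L t \<rho> A]) (use Rel that in simp_all)
    then have "(\<Union>t\<in>set ts. fv_trm (consts_of_vars_trm \<rho> t)) \<subseteq> (\<Union>t\<in>set ts. fv_trm t - dom \<rho>)"
      by (rule UN_mono[OF order_refl])
    then show ?case by auto
  next
    case (Imp \<phi> \<psi>)
    have "fv (consts_of_vars \<phi> \<rho>) \<subseteq> fv \<phi> - dom \<rho>" "fv (consts_of_vars \<psi> \<rho>) \<subseteq> fv \<psi> - dom \<rho>"
      using Imp by auto
    then show ?case by auto
  next
    case (All x \<phi>)
    have "fv (consts_of_vars \<phi> (\<rho>(x := None))) \<subseteq> fv \<phi> - dom (\<rho>(x := None))"
    proof (rule All.IH)
      show "wf_fm L \<phi>" using All.prems(1) by simp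
      show "ran (\<rho>(x := None)) \<subseteq> A" by (rule ran_upd_None[OF All.prems(2)])
    qed
    then show ?case by auto
  qed auto
  show "sat (expand_struct L M A) s (consts_of_vars \<phi> \<rho>) \<longleftrightarrow>
      sat M (\<lambda>x. case \<rho> x of None \<Rightarrow> s x | Some a \<Rightarrow> a) \<phi>"
    using assms
  proof (induction \<phi> arbitrary: \<rho> s)
    case (Eq t u)
    then show ?case
      using consts_of_vars_trm(3)[of L t \<rho> A M s] consts_of_vars_trm(3)[of L u \<rho> A M s] by simp
  next
    case (Rel r ts)
    have "map (val (expand_struct L M A) s) (map (consts_of_vars_trm \<rho>) ts) =
        map (val M (\<lambda>x. case \<rho> x of None \<Rightarrow> s x | Some a \<Rightarrow> a)) ts"
      using Rel consts_of_vars_trm(3)[of L _ \<rho> A M s] by auto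
    then show ?case by (simp del: map_map)
  next
    case (All x \<phi>)
    have "sat (expand_struct L M A) (s(x := b)) (consts_of_vars \<phi> (\<rho>(x := None))) \<longleftrightarrow>
        sat M ((\<lambda>y. case \<rho> y of None \<Rightarrow> s y | Some a \<Rightarrow> a)(x := b)) \<phi>" for b
    proof -
      have "(\<lambda>y. case (\<rho>(x := None)) y of None \<Rightarrow> (s(x := b)) y | Some a \<Rightarrow> a) =
          (\<lambda>y. case \<rho> y of None \<Rightarrow> s y | Some a \<Rightarrow> a)(x := b)"
        by (auto simp: fun_eq_iff split: option.split)
      then show ?thesis
        using All.IH[of "\<rho>(x := None)" "s(x := b)"] All.prems ran_upd_None[of \<rho> A x]
        by (simp only: wf_fm.simps)
    qed
    then show ?case by simp
  qed auto
qed

text \<open>The translations between constants and variables match the types over a finite set with the types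
  over a finite tuple. By compactness in the language with constants, consistency with the theory of
  the expansion is finite satisfiability in the expansion.\<close>

lemma saturated_iff_omega_saturated:
  fixes M :: "('f, 'r, 'u) struct" and \<kappa> :: "'k rel"
  assumes L: "countable_lang L" and M: "is_struct L M"
    and \<kappa>: "\<And>A. A \<subseteq> univ M \<Longrightarrow> |A| <o \<kappa> \<longleftrightarrow> finite A"
  shows "saturated L \<kappa> M \<longleftrightarrow> omega_saturated L M"
proof -
  have cons: "consistent_with TYPE('u) (expand_lang L A) (Th (expand_lang L A) (expand_struct L M A)) p
      \<longleftrightarrow> finsat (expand_struct L M A) p"
    if "A \<subseteq> univ M" "finite A" "p \<subseteq> formulas (expand_lang L A) 1" for A p
    by (rule consistent_with_iff[OF countable_expand_lang[OF L that(2)] is_struct_expand[OF M that(1)] that(3)])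
  show ?thesis
  proof
    assume sat: "saturated L \<kappa> M"
    show "omega_saturated L M"
      unfolding omega_saturated_def
    proof (intro allI ballI impI)
      fix k s p assume s: "s \<in> assignments M" and p: "p \<subseteq> formulas L (Suc k)"
        and fin: "\<forall>F. finite F \<longrightarrow> F \<subseteq> p \<longrightarrow> (\<exists>b\<in>univ M. \<forall>\<phi>\<in>F. sat M (s(k := b)) \<phi>)"
      let ?A = "s ` {..<k}"
      \<comment> \<open>variable \<open>k\<close>, the one to be realized, becomes \<open>v\<^sub>0\<close>; parameter \<open>i\<close> is moved out of the way and then
        replaced by the constant \<open>s i\<close>\<close>
      let ?\<sigma> = "\<lambda>i. if i = k then 0 else Suc i"
      let ?\<rho> = "\<lambda>i. case i of 0 \<Rightarrow> None | Suc j \<Rightarrow> if j < k then Some (s j) else None"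
      let ?tr = "\<lambda>\<phi>. consts_of_vars (sub \<phi> ?\<sigma>) ?\<rho>"
      have A: "?A \<subseteq> univ M" "finite ?A" using s by auto
      have "b \<in> ?A" if "?\<rho> i = Some b" for i b using that by (cases i) (auto split: if_splits)
      then have ran: "ran ?\<rho> \<subseteq> ?A" unfolding ran_def by blast
      have wf: "wf_fm L (sub \<phi> ?\<sigma>)" if "\<phi> \<in> p" for \<phi> using that p by (auto simp: formulas_def)
      have tr_formulas: "?tr ` p \<subseteq> formulas (expand_lang L ?A) 1"
      proof (rule image_subsetI)
        fix \<phi> assume \<phi>: "\<phi> \<in> p"
        have "fv (sub \<phi> ?\<sigma>) \<subseteq> ?\<sigma> ` fv \<phi>" by (rule fv_sub)
        moreover have "fv \<phi> \<subseteq> {..<Suc k}" using \<phi> p by (auto simp: formulas_def)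
        ultimately have "fv (sub \<phi> ?\<sigma>) - dom ?\<rho> \<subseteq> {..<1}"
          by (fastforce simp: dom_def split: nat.splits if_splits)
        then show "?tr \<phi> \<in> formulas (expand_lang L ?A) 1"
          using consts_of_vars(1,2)[OF wf[OF \<phi>] ran] unfolding formulas_def by blast
      qed
      have tr: "sat (expand_struct L M ?A) t (?tr \<phi>) \<longleftrightarrow> sat M (s(k := t 0)) \<phi>" if "\<phi> \<in> p" for \<phi> t
      proof -
        have "sat (expand_struct L M ?A) t (?tr \<phi>) \<longleftrightarrow>
            sat M ((\<lambda>x. case ?\<rho> x of None \<Rightarrow> t x | Some a \<Rightarrow> a) \<circ> ?\<sigma>) \<phi>"
          unfolding consts_of_vars(3)[OF wf[OF that] ran] sat_sub ..
        also have "\<dots> \<longleftrightarrow> sat M (s(k := t 0)) \<phi>"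
          using that p by (intro sat_formulas_cong[of \<phi> L "Suc k"]) auto
        finally show ?thesis .
      qed
      have "finsat (expand_struct L M ?A) (?tr ` p)"
        unfolding finsat_def
      proof (intro allI impI)
        fix F assume "finite F" "F \<subseteq> ?tr ` p"
        then obtain G where G: "G \<subseteq> p" "finite G" "F = ?tr ` G" by (rule finite_subset_image[elim_format]) blast
        then obtain b where b: "b \<in> univ M" "\<forall>\<phi>\<in>G. sat M (s(k := b)) \<phi>" using fin by blast
        have "\<forall>\<phi>\<in>F. sat (expand_struct L M ?A) (\<lambda>_. b) \<phi>"
          using b(2) tr[of _ "\<lambda>_. b"] G by auto
        then show "\<exists>t\<in>assignments (expand_struct L M ?A). \<forall>\<phi>\<in>F. sat (expand_struct L M ?A) t \<phi>"
          using b(1) by (intro bexI[of _ "\<lambda>_. b"]) (auto intro: assignmentsI)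
      qed
      then have "realizes (expand_struct L M ?A) (?tr ` p)"
        using sat A(1) \<kappa>[OF A(1)] A(2) tr_formulas cons[OF A tr_formulas] unfolding saturated_def by blast
      then obtain t where "t \<in> assignments M" "\<forall>\<phi>\<in>p. sat (expand_struct L M ?A) t (?tr \<phi>)"
        unfolding realizes_def by auto
      then show "\<exists>b\<in>univ M. \<forall>\<phi>\<in>p. sat M (s(k := b)) \<phi>"
        using tr by (intro bexI[of _ "t 0"]) auto
    qed
  next
    assume sat: "omega_saturated L M"
    show "saturated L \<kappa> M"
      unfolding saturated_def
    proof (intro allI impI)
      fix A p assume A: "A \<subseteq> univ M" "|A| <o \<kappa>" and p: "p \<subseteq> formulas (expand_lang L A) 1"
        and "consistent_with TYPE('u) (expand_lang L A) (Th (expand_lang L A) (expand_struct L M A)) p"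
      then have fA: "finite A" and fs: "finsat (expand_struct L M A) p" using \<kappa>[OF A(1)] cons[OF A(1) _ p] by auto
      obtain xs where xs: "set xs = A" using finite_list[OF fA] by blast
      let ?k = "length xs"
      have "\<forall>a\<in>A. \<exists>i. i < ?k \<and> xs ! i = a" unfolding xs[symmetric] by (simp add: in_set_conv_nth)
      then obtain c where c: "\<And>a. a \<in> A \<Longrightarrow> c a < ?k \<and> xs ! c a = a" by metis
      let ?tr = "vars_of_consts ?k c"
      obtain s where s: "s \<in> assignments M" "\<And>i. i < ?k \<Longrightarrow> s i = xs ! i"
        using assignment_of_list[OF M, of xs] xs A(1) by auto
      have wf: "wf_fm (expand_lang L A) \<phi>" if "\<phi> \<in> p" for \<phi> using that p by (auto simp: formulas_def)
      have tr_formulas: "?tr ` p \<subseteq> formulas L (Suc ?k)"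
      proof (rule image_subsetI)
        fix \<phi> assume \<phi>: "\<phi> \<in> p"
        have "fv \<phi> \<subseteq> {0}" using \<phi> p by (auto simp: formulas_def)
        then have "(+) ?k ` fv \<phi> \<union> c ` A \<subseteq> {..<Suc ?k}" using c by fastforce
        then show "?tr \<phi> \<in> formulas L (Suc ?k)"
          using vars_of_consts_wf_fv[OF wf[OF \<phi>], of ?k c] unfolding formulas_def by blast
      qed
      have tr: "sat M (s(?k := t 0)) (?tr \<phi>) \<longleftrightarrow> sat (expand_struct L M A) t \<phi>" if "\<phi> \<in> p" for \<phi> t
      proof -
        let ?s' = "\<lambda>i. if i < ?k then s i else t (i - ?k)"
        have "sat M (s(?k := t 0)) (?tr \<phi>) \<longleftrightarrow> sat M ?s' (?tr \<phi>)"
          using tr_formulas that by (intro sat_formulas_cong[of _ L "Suc ?k"]) auto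
        also have "\<dots> \<longleftrightarrow> sat (expand_struct L M A) t \<phi>"
          by (rule sat_vars_of_consts[OF wf[OF that]]) (use c s(2) in auto)
        finally show ?thesis .
      qed
      have "\<exists>b\<in>univ M. \<forall>\<phi>\<in>?tr ` p. sat M (s(?k := b)) \<phi>"
      proof (rule omega_saturatedD[OF sat s(1) tr_formulas])
        fix F assume "finite F" "F \<subseteq> ?tr ` p"
        then obtain G where G: "G \<subseteq> p" "finite G" "F = ?tr ` G" by (rule finite_subset_image[elim_format]) blast
        then obtain t where "t \<in> assignments M" "\<forall>\<phi>\<in>G. sat (expand_struct L M A) t \<phi>"
          using fs unfolding finsat_def by auto
        then show "\<exists>b\<in>univ M. \<forall>\<phi>\<in>F. sat M (s(?k := b)) \<phi>"
          using tr G by (intro bexI[of _ "t 0"]) auto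
      qed
      then obtain b where b: "b \<in> univ M" "\<forall>\<phi>\<in>p. sat M (s(?k := b)) (?tr \<phi>)" by auto
      then have "\<forall>\<phi>\<in>p. sat (expand_struct L M A) (\<lambda>_. b) \<phi>" using tr[of _ "\<lambda>_. b"] by simp
      moreover have "(\<lambda>_. b) \<in> assignments (expand_struct L M A)" using b(1) by (simp add: assignmentsI)
      ultimately show "realizes (expand_struct L M A) p" unfolding realizes_def by blast
    qed
  qed
qed

lemma saturated_natLeq_iff:
  assumes "countable_lang L" "is_struct L M"
  shows "saturated L natLeq M \<longleftrightarrow> omega_saturated L M"
  by (rule saturated_iff_omega_saturated[OF assms]) (simp add: finite_iff_ordLess_natLeq)

text \<open>Preservation of saturation is assumed for cardinals on \<open>'u set\<close>. The cardinal below works like \<open>\<omega>\<close>: it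
  is a copy of \<open>\<omega>\<close> if \<open>'u\<close> is infinite, and exceeds the size of \<open>'u\<close> otherwise.\<close>

lemma ex_finiteness_cardinal:
  "\<exists>\<kappa> :: 'u set rel. Card_order \<kappa> \<and> (\<forall>A :: 'u set. |A| <o \<kappa> \<longleftrightarrow> finite A)"
proof (cases "finite (UNIV :: 'u set)")
  case True
  have "|A| <o |UNIV :: 'u set set|" for A :: "'u set"
    by (rule ordLeq_ordLess_trans[OF card_of_mono1[OF subset_UNIV] card_of_Pow[of UNIV, unfolded Pow_UNIV]])
  then have "|A| <o |UNIV :: 'u set set| \<longleftrightarrow> finite A" for A :: "'u set"
    using finite_subset[OF subset_UNIV True] by simp
  then show ?thesis
    by (intro exI[of _ "|UNIV :: 'u set set|"] conjI card_of_Card_order allI)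
next
  case False
  then have "infinite (UNIV :: 'u set set)" using finite_Pow_iff[of "UNIV :: 'u set"] by simp
  then obtain e :: "nat \<Rightarrow> 'u set" where e: "inj e" using infinite_countable_subset by blast
  have "bij_betw e UNIV (range e)" using e by (rule inj_on_imp_bij_betw)
  then have "|range e| =o |UNIV :: nat set|" by (rule ordIso_symmetric[OF card_of_ordIsoI])
  then have eq: "|range e| =o natLeq" using card_of_nat by (rule ordIso_transitive)
  have "|A| <o |range e| \<longleftrightarrow> finite A" for A :: "'u set"
    unfolding finite_iff_ordLess_natLeq
    using ordLess_ordIso_trans[OF _ eq] ordLess_ordIso_trans[OF _ ordIso_symmetric[OF eq]] by meson
  then show ?thesis by (intro exI[of _ "|range e|"] conjI card_of_Card_order allI)
qed

section \<open>Complete theories and their models\<close>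

lemma consistent_with_singleton:
  fixes M :: "('f, 'r, 'u) struct"
  assumes M: "is_struct L M" and \<phi>: "wf_fm L \<phi>"
  shows "consistent_with TYPE('u) L (Th L M) {\<phi>} \<longleftrightarrow> (\<exists>s\<in>assignments M. sat M s \<phi>)"
  unfolding consistent_with_def model_Th_iff[OF M] realizes_def
  using sat_ex_transfer[OF _ M _ \<phi>] M by (metis insertI1 singletonD)

lemma entails_iff:
  fixes M :: "('f, 'r, 'u) struct"
  assumes M: "is_struct L M" and \<phi>: "wf_fm L \<phi>"
  shows "entails TYPE('u) L (Th L M) \<phi> \<longleftrightarrow> (\<forall>s\<in>assignments M. sat M s \<phi>)"
  unfolding entails_def model_Th_iff[OF M]
  using sat_all_transfer[OF _ M _ \<phi>] M by blast

lemma complete_fm_iff: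
  fixes M :: "('f, 'r, 'u) struct"
  assumes M: "is_struct L M"
  shows "complete_fm TYPE('u) L (Th L M) k \<phi> \<longleftrightarrow> complete_in L M k \<phi>"
proof (cases "\<phi> \<in> formulas L k")
  case True
  have "entails TYPE('u) L (Th L M) (Imp \<phi> \<psi>) \<longleftrightarrow> (\<forall>s\<in>assignments M. sat M s \<phi> \<longrightarrow> sat M s \<psi>)"
    "entails TYPE('u) L (Th L M) (Imp \<phi> (Neg \<psi>)) \<longleftrightarrow> (\<forall>s\<in>assignments M. sat M s \<phi> \<longrightarrow> \<not> sat M s \<psi>)"
    if "\<psi> \<in> formulas L k" for \<psi>
    using entails_iff[OF M, of "Imp \<phi> \<psi>"] entails_iff[OF M, of "Imp \<phi> (Neg \<psi>)"]
      formulas_wf[OF True] formulas_wf[OF that] by simp_all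
  then show ?thesis
    unfolding complete_fm_def isolating_def consistent_with_singleton[OF M formulas_wf[OF True]]
    by (simp add: True)
qed (simp add: complete_fm_def isolating_def)

lemma atomic_struct_iff:
  assumes "is_struct L M"
  shows "atomic_struct L M \<longleftrightarrow> isolated_tuples L M"
  unfolding atomic_struct_def isolated_tuples_def complete_fm_iff[OF assms] ..

lemma atomic_theory_iff:
  fixes M :: "('f, 'r, 'u) struct"
  assumes M: "is_struct L M"
  shows "atomic_theory TYPE('u) L (Th L M) \<longleftrightarrow>
    (\<forall>k. \<forall>\<phi>\<in>formulas L k. (\<exists>s\<in>assignments M. sat M s \<phi>) \<longrightarrow>
       (\<exists>\<chi>. complete_in L M k \<chi> \<and> (\<forall>s\<in>assignments M. sat M s \<chi> \<longrightarrow> sat M s \<phi>)))"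
proof -
  have "completable_fm TYPE('u) L (Th L M) k \<phi> \<longleftrightarrow>
      (\<exists>\<chi>. complete_in L M k \<chi> \<and> (\<forall>s\<in>assignments M. sat M s \<chi> \<longrightarrow> sat M s \<phi>))"
    if \<phi>: "\<phi> \<in> formulas L k" for k \<phi>
  proof -
    have "entails TYPE('u) L (Th L M) (Imp \<chi> \<phi>) \<longleftrightarrow> (\<forall>s\<in>assignments M. sat M s \<chi> \<longrightarrow> sat M s \<phi>)"
      if "complete_in L M k \<chi>" for \<chi>
      using that \<phi> entails_iff[OF M, of "Imp \<chi> \<phi>"] by (auto simp: isolating_def formulas_def)
    then show ?thesis unfolding completable_fm_def complete_fm_iff[OF M] by blast
  qed
  then show ?thesis
    unfolding atomic_theory_def using consistent_with_singleton[OF M formulas_wf] by simp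
qed

lemma isolated_tuples_atomic_theory:
  fixes M :: "('f, 'r, 'u) struct"
  assumes M: "is_struct L M" and iso: "isolated_tuples L M"
  shows "atomic_theory TYPE('u) L (Th L M)"
  unfolding atomic_theory_iff[OF M]
proof (intro allI ballI impI)
  fix k \<phi> assume \<phi>: "\<phi> \<in> formulas L k" and "\<exists>s\<in>assignments M. sat M s \<phi>"
  then obtain s where s: "s \<in> assignments M" "sat M s \<phi>" by blast
  then obtain \<chi> where \<chi>: "complete_in L M k \<chi>" "sat M s \<chi>"
    using iso unfolding isolated_tuples_def by blast
  then have "\<forall>t\<in>assignments M. sat M t \<chi> \<longrightarrow> sat M t \<phi>"
    using isolating_decides[OF \<chi>(1) \<phi> s(1) _ \<chi>(2) s(2)] by simp
  then show "\<exists>\<chi>. complete_in L M k \<chi> \<and> (\<forall>s\<in>assignments M. sat M s \<chi> \<longrightarrow> sat M s \<phi>)"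
    using \<chi>(1) by blast
qed

text \<open>An atomic model omits, for each \<open>k\<close>, the set of negations of complete formulas in \<open>k\<close> variables. That
  no satisfiable formula implies this set is the atomicity of the theory.\<close>

lemma atomic_theory_model:
  fixes M :: "('f, 'r, 'u) struct"
  assumes L: "countable_lang L" and M: "is_struct L M" and at: "atomic_theory TYPE('u) L (Th L M)"
  obtains N :: "('f, 'r, 'u) struct" where
    "is_struct L N" "countable (univ N)" "Th L N = Th L M" "isolated_tuples L N"
proof -
  obtain a where a: "a \<in> assignments M" using ex_assignment[OF M] by blast
  let ?\<Theta> = "\<lambda>k. Neg ` {\<chi>. complete_in L M k \<chi>}"
  obtain N :: "('f, 'r, 'u) struct" and t :: "nat \<Rightarrow> 'u" where N: "is_struct L N" "Th L N = Th L M" "range t = univ N"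
    and omit: "\<And>k s. s \<in> assignments N \<Longrightarrow> agree 0 s t \<Longrightarrow> \<exists>\<psi>\<in>?\<Theta> k. \<not> sat N s \<psi>"
  proof (rule omitting_types[OF L M a, of 0 "\<lambda>k. k" ?\<Theta>])
    show "?\<Theta> k \<subseteq> formulas L k" for k by (auto simp: isolating_def)
    fix k \<phi> s assume \<phi>: "\<phi> \<in> formulas L k" "s \<in> assignments M" "sat M s \<phi>"
    then obtain \<chi> where \<chi>: "complete_in L M k \<chi>" "\<forall>s\<in>assignments M. sat M s \<chi> \<longrightarrow> sat M s \<phi>"
      using at unfolding atomic_theory_iff[OF M] by blast
    then obtain u where "u \<in> assignments M" "sat M u \<chi>" by (auto simp: isolating_def)
    then show "\<exists>\<psi>\<in>?\<Theta> k. \<exists>s\<in>assignments M. agree 0 s a \<and> sat M s \<phi> \<and> \<not> sat M s \<psi>"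
      using \<chi> by (intro bexI[of _ "Neg \<chi>"] bexI[of _ u]) auto
  qed blast+
  have "isolated_tuples L N"
    unfolding isolated_tuples_def
  proof (intro allI ballI)
    fix k s assume "s \<in> assignments N"
    then obtain \<chi> where "complete_in L M k \<chi>" "sat N s \<chi>" using omit[of s k] by auto
    then show "\<exists>\<chi>. complete_in L N k \<chi> \<and> sat N s \<chi>"
      using complete_in_transfer[OF M N(1) N(2)[symmetric]] by blast
  qed
  moreover have "countable (univ N)" unfolding N(3)[symmetric] by simp
  ultimately show thesis using that N by blast
qed

lemma countable_atomic_model_iff:
  assumes "is_struct L M"
  shows "countable_atomic_model L (Th L M) A \<longleftrightarrow>
    is_struct L A \<and> Th L A = Th L M \<and> countable (univ A) \<and> isolated_tuples L A"
  unfolding countable_atomic_model_def model_Th_iff[OF assms] using atomic_struct_iff by blast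

lemma countably_saturated_model_iff:
  assumes "countable_lang L" "is_struct L M"
  shows "countably_saturated_model L (Th L M) A \<longleftrightarrow>
    is_struct L A \<and> Th L A = Th L M \<and> countable (univ A) \<and> omega_saturated L A"
  unfolding countably_saturated_model_def model_Th_iff[OF assms(2)]
  using saturated_natLeq_iff[OF assms(1)] by blast

lemma ex_countable_model:
  fixes M :: "('f, 'r, 'u) struct"
  assumes L: "countable_lang L" and M: "is_struct L M"
  obtains N :: "('f, 'r, 'u) struct" where "is_struct L N" "countable (univ N)" "Th L N = Th L M"
proof -
  have fin: "finsat M {}" using ex_assignment[OF M] by (auto simp: finsat_def)
  obtain N :: "('f, 'r, 'u) struct" and t :: "nat \<Rightarrow> 'u" where N: "is_struct L N" "Th L N = Th L M" "range t = univ N"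
    by (rule compactness[OF L M empty_subsetI[of "formulas L 0"] fin])
  moreover have "countable (univ N)" unfolding N(3)[symmetric] by simp
  ultimately show thesis using that by blast
qed

section \<open>Counting models\<close>

definition iso_rel :: "('f, 'r) lang \<Rightarrow> (('f, 'r, 'u) struct \<times> ('f, 'r, 'u) struct) set" where
  "iso_rel L = {(M, N). iso L M N}"

definition countable_models :: "('f, 'r) lang \<Rightarrow> ('f, 'r, 'u) struct \<Rightarrow> ('f, 'r, 'u) struct set" where
  "countable_models L M = {N. is_struct L N \<and> Th L N = Th L M \<and> countable (univ N)}"

text \<open>Finite models are included, which treats theories of finite and of infinite structures alike.\<close>

definition iso_types :: "('f, 'r) lang \<Rightarrow> ('f, 'r, 'u) struct \<Rightarrow> ('f, 'r, 'u) struct set set" where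
  "iso_types L M = countable_models L M // iso_rel L"

lemma iso_class_eq_iff:
  assumes "is_struct L M"
  shows "iso_rel L `` {M} = iso_rel L `` {N} \<longleftrightarrow> iso L M N"
proof
  assume "iso_rel L `` {M} = iso_rel L `` {N}"
  moreover have "M \<in> iso_rel L `` {M}" using iso_refl[OF assms] by (simp add: iso_rel_def)
  ultimately show "iso L M N" by (auto simp: iso_rel_def intro: iso_sym)
next
  assume "iso L M N"
  then have "iso L M P \<longleftrightarrow> iso L N P" for P
    using iso_trans[of L M N P] iso_trans[of L N M P] iso_sym[of L M N] by blast
  then show "iso_rel L `` {M} = iso_rel L `` {N}" by (auto simp: iso_rel_def)
qed

lemma iso_types_eq: "iso_types L M = (\<lambda>N. iso_rel L `` {N}) ` countable_models L M"
  by (auto simp: iso_types_def quotient_def)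

lemma iso_types_rep:
  assumes "c \<in> iso_types L M"
  obtains N where "N \<in> countable_models L M" "c = iso_rel L `` {N}"
  using assms unfolding iso_types_eq by blast

lemma iso_types_nonempty:
  fixes M :: "('f, 'r, 'u) struct"
  assumes "countable_lang L" "is_struct L M"
  shows "iso_types L M \<noteq> {}"
proof -
  obtain N :: "('f, 'r, 'u) struct" where "is_struct L N" "countable (univ N)" "Th L N = Th L M"
    by (rule ex_countable_model[OF assms])
  then show ?thesis unfolding iso_types_eq countable_models_def by blast
qed

lemma card_one: "|A| =o cone \<longleftrightarrow> (\<exists>a. A = {a})"
proof
  assume "|A| =o cone"
  then obtain f where "bij_betw f A {()}" unfolding cone_def card_of_ordIso[symmetric] by blast
  then have "card A = 1" using bij_betw_same_card by fastforce
  then show "\<exists>a. A = {a}" by (auto simp: card_1_singleton_iff)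
next
  assume "\<exists>a. A = {a}"
  then obtain a where "A = {a}" by blast
  then have "bij_betw (\<lambda>_. ()) A {()}" by (auto simp: bij_betw_def)
  then show "|A| =o cone" unfolding cone_def by (rule card_of_ordIsoI)
qed

text \<open>All models of the theory of a finite structure are isomorphic to it, and all models of the theory of
  an infinite structure are infinite.\<close>

lemma num_models_iso_types:
  fixes M :: "('f, 'r, 'u) struct"
  assumes L: "countable_lang L" and M: "is_struct L M"
  shows "num_models TYPE('u) L (Th L M) =o |iso_types L M|"
proof (cases "finite (univ M)")
  case True
  then have "num_models TYPE('u) L (Th L M) = |{ {} }|"
    using M unfolding num_models_def model_Th_iff[OF M] by auto
  moreover have "iso_types L M = {iso_rel L `` {M}}"
  proof -
    have "iso_rel L `` {N} = iso_rel L `` {M}" if "N \<in> countable_models L M" for N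
      using that finite_elem_equiv_iso[OF M True, of N] iso_class_eq_iff[OF M, of N]
      by (auto simp: countable_models_def)
    moreover have "M \<in> countable_models L M"
      using M True by (simp add: countable_models_def countable_finite)
    ultimately show ?thesis unfolding iso_types_eq by blast
  qed
  ultimately show ?thesis
    using card_one[of "{ {} }"] card_one[of "iso_types L M"] ordIso_transitive ordIso_symmetric
    by (metis (no_types, lifting))
next
  case False
  have inf: "infinite (univ N)" if "is_struct L N" "Th L N = Th L M" for N :: "('f, 'r, 'u) struct"
    using finite_transfer[OF M that(1) that(2)[symmetric]] False by blast
  have "|univ N| =o natLeq \<longleftrightarrow> countable (univ N)" if "is_struct L N" "Th L N = Th L M" for N :: "('f, 'r, 'u) struct"
    using inf[OF that] infinite_iff_natLeq_ordLeq[of "univ N"]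
    unfolding countable_card_le_natLeq ordIso_iff_ordLeq by blast
  then have eq: "{N. model L (Th L M) N \<and> |univ N| =o natLeq} = countable_models L M"
    unfolding model_Th_iff[OF M] countable_models_def by (intro Collect_cong) meson
  have nofin: "\<not> (\<exists>N :: ('f, 'r, 'u) struct. model L (Th L M) N \<and> finite (univ N))"
    using inf unfolding model_Th_iff[OF M] by blast
  have "num_models TYPE('u) L (Th L M) = |iso_types L M|"
    unfolding num_models_def if_not_P[OF nofin] eq iso_types_def iso_rel_def ..
  then show ?thesis using card_of_refl by simp
qed

lemma three_iso_types:
  fixes M :: "('f, 'r, 'u) struct"
  assumes L: "countable_lang L" and M: "is_struct L M" and "\<not> |iso_types L M| =o cone"
  shows "|{..<3::nat}| \<le>o |iso_types L M|"
proof -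
  obtain A where A: "A \<in> countable_models L M"
    using iso_types_nonempty[OF L M] unfolding iso_types_eq by blast
  have "iso_types L M \<noteq> {iso_rel L `` {A}}" using assms(3) card_one by blast
  then obtain B where B: "B \<in> countable_models L M" "iso_rel L `` {B} \<noteq> iso_rel L `` {A}"
    using A unfolding iso_types_eq by blast
  have sA: "is_struct L A" "countable (univ A)" "Th L A = Th L M" using A by (auto simp: countable_models_def)
  have sB: "is_struct L B" "countable (univ B)" "Th L B = Th L M" using B by (auto simp: countable_models_def)
  have nAB: "\<not> iso L A B" using B(2) iso_class_eq_iff[OF sA(1), of B] by simp
  obtain X Y Z :: "('f, 'r, 'u) struct" where XYZ:
    "\<And>W. W \<in> {X, Y, Z} \<Longrightarrow> is_struct L W \<and> countable (univ W) \<and> Th L W = Th L A"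
    "\<not> iso L X Y" "\<not> iso L X Z" "\<not> iso L Y Z"
    using never_two[OF L sA(1,2) sB(1,2) _ nAB] sA(3) sB(3) by metis
  let ?c = "\<lambda>W. iso_rel L `` {W}"
  have "?c X \<noteq> ?c Y" "?c X \<noteq> ?c Z" "?c Y \<noteq> ?c Z"
    using XYZ iso_class_eq_iff[of L X] iso_class_eq_iff[of L Y] by auto
  then have "inj_on (\<lambda>i::nat. if i = 0 then ?c X else if i = 1 then ?c Y else ?c Z) {..<3}"
    by (auto simp: inj_on_def numeral_3_eq_3 less_Suc_eq)
  moreover have "(\<lambda>i::nat. if i = 0 then ?c X else if i = 1 then ?c Y else ?c Z) ` {..<3} \<subseteq> iso_types L M"
    using XYZ(1) sA(3) unfolding iso_types_eq countable_models_def by auto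
  ultimately show ?thesis unfolding card_of_ordLeq[symmetric] by blast
qed

section \<open>Cardinalities of finite products\<close>

lemma PiE_ordLeq:
  assumes r: "Card_order r" "infinite (Field r)" and A: "\<And>i. i < n \<Longrightarrow> |A i| \<le>o r"
  shows "|\<Pi>\<^sub>E i\<in>{..<n::nat}. A i| \<le>o r"
  using A
proof (induction n)
  case 0
  have "Field r \<noteq> {}" using r(2) by auto
  then have "|{\<lambda>x. undefined}| \<le>o |Field r|" by (rule card_of_singl_ordLeq)
  then show ?case using card_of_Field_ordIso[OF r(1)] ordLeq_ordIso_trans by (auto simp: PiE_empty_domain)
next
  case (Suc n)
  have "|A n \<times> (\<Pi>\<^sub>E i\<in>{..<n}. A i)| \<le>o r"
    using Suc by (intro card_of_Times_ordLeq_infinite_Field r) auto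
  then have "|(\<lambda>(y, g). g(n := y)) ` (A n \<times> (\<Pi>\<^sub>E i\<in>{..<n}. A i))| \<le>o r"
    using card_of_image ordLeq_transitive by blast
  then show ?case by (simp add: lessThan_Suc PiE_insert_eq)
qed

lemma PiE_ordLeq_mono:
  assumes "\<And>i. i \<in> J \<Longrightarrow> |A i| \<le>o |B i|"
  shows "|\<Pi>\<^sub>E i\<in>J. A i| \<le>o |\<Pi>\<^sub>E i\<in>J. B i|"
proof -
  have "\<forall>i\<in>J. \<exists>f. inj_on f (A i) \<and> f ` A i \<subseteq> B i" using assms unfolding card_of_ordLeq[symmetric] by blast
  then obtain f where f: "\<And>i. i \<in> J \<Longrightarrow> inj_on (f i) (A i) \<and> f i ` A i \<subseteq> B i" by metis
  let ?F = "\<lambda>g. \<lambda>i\<in>J. f i (g i)"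
  have "inj_on ?F (\<Pi>\<^sub>E i\<in>J. A i)"
  proof (rule inj_onI)
    fix g h assume g: "g \<in> (\<Pi>\<^sub>E i\<in>J. A i)" and h: "h \<in> (\<Pi>\<^sub>E i\<in>J. A i)" and e: "?F g = ?F h"
    show "g = h"
    proof (rule PiE_ext[OF g h])
      fix i assume i: "i \<in> J"
      then have "f i (g i) = f i (h i)" using fun_cong[OF e, of i] by simp
      then show "g i = h i" using f[OF i] PiE_mem[OF g i] PiE_mem[OF h i] by (meson inj_onD)
    qed
  qed
  moreover have "?F ` (\<Pi>\<^sub>E i\<in>J. A i) \<subseteq> (\<Pi>\<^sub>E i\<in>J. B i)" using f by fastforce
  ultimately show ?thesis unfolding card_of_ordLeq[symmetric] by blast
qed

lemma factor_ordLeq_PiE: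
  assumes i: "i \<in> J" and "\<And>j. j \<in> J \<Longrightarrow> A j \<noteq> {}"
  shows "|A i| \<le>o |\<Pi>\<^sub>E j\<in>J. A j|"
proof -
  have "\<forall>j\<in>J. \<exists>a. a \<in> A j" using assms(2) by blast
  then obtain g where g: "\<And>j. j \<in> J \<Longrightarrow> g j \<in> A j" by metis
  let ?F = "\<lambda>a. \<lambda>j\<in>J. if j = i then a else g j"
  have "inj_on ?F (A i)" using i by (intro inj_onI) (auto dest: fun_cong[of _ _ i])
  moreover have "?F ` A i \<subseteq> (\<Pi>\<^sub>E j\<in>J. A j)" using g by auto
  ultimately show ?thesis unfolding card_of_ordLeq[symmetric] by blast
qed

section \<open>Products of a perfect pair\<close>

locale perfect_pair =
  fixes L :: "('f, 'r) lang"
    and box :: "('f, 'r, 'u) struct list \<Rightarrow> ('f, 'r, 'u) struct"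
    and C :: "('f, 'r, 'u) struct set"
    and n :: nat
  assumes perf: "Perf L box C" and n: "n \<ge> 1" and L: "countable_lang L"
begin

definition product :: "(nat \<Rightarrow> ('f, 'r, 'u) struct) \<Rightarrow> ('f, 'r, 'u) struct" where
  "product Z = box (map Z [0..<n])"

lemma in_C_struct: "M \<in> C \<Longrightarrow> is_struct L M"
  using perf by (simp add: Perf_def elementary_class_def)

lemma in_C_equiv: "M \<in> C \<Longrightarrow> is_struct L N \<Longrightarrow> Th L N = Th L M \<Longrightarrow> N \<in> C"
  using perf in_C_struct unfolding Perf_def elementary_class_def elem_equiv_def by metis

lemma clause_iso:
  assumes "range Z \<subseteq> C" "range W \<subseteq> C"
  shows "iso L (product Z) (product W) \<longleftrightarrow> (\<exists>\<pi>. \<pi> permutes {..<n} \<and> (\<forall>i<n. iso L (Z i) (W (\<pi> i))))"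
  using perf[unfolded Perf_def, THEN conjunct2, THEN conjunct2, THEN conjunct1, rule_format, OF n n assms]
  unfolding product_def by simp

lemma clause_equiv:
  assumes "range Z \<subseteq> C" "is_struct L Y"
  shows "elem_equiv L Y (product Z) \<longleftrightarrow> (\<exists>W. (\<forall>i<n. elem_equiv L (W i) (Z i)) \<and> iso L Y (product W))"
  using perf[unfolded Perf_def, THEN conjunct2, THEN conjunct2, THEN conjunct2, THEN conjunct1, rule_format, OF n assms]
  unfolding product_def .

lemma clause_elem_sub:
  assumes "range Z \<subseteq> C" "is_struct L E"
  shows "elem_sub L E (product Z) \<longleftrightarrow> (\<exists>F. (\<forall>i<n. elem_sub L (F i) (Z i)) \<and> E = product F)"
  using perf[unfolded Perf_def, THEN conjunct2, THEN conjunct2, THEN conjunct2, THEN conjunct2, rule_format, OF n assms]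
  unfolding product_def .

lemma product_cong: "\<forall>i<n. Z i = W i \<Longrightarrow> product Z = product W"
  unfolding product_def by (intro arg_cong[where f = box] map_cong) auto

text \<open>The clauses quantify over infinite sequences in the class. A finite sequence is extended by
  repeating its first entry.\<close>

lemma padded_sequence:
  assumes "\<forall>i<n. Z i \<in> C"
  shows "range (\<lambda>i. if i < n then Z i else Z 0) \<subseteq> C"
    and "product (\<lambda>i. if i < n then Z i else Z 0) = product Z"
  using assms n by (auto intro!: product_cong)

lemma product_iso:
  assumes "\<forall>i<n. Z i \<in> C" "\<forall>i<n. W i \<in> C"
  shows "iso L (product Z) (product W) \<longleftrightarrow> (\<exists>\<pi>. \<pi> permutes {..<n} \<and> (\<forall>i<n. iso L (Z i) (W (\<pi> i))))"
proof -
  let ?Z = "\<lambda>i. if i < n then Z i else Z 0" and ?W = "\<lambda>i. if i < n then W i else W 0"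
  have "iso L (product ?Z) (product ?W) \<longleftrightarrow>
      (\<exists>\<pi>. \<pi> permutes {..<n} \<and> (\<forall>i<n. iso L (?Z i) (?W (\<pi> i))))"
    by (rule clause_iso[OF padded_sequence(1)[OF assms(1)] padded_sequence(1)[OF assms(2)]])
  moreover have "\<pi> i < n" if "\<pi> permutes {..<n}" "i < n" for \<pi> i
    using permutes_in_image[OF that(1), of i] that(2) by simp
  ultimately show ?thesis
    unfolding padded_sequence(2)[OF assms(1)] padded_sequence(2)[OF assms(2)] by auto
qed

lemma product_iso_factors:
  assumes "\<forall>i<n. Z i \<in> C" "\<forall>i<n. iso L (Z i) (W i)"
  shows "iso L (product Z) (product W)"
proof -
  have "W i \<in> C" if "i < n" for i
    using in_C_equiv[OF assms(1)[rule_format, OF that]] iso_elem_equiv[OF assms(2)[rule_format, OF that]]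
    by (simp add: elem_equiv_def)
  then have "\<forall>i<n. W i \<in> C" by blast
  from product_iso[OF assms(1) this] show ?thesis
    using assms(2) permutes_id[of "{..<n}"] by (metis id_apply)
qed

lemma product_struct:
  assumes "\<forall>i<n. is_struct L (Z i)"
  shows "is_struct L (product Z)"
    and "|SIGMA i : {..<n}. univ (Z i)| \<le>o |univ (product Z)| \<or>
         |\<Pi>\<^sub>E i\<in>{..<n}. univ (Z i)| \<le>o |univ (product Z)|"
    and "|univ (product Z)| \<le>o |SIGMA i : {..<n}. univ (Z i)| \<or>
         |univ (product Z)| \<le>o |\<Pi>\<^sub>E i\<in>{..<n}. univ (Z i)|"
proof -
  have "struct_operation L box" using perf by (simp add: Perf_def)
  then have "let B = product Z; S = |(SIGMA i : {..<n}. univ (Z i))|; P = |(\<Pi>\<^sub>E i\<in>{..<n}. univ (Z i))|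
         in is_struct L B \<and> (S \<le>o |univ B| \<or> P \<le>o |univ B| ) \<and> ( |univ B| \<le>o S \<or> |univ B| \<le>o P)"
    using n assms unfolding struct_operation_def product_def by blast
  then show "is_struct L (product Z)"
    "|SIGMA i : {..<n}. univ (Z i)| \<le>o |univ (product Z)| \<or>
         |\<Pi>\<^sub>E i\<in>{..<n}. univ (Z i)| \<le>o |univ (product Z)|"
    "|univ (product Z)| \<le>o |SIGMA i : {..<n}. univ (Z i)| \<or>
         |univ (product Z)| \<le>o |\<Pi>\<^sub>E i\<in>{..<n}. univ (Z i)|"
    by (auto simp: Let_def)
qed

lemma product_factor_countable:
  assumes Z: "\<forall>i<n. is_struct L (Z i)" and c: "countable (univ (product Z))" and i: "i < n"
  shows "countable (univ (Z i))"
proof -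
  have S: "|univ (Z i)| \<le>o |SIGMA i : {..<n}. univ (Z i)|"
    unfolding card_of_ordLeq[symmetric] using i by (intro exI[of _ "Pair i"]) (auto simp: inj_on_def)
  have P: "|univ (Z i)| \<le>o |\<Pi>\<^sub>E i\<in>{..<n}. univ (Z i)|"
    using i Z by (intro factor_ordLeq_PiE) (auto simp: is_struct_def)
  have "|univ (Z i)| \<le>o |univ (product Z)|"
    by (rule disjE[OF product_struct(2)[OF Z]]) (erule ordLeq_transitive[OF S], erule ordLeq_transitive[OF P])
  then show ?thesis using c ordLeq_transitive unfolding countable_card_le_natLeq by blast
qed

lemma product_countable:
  assumes Z: "\<forall>i<n. is_struct L (Z i)" and c: "\<forall>i<n. countable (univ (Z i))"
  shows "countable (univ (product Z))"
proof -
  have S: "|SIGMA i : {..<n}. univ (Z i)| \<le>o natLeq"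
    using c unfolding countable_card_le_natLeq[symmetric] by auto
  have P: "|\<Pi>\<^sub>E i\<in>{..<n}. univ (Z i)| \<le>o natLeq"
    using c natLeq_Card_order Field_natLeq unfolding countable_card_le_natLeq by (intro PiE_ordLeq) auto
  show ?thesis
    unfolding countable_card_le_natLeq
    by (rule disjE[OF product_struct(3)[OF Z]])
      (erule ordLeq_transitive[OF _ S], erule ordLeq_transitive[OF _ P])
qed

lemma product_Th:
  assumes Z: "\<forall>i<n. Z i \<in> C"
    and W: "\<forall>i<n. is_struct L (W i)" "\<forall>i<n. Th L (W i) = Th L (Z i)"
  shows "Th L (product W) = Th L (product Z)"
proof -
  let ?Z = "\<lambda>i. if i < n then Z i else Z 0"
  have WS: "is_struct L (product W)" by (rule product_struct(1)[OF W(1)])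
  have "\<forall>i<n. elem_equiv L (W i) (?Z i)"
    using W Z in_C_struct by (simp add: elem_equiv_def)
  moreover have "iso L (product W) (product W)" by (rule iso_refl[OF WS])
  ultimately have "elem_equiv L (product W) (product ?Z)"
    unfolding clause_equiv[OF padded_sequence(1)[OF Z] WS] by blast
  then show ?thesis unfolding padded_sequence(2)[OF Z] elem_equiv_def by blast
qed

lemma product_models:
  assumes Z: "\<forall>i<n. Z i \<in> C" and Y: "is_struct L Y" "Th L Y = Th L (product Z)"
  obtains W where "\<forall>i<n. is_struct L (W i)" "\<forall>i<n. Th L (W i) = Th L (Z i)"
    "\<forall>i<n. W i \<in> C" "iso L Y (product W)"
proof -
  let ?Z = "\<lambda>i. if i < n then Z i else Z 0"
  have "is_struct L (product Z)" by (rule product_struct(1)) (use Z in_C_struct in blast)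
  then have "elem_equiv L Y (product ?Z)" unfolding padded_sequence(2)[OF Z] using Y by (simp add: elem_equiv_def)
  then obtain W where W: "\<forall>i<n. elem_equiv L (W i) (?Z i)" "iso L Y (product W)"
    unfolding clause_equiv[OF padded_sequence(1)[OF Z] Y(1)] by blast
  have Wi: "is_struct L (W i)" "Th L (W i) = Th L (Z i)" if "i < n" for i
    using W(1) that by (auto simp: elem_equiv_def)
  have "W i \<in> C" if "i < n" for i using Wi[OF that] in_C_equiv Z that by blast
  then show thesis using Wi W(2) by (intro that[of W]) auto
qed

lemma product_elem_sub:
  assumes Z: "\<forall>i<n. Z i \<in> C" and F: "\<forall>i<n. elem_sub L (F i) (Z i)"
  shows "elem_sub L (product F) (product Z)"
proof -
  let ?Z = "\<lambda>i. if i < n then Z i else Z 0"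
  have FS: "is_struct L (product F)"
    using F by (intro product_struct(1)) (auto simp: elem_sub_def substruct_def)
  have "\<forall>i<n. elem_sub L (F i) (?Z i)" using F by simp
  then have "elem_sub L (product F) (product ?Z)"
    unfolding clause_elem_sub[OF padded_sequence(1)[OF Z] FS] by blast
  then show ?thesis unfolding padded_sequence(2)[OF Z] .
qed

lemma elem_sub_product:
  assumes Z: "\<forall>i<n. Z i \<in> C" and E: "elem_sub L E (product Z)"
  obtains F where "\<forall>i<n. elem_sub L (F i) (Z i)" "E = product F"
proof -
  let ?Z = "\<lambda>i. if i < n then Z i else Z 0"
  have "elem_sub L E (product ?Z)" unfolding padded_sequence(2)[OF Z] by (rule E)
  moreover have ES: "is_struct L E" using E by (simp add: elem_sub_def substruct_def)
  ultimately obtain F where "\<forall>i<n. elem_sub L (F i) (?Z i)" "E = product F"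
    unfolding clause_elem_sub[OF padded_sequence(1)[OF Z] ES] by blast
  then show thesis using that by simp
qed

text \<open>Clause (iii) decomposes the range of \<open>h\<close> into elementary substructures of the \<open>Z i\<close>, and clause (i)
  matches the \<open>W i\<close> with these up to a permutation.\<close>

lemma product_elementary_map:
  assumes Z: "\<forall>i<n. Z i \<in> C" and W: "\<forall>i<n. W i \<in> C"
    and h: "elementary_map L (product W) (product Z) h"
  obtains \<pi> where "\<pi> permutes {..<n}" "\<forall>i<n. \<exists>g. elementary_map L (W i) (Z (\<pi> i)) g"
proof -
  obtain E where E: "iso L (product W) E" "elem_sub L E (product Z)"
    using elementary_map_range[OF h] by blast
  obtain F where F: "\<forall>i<n. elem_sub L (F i) (Z i)" "E = product F"
    by (rule elem_sub_product[OF Z E(2)]) blast+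
  have "F i \<in> C" if "i < n" for i
    using elem_sub_elementary[OF F(1)[rule_format, OF that]] in_C_equiv[OF Z[rule_format, OF that]]
      elementary_map_Th elementary_map_struct(1) by blast
  then have FC: "\<forall>i<n. F i \<in> C" by blast
  obtain \<pi> where \<pi>: "\<pi> permutes {..<n}" "\<forall>i<n. iso L (W i) (F (\<pi> i))"
    using E(1) product_iso[OF W FC] F(2) by blast
  show thesis
  proof (rule that[OF \<pi>(1)], intro allI impI)
    fix i assume i: "i < n"
    then have \<pi>i: "\<pi> i < n" using permutes_in_image[OF \<pi>(1), of i] by simp
    obtain g where "elementary_map L (W i) (F (\<pi> i)) g" using \<pi>(2) i unfolding iso_iff_elementary by blast
    then show "\<exists>g. elementary_map L (W i) (Z (\<pi> i)) g"
      using elementary_map_comp elem_sub_elementary[OF F(1)[rule_format, OF \<pi>i]] by blast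
  qed
qed

lemma elementary_map_product:
  assumes Z: "\<forall>i<n. Z i \<in> C" and W: "\<forall>i<n. W i \<in> C"
    and h: "\<forall>i<n. \<exists>h. elementary_map L (W i) (Z i) h"
  shows "\<exists>h. elementary_map L (product W) (product Z) h"
proof -
  have "\<forall>i. \<exists>E. i < n \<longrightarrow> iso L (W i) E \<and> elem_sub L E (Z i)"
    using h elementary_map_range by meson
  then obtain F where F: "\<forall>i<n. iso L (W i) (F i) \<and> elem_sub L (F i) (Z i)" by metis
  have "iso L (product W) (product F)" by (rule product_iso_factors[OF W]) (use F in auto)
  then obtain g where "elementary_map L (product W) (product F) g" unfolding iso_iff_elementary by blast
  moreover have "elem_sub L (product F) (product Z)" by (rule product_elem_sub[OF Z]) (use F in auto)
  ultimately show ?thesis using elementary_map_comp elem_sub_elementary by blast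
qed

section \<open>Counting the models of a product\<close>

context
  fixes X :: "nat \<Rightarrow> ('f, 'r, 'u) struct"
  assumes X: "\<forall>i<n. X i \<in> C"
begin

lemma factor_struct: "\<forall>i<n. is_struct L (X i)"
  using X in_C_struct by blast

lemma product_is_struct: "is_struct L (product X)"
  by (rule product_struct(1)[OF factor_struct])

lemma ex_countable_factor_model:
  assumes "j < n"
  shows "\<exists>N :: ('f, 'r, 'u) struct. is_struct L N \<and> countable (univ N) \<and> Th L N = Th L (X j)"
proof -
  obtain N :: "('f, 'r, 'u) struct" where "is_struct L N" "countable (univ N)" "Th L N = Th L (X j)"
    by (rule ex_countable_model[OF L factor_struct[rule_format, OF assms]])
  then show ?thesis by blast
qed

text \<open>By clause (i), the two products have the same multiset of isomorphism types of factors; removing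
  the types of the common factors leaves those of \<open>Y\<close> and \<open>Y'\<close>.\<close>

lemma cancel_factor:
  assumes W: "\<forall>j<n. W j \<in> C" and Y: "Y \<in> C" "Y' \<in> C" and i: "i < n"
    and iso: "iso L (product (W(i := Y))) (product (W(i := Y')))"
  shows "iso L Y Y'"
proof -
  let ?c = "\<lambda>M. iso_rel L `` {M}"
  let ?V = "W(i := Y)" and ?V' = "W(i := Y')"
  have V: "\<forall>j<n. ?V j \<in> C" "\<forall>j<n. ?V' j \<in> C" using W Y by auto
  obtain \<pi> where \<pi>: "\<pi> permutes {..<n}" "\<forall>j<n. iso L (?V j) (?V' (\<pi> j))"
    using product_iso[OF V] iso by blast
  have "image_mset (\<lambda>j. ?c (?V j)) (mset_set {..<n}) = image_mset (\<lambda>j. ?c (?V' (\<pi> j))) (mset_set {..<n})"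
    using \<pi>(2) V(1) iso_class_eq_iff[OF in_C_struct] by (intro image_mset_cong) auto
  also have "\<dots> = image_mset (\<lambda>j. ?c (?V' j)) (image_mset \<pi> (mset_set {..<n}))"
    by (simp add: multiset.map_comp comp_def)
  also have "image_mset \<pi> (mset_set {..<n}) = mset_set {..<n}"
    using permutes_image[OF \<pi>(1)] image_mset_mset_set[OF permutes_inj_on[OF \<pi>(1)]] by simp
  finally have eq: "image_mset (\<lambda>j. ?c (?V j)) (mset_set {..<n}) = image_mset (\<lambda>j. ?c (?V' j)) (mset_set {..<n})" .
  have split: "mset_set {..<n} = add_mset i (mset_set ({..<n} - {i}))"
    using i by (intro mset_set.remove) auto
  have "image_mset (\<lambda>j. ?c (?V j)) (mset_set ({..<n} - {i})) =
      image_mset (\<lambda>j. ?c (?V' j)) (mset_set ({..<n} - {i}))"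
    by (intro image_mset_cong) auto
  then have "?c Y = ?c Y'" using eq unfolding split by simp
  then show ?thesis using iso_class_eq_iff[OF in_C_struct[OF Y(1)]] by simp
qed

text \<open>The injection multiplies a model of the \<open>i\<close>-th theory with fixed countable models of the others.\<close>

lemma iso_types_factor_le:
  assumes i: "i < n"
  shows "|iso_types L (X i)| \<le>o |iso_types L (product X)|"
proof -
  have "\<forall>j. \<exists>N :: ('f, 'r, 'u) struct. j < n \<longrightarrow> is_struct L N \<and> countable (univ N) \<and> Th L N = Th L (X j)"
    using ex_countable_factor_model by meson
  then obtain W :: "nat \<Rightarrow> ('f, 'r, 'u) struct" where
    W: "\<forall>j<n. is_struct L (W j) \<and> countable (univ (W j)) \<and> Th L (W j) = Th L (X j)" by metis
  have WC: "\<forall>j<n. W j \<in> C" using in_C_equiv X W by blast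
  let ?c = "\<lambda>M. iso_rel L `` {M}"
  have "\<forall>c\<in>iso_types L (X i). \<exists>N. N \<in> countable_models L (X i) \<and> c = ?c N"
    unfolding iso_types_eq by blast
  then obtain r where r: "\<And>c. c \<in> iso_types L (X i) \<Longrightarrow> r c \<in> countable_models L (X i) \<and> c = ?c (r c)" by metis
  have rC: "r c \<in> C" "is_struct L (r c)" "countable (univ (r c))" "Th L (r c) = Th L (X i)"
    if "c \<in> iso_types L (X i)" for c
    using r[OF that] in_C_equiv[OF X[rule_format, OF i]] by (auto simp: countable_models_def)
  let ?f = "\<lambda>c. ?c (product (W(i := r c)))"
  have ps: "is_struct L (product (W(i := r c)))" "product (W(i := r c)) \<in> countable_models L (product X)"
    if "c \<in> iso_types L (X i)" for c
  proof -
    have a: "\<forall>j<n. is_struct L ((W(i := r c)) j)" "\<forall>j<n. countable (univ ((W(i := r c)) j))"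
      "\<forall>j<n. Th L ((W(i := r c)) j) = Th L (X j)"
      using W rC[OF that] by auto
    show "is_struct L (product (W(i := r c)))" by (rule product_struct(1)[OF a(1)])
    then show "product (W(i := r c)) \<in> countable_models L (product X)"
      unfolding countable_models_def
      by (intro CollectI conjI product_Th[OF X a(1,3)] product_countable[OF a(1,2)])
  qed
  have "inj_on ?f (iso_types L (X i))"
  proof (rule inj_onI)
    fix c d assume c: "c \<in> iso_types L (X i)" and d: "d \<in> iso_types L (X i)" and "?f c = ?f d"
    then have "iso L (product (W(i := r c))) (product (W(i := r d)))"
      using iso_class_eq_iff[OF ps(1)[OF c]] by simp
    then have "iso L (r c) (r d)" using cancel_factor[OF WC rC(1)[OF c] rC(1)[OF d] i] by blast
    then have "?c (r c) = ?c (r d)" using iso_class_eq_iff[OF rC(2)[OF c]] by simp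
    then show "c = d" using r[OF c] r[OF d] by simp
  qed
  moreover have "?f ` iso_types L (X i) \<subseteq> iso_types L (product X)"
    using ps(2) unfolding iso_types_eq[of L "product X"] by blast
  ultimately show ?thesis unfolding card_of_ordLeq[symmetric] by blast
qed

text \<open>The injection takes a model to the isomorphism types of the factors of one of its decompositions.\<close>

lemma iso_types_product_le:
  "|iso_types L (product X)| \<le>o |\<Pi>\<^sub>E i\<in>{..<n}. iso_types L (X i)|"
proof -
  let ?c = "\<lambda>M. iso_rel L `` {M}"
  have "\<exists>N W. c = ?c N \<and> is_struct L N \<and> iso L N (product W) \<and>
      (\<forall>i<n. W i \<in> C \<and> W i \<in> countable_models L (X i))"
    if c: "c \<in> iso_types L (product X)" for c
  proof -
    obtain N where N: "N \<in> countable_models L (product X)" "c = ?c N" by (rule iso_types_rep[OF c])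
    then have Ns: "is_struct L N" "Th L N = Th L (product X)" by (auto simp: countable_models_def)
    obtain W where W: "\<forall>i<n. is_struct L (W i)" "\<forall>i<n. Th L (W i) = Th L (X i)"
      "\<forall>i<n. W i \<in> C" "iso L N (product W)"
      by (rule product_models[OF X Ns]) blast+
    have "|univ (product W)| \<le>o |univ N|" using iso_card[OF W(4)] ordIso_iff_ordLeq by blast
    then have "countable (univ (product W))"
      using N(1) ordLeq_transitive unfolding countable_models_def countable_card_le_natLeq by blast
    then have "countable (univ (W i))" if "i < n" for i by (rule product_factor_countable[OF W(1) _ that])
    then show ?thesis
      using N(2) Ns(1) W by (intro exI[of _ N] exI[of _ W]) (auto simp: countable_models_def)
  qed
  then obtain N W where NW: "\<And>c. c \<in> iso_types L (product X) \<Longrightarrow>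
      c = ?c (N c) \<and> is_struct L (N c) \<and> iso L (N c) (product (W c)) \<and>
      (\<forall>i<n. W c i \<in> C \<and> W c i \<in> countable_models L (X i))" by metis
  let ?f = "\<lambda>c. \<lambda>i\<in>{..<n}. ?c (W c i)"
  have "inj_on ?f (iso_types L (product X))"
  proof (rule inj_onI)
    fix c d assume c: "c \<in> iso_types L (product X)" and d: "d \<in> iso_types L (product X)" and eq: "?f c = ?f d"
    have "\<forall>i<n. iso L (W c i) (W d i)"
    proof (intro allI impI)
      fix i assume that: "i < n"
      have "?c (W c i) = ?c (W d i)" using fun_cong[OF eq, of i] that by simp
      moreover have "is_struct L (W c i)" using NW[OF c] that in_C_struct by blast
      ultimately show "iso L (W c i) (W d i)" using iso_class_eq_iff by blast
    qed
    then have WW: "iso L (product (W c)) (product (W d))"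
      using NW[OF c] by (intro product_iso_factors) auto
    have Nc: "iso L (N c) (product (W c))" "is_struct L (N c)" using NW[OF c] by auto
    have "iso L (product (W d)) (N d)" using NW[OF d] iso_sym[of L "N d"] by blast
    then have "iso L (N c) (N d)" by (rule iso_trans[OF iso_trans[OF Nc(1) WW]])
    then have "?c (N c) = ?c (N d)" using iso_class_eq_iff[OF Nc(2)] by simp
    then show "c = d" using NW[OF c] NW[OF d] by simp
  qed
  moreover have "?f ` iso_types L (product X) \<subseteq> (\<Pi>\<^sub>E i\<in>{..<n}. iso_types L (X i))"
    using NW unfolding iso_types_eq by auto
  ultimately show ?thesis unfolding card_of_ordLeq[symmetric] by blast
qed

section \<open>Atomic and saturated models of a product\<close>

text \<open>A countable model of the theory of the product is itself a product of countable models. The factors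
  of the atomic models embed into those, so the product of the atomic models is prime.\<close>

lemma product_isolated_tuples:
  assumes A: "\<forall>i<n. is_struct L (A i) \<and> Th L (A i) = Th L (X i) \<and> countable (univ (A i)) \<and> isolated_tuples L (A i)"
  shows "isolated_tuples L (product A)"
proof (rule prime_isolated_tuples[OF L])
  have AC: "\<forall>i<n. A i \<in> C" using in_C_equiv X A by blast
  show "is_struct L (product A)" by (rule product_struct(1)) (use A in blast)
  fix N :: "('f, 'r, 'u) struct"
  assume N: "is_struct L N" "countable (univ N)" "Th L N = Th L (product A)"
  obtain W where W: "\<forall>i<n. is_struct L (W i)" "\<forall>i<n. Th L (W i) = Th L (A i)"
      "\<forall>i<n. W i \<in> C" "iso L N (product W)"
    by (rule product_models[OF AC N(1,3)]) blast+
  have "|univ (product W)| \<le>o |univ N|" using iso_card[OF W(4)] ordIso_iff_ordLeq by blast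
  then have cW: "countable (univ (product W))"
    using N(2) ordLeq_transitive unfolding countable_card_le_natLeq by blast
  have "\<forall>i<n. \<exists>h. elementary_map L (A i) (W i) h"
  proof (intro allI impI)
    fix i assume i: "i < n"
    have c: "countable (univ (W i))" by (rule product_factor_countable[OF W(1) cW i])
    have a: "is_struct L (A i)" "countable (univ (A i))" "isolated_tuples L (A i)" using A i by auto
    have e: "is_struct L (W i)" "Th L (A i) = Th L (W i)" using W(1,2) i by auto
    show "\<exists>h. elementary_map L (A i) (W i) h" by (rule isolated_tuples_prime[OF a e(1) c e(2)]) blast
  qed
  then obtain h where h: "elementary_map L (product A) (product W) h"
    using elementary_map_product[OF W(3) AC] by blast
  obtain g where "elementary_map L (product W) N g"
    using iso_sym[OF W(4)] unfolding iso_iff_elementary by blast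
  then show "\<exists>h. elementary_map L (product A) N h" using elementary_map_comp[OF h] by blast
qed

text \<open>A countable atomic model of the product theory is isomorphic to some product of \<open>Z i\<close>, and each \<open>Z i\<close> is
  prime: the atomic model embeds into every product of countable models.\<close>

lemma factor_atomic:
  assumes at: "atomic_theory TYPE('u) L (Th L (product X))" and i: "i < n"
  shows "atomic_theory TYPE('u) L (Th L (X i))"
proof -
  obtain P :: "('f, 'r, 'u) struct" where P: "is_struct L P" "countable (univ P)" "Th L P = Th L (product X)" "isolated_tuples L P"
    by (rule atomic_theory_model[OF L product_is_struct at]) blast
  obtain Z where Z: "\<forall>i<n. is_struct L (Z i)" "\<forall>i<n. Th L (Z i) = Th L (X i)"
      "\<forall>i<n. Z i \<in> C" "iso L P (product Z)"
    by (rule product_models[OF X P(1,3)]) blast+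
  have "isolated_tuples L (Z i)"
  proof (rule prime_isolated_tuples[OF L Z(1)[rule_format, OF i]])
    fix Y :: "('f, 'r, 'u) struct"
    assume Y: "is_struct L Y" "countable (univ Y)" "Th L Y = Th L (Z i)"
    \<comment> \<open>the copy of \<open>Y\<close> stands at every index with the same theory, so that it does not matter
      which factor the permutation selects\<close>
    have "\<exists>N :: ('f, 'r, 'u) struct. is_struct L N \<and> countable (univ N) \<and> Th L N = Th L (X j) \<and>
        (Th L (X j) = Th L (X i) \<longrightarrow> N = Y)" if "j < n" for j
    proof (cases "Th L (X j) = Th L (X i)")
      case True
      then show ?thesis using Y Z(2)[rule_format, OF i] by (intro exI[of _ Y]) simp
    next
      case False
      then show ?thesis using ex_countable_factor_model[OF that] by simp
    qed
    then have "\<exists>V. \<forall>j\<in>{..<n}. is_struct L (V j) \<and> countable (univ (V j)) \<and>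
        Th L (V j) = Th L (X j) \<and> (Th L (X j) = Th L (X i) \<longrightarrow> V j = Y)" by (intro bchoice) simp
    then obtain V :: "nat \<Rightarrow> ('f, 'r, 'u) struct" where V: "\<forall>j<n. is_struct L (V j) \<and> countable (univ (V j)) \<and>
        Th L (V j) = Th L (X j) \<and> (Th L (X j) = Th L (X i) \<longrightarrow> V j = Y)"
      unfolding Ball_def lessThan_iff by (rule exE)
    have VC: "\<forall>j<n. V j \<in> C" using in_C_equiv X V by blast
    have VS: "\<forall>j<n. is_struct L (V j)" "\<forall>j<n. countable (univ (V j))" "\<forall>j<n. Th L (V j) = Th L (X j)"
      using V by auto
    have "Th L P = Th L (product V)" using product_Th[OF X VS(1,3)] P(3) by simp
    then obtain h where h: "elementary_map L P (product V) h"
      by (rule isolated_tuples_prime[OF P(1,2,4) product_struct(1)[OF VS(1)] product_countable[OF VS(1,2)]])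
    obtain g where g: "elementary_map L (product Z) P g"
      using iso_sym[OF Z(4)] unfolding iso_iff_elementary by blast
    obtain \<pi> where \<pi>: "\<pi> permutes {..<n}" "\<forall>i<n. \<exists>g. elementary_map L (Z i) (V (\<pi> i)) g"
      by (rule product_elementary_map[OF VC Z(3) elementary_map_comp[OF g h]]) blast+
    have \<pi>i: "\<pi> i < n" using permutes_in_image[OF \<pi>(1), of i] i by simp
    obtain g where g: "elementary_map L (Z i) (V (\<pi> i)) g" using \<pi>(2)[rule_format, OF i] by blast
    have "Th L (X (\<pi> i)) = Th L (X i)"
      using elementary_map_Th[OF g] Z(2)[rule_format, OF i] VS(3)[rule_format, OF \<pi>i] by simp
    then have "V (\<pi> i) = Y" using V[rule_format, OF \<pi>i] by blast
    then show "\<exists>h. elementary_map L (Z i) Y h" using g by blast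
  qed
  then show ?thesis using isolated_tuples_atomic_theory[OF Z(1)[rule_format, OF i]] Z(2)[rule_format, OF i] by simp
qed

text \<open>Decompose a countable saturated model of the product theory into factors \<open>Z i\<close>. Replacing its \<open>i\<close>-th
  factor by any countable model \<open>Y\<close> of the \<open>i\<close>-th theory gives a structure that embeds into it, so that
  \<open>Y\<close> embeds into some \<open>Z j\<close>. Hence all types of the \<open>i\<close>-th theory are realized in finitely many
  countable structures.\<close>

lemma factor_small:
  assumes small: "small_theory TYPE('u) L (Th L (product X))" and i: "i < n"
  shows "small_theory TYPE('u) L (Th L (X i))"
proof -
  obtain S :: "('f, 'r, 'u) struct" where S: "is_struct L S" "countable (univ S)" "Th L S = Th L (product X)" "omega_saturated L S"
    by (rule small_saturated_model[OF L product_is_struct small]) blast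
  obtain Z where Z: "\<forall>i<n. is_struct L (Z i)" "\<forall>i<n. Th L (Z i) = Th L (X i)"
      "\<forall>i<n. Z i \<in> C" "iso L S (product Z)"
    by (rule product_models[OF X S(1,3)]) blast+
  have "|univ (product Z)| \<le>o |univ S|" using iso_card[OF Z(4)] ordIso_iff_ordLeq by blast
  then have cZ: "countable (univ (product Z))"
    using S(2) ordLeq_transitive unfolding countable_card_le_natLeq by blast
  have cZi: "countable (univ (Z j))" if "j < n" for j by (rule product_factor_countable[OF Z(1) cZ that])
  show ?thesis
  proof (rule small_if_types_realized[OF L factor_struct[rule_format, OF i], of "{..<n}" Z])
    show "countable (univ (Z j))" if "j \<in> {..<n}" for j using cZi that by simp
    fix Y :: "('f, 'r, 'u) struct" and k s
    assume Y: "is_struct L Y" "countable (univ Y)" "Th L Y = Th L (X i)" and s: "s \<in> assignments Y"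
    let ?W = "Z(i := Y)"
    have W: "\<forall>j<n. is_struct L (?W j)" "\<forall>j<n. countable (univ (?W j))" "\<forall>j<n. Th L (?W j) = Th L (X j)"
      "\<forall>j<n. ?W j \<in> C"
      using Z(1-3) cZi Y in_C_equiv[OF X[rule_format, OF i], of Y] by auto
    have "Th L (product ?W) = Th L S" by (rule trans[OF product_Th[OF X W(1,3)] S(3)[symmetric]])
    then obtain h where h: "elementary_map L (product ?W) S h"
      by (rule omega_saturated_universal[OF product_struct(1)[OF W(1)] product_countable[OF W(1,2)] S(1,2,4)])
    obtain g where g: "elementary_map L S (product Z) g"
      using Z(4) unfolding iso_iff_elementary by blast
    obtain \<pi> where \<pi>: "\<pi> permutes {..<n}" "\<forall>j<n. \<exists>g. elementary_map L (?W j) (Z (\<pi> j)) g"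
      by (rule product_elementary_map[OF Z(3) W(4) elementary_map_comp[OF h g]]) blast+
    obtain f where "elementary_map L (?W i) (Z (\<pi> i)) f" using \<pi>(2)[rule_format, OF i] by blast
    then have f: "elementary_map L Y (Z (\<pi> i)) f" by simp
    have "tp L Y k s = tp L (Z (\<pi> i)) k (f \<circ> s)"
      unfolding tp_eq_iff using elementary_map_sat[OF f _ s] by (auto simp: formulas_def)
    moreover have "\<pi> i \<in> {..<n}" using permutes_in_image[OF \<pi>(1), of i] i by simp
    ultimately show "\<exists>j\<in>{..<n}. \<exists>t\<in>assignments (Z j). tp L Y k s = tp L (Z j) k t"
      using elementary_map_assignment[OF f s] by blast
  qed simp
qed

lemma product_omega_saturated:
  assumes perf_s: "Perf_s L box C"
    and S: "\<forall>i<n. is_struct L (S i) \<and> Th L (S i) = Th L (X i) \<and> omega_saturated L (S i)"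
  shows "omega_saturated L (product S)"
proof -
  obtain \<kappa> :: "'u set rel" where \<kappa>: "Card_order \<kappa>" "\<And>A :: 'u set. |A| <o \<kappa> \<longleftrightarrow> finite A"
    using ex_finiteness_cardinal by blast
  have SC: "\<forall>i<n. S i \<in> C" using in_C_equiv X S by blast
  have "\<forall>i<n. saturated L \<kappa> (S i)"
    using saturated_iff_omega_saturated[OF L _ \<kappa>(2)] S by blast
  then have "saturated L \<kappa> (product S)"
    using perf_s n \<kappa>(1) SC unfolding Perf_s_def product_def by blast
  then show ?thesis
    using saturated_iff_omega_saturated[OF L product_struct(1) \<kappa>(2), of S] S by blast
qed

end

end

section \<open>Vaught's conjecture and products\<close>

lemma finite_product_not_one:
  assumes "\<not> |\<Pi>\<^sub>E i\<in>{..<n::nat}. A i| =o cone"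
  shows "\<exists>i<n. \<not> |A i| =o cone"
proof (rule ccontr)
  assume "\<not> ?thesis"
  then have "\<forall>i\<in>{..<n}. \<exists>a. A i = {a}" unfolding card_one by blast
  then obtain a where "\<And>i. i \<in> {..<n} \<Longrightarrow> A i = {a i}" by metis
  then have "(\<Pi>\<^sub>E i\<in>{..<n}. A i) = (\<Pi>\<^sub>E i\<in>{..<n}. {restrict a {..<n} i})" by (intro PiE_cong) simp
  also have "\<dots> = {restrict a {..<n}}" by (rule PiE_singleton[OF restrict_extensional])
  finally show False using assms card_one by blast
qed

lemma ordIso_cong: "r =o r' \<Longrightarrow> r =o s \<longleftrightarrow> r' =o s"
  using ordIso_transitive ordIso_symmetric by meson

theorem theorem3p1:
  fixes L :: "('f, 'r) lang"
    and box :: "('f, 'r, 'u) struct list \<Rightarrow> ('f, 'r, 'u) struct"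
    and C :: "('f, 'r, 'u) struct set"
    and n :: nat
    and X :: "nat \<Rightarrow> ('f, 'r, 'u) struct"
  defines "T \<equiv> Th L (box (map X [0..<n]))"
    and "Ti \<equiv> (\<lambda>i. Th L (X i))"
    and "I \<equiv> num_models TYPE('u) L"
  defines "\<kappa> \<equiv> Cprod {..<n} (\<lambda>i. I (Ti i))"
  assumes "countable_lang L"
    and "Perf L box C"
    and "n \<ge> 1"
    and "\<forall>i<n. X i \<in> C"
  shows
    "((\<forall>i<n. I (Ti i) \<le>o I T) \<and> I T \<le>o \<kappa> \<and>
        (I T =o cone \<longleftrightarrow> (\<forall>i<n. I (Ti i) =o cone)))
     \<and>
     ((\<forall>i<n. vaught TYPE('u) L (Ti i)) \<longrightarrow>
        vaught TYPE('u) L T \<and>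
        (if \<kappa> =o cone \<or> \<kappa> =o natLeq \<or> \<kappa> =o ctwo ^c natLeq then I T =o \<kappa>
         else |{..<3::nat}| \<le>o I T \<and> I T <o natLeq))
     \<and>
     ((atomic_theory TYPE('u) L T \<longleftrightarrow> (\<forall>i<n. atomic_theory TYPE('u) L (Ti i))) \<and>
      (atomic_theory TYPE('u) L T \<longrightarrow>
         (\<forall>i<n. \<exists>A :: ('f, 'r, 'u) struct. countable_atomic_model L (Ti i) A) \<and>
         (\<forall>A :: nat \<Rightarrow> ('f, 'r, 'u) struct.
            (\<forall>i<n. countable_atomic_model L (Ti i) (A i)) \<longrightarrow>
            countable_atomic_model L T (box (map A [0..<n])))))
     \<and>
     (Perf_s L box C \<longrightarrow>
        (small_theory TYPE('u) L T \<longleftrightarrow> (\<forall>i<n. small_theory TYPE('u) L (Ti i))) \<and>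
        (small_theory TYPE('u) L T \<longrightarrow>
           (\<forall>i<n. \<exists>S :: ('f, 'r, 'u) struct. countably_saturated_model L (Ti i) S) \<and>
           (\<forall>S :: nat \<Rightarrow> ('f, 'r, 'u) struct.
              (\<forall>i<n. countably_saturated_model L (Ti i) (S i)) \<longrightarrow>
              countably_saturated_model L T (box (map S [0..<n])))))"
proof -
  interpret perfect_pair L box C n using assms by unfold_locales
  have X: "\<forall>i<n. X i \<in> C" by fact
  let ?K = "\<lambda>i. iso_types L (X i)"
  let ?\<Pi> = "\<Pi>\<^sub>E i\<in>{..<n}. ?K i"
  let ?KT = "iso_types L (product X)"
  have T: "T = Th L (product X)" by (simp add: T_def product_def)
  have XS: "is_struct L (X i)" if "i < n" for i using factor_struct[OF X] that by blast
  have PS: "is_struct L (product X)" by (rule product_is_struct[OF X])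
  have I: "I (Ti i) =o |?K i|" if "i < n" for i
    unfolding I_def Ti_def by (rule num_models_iso_types[OF L XS[OF that]])
  have IT: "I T =o |?KT|" unfolding I_def T by (rule num_models_iso_types[OF L PS])
  have Ico: "Card_order (I S)" for S
    unfolding I_def num_models_def by (simp add: card_of_Card_order)
  have FI: "|Field (I (Ti i))| =o |?K i|" if "i < n" for i
    by (rule ordIso_transitive[OF card_of_Field_ordIso[OF Ico] I[OF that]])
  have \<kappa>: "\<kappa> =o |?\<Pi>|"
    unfolding \<kappa>_def Cprod_def ordIso_iff_ordLeq
    using FI by (intro conjI PiE_ordLeq_mono) (auto simp: ordIso_iff_ordLeq)
  have ne: "?K i \<noteq> {}" if "i < n" for i by (rule iso_types_nonempty[OF L XS[OF that]])
  have neT: "?KT \<noteq> {}" by (rule iso_types_nonempty[OF L PS])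
  have low: "|?K i| \<le>o |?KT|" if "i < n" for i by (rule iso_types_factor_le[OF X that])
  have up: "|?KT| \<le>o |?\<Pi>|" by (rule iso_types_product_le[OF X])
  have fac: "|?K i| \<le>o |?\<Pi>|" if "i < n" for i by (rule factor_ordLeq_PiE) (use that ne in auto)
  have one: "cone \<le>o |?K i|" if "i < n" for i unfolding cone_def by (rule card_of_singl_ordLeq[OF ne[OF that]])
  have oneT: "cone \<le>o |?KT|" unfolding cone_def by (rule card_of_singl_ordLeq[OF neT])
  have a1: "I (Ti i) \<le>o I T" if "i < n" for i
    using ordIso_ordLeq_trans[OF I[OF that] ordLeq_ordIso_trans[OF low[OF that] ordIso_symmetric[OF IT]]] .
  have a2: "I T \<le>o \<kappa>"
    using ordIso_ordLeq_trans[OF IT ordLeq_ordIso_trans[OF up ordIso_symmetric[OF \<kappa>]]] .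
  have oneK: "|?KT| =o cone \<longleftrightarrow> (\<forall>i<n. |?K i| =o cone)"
  proof
    assume e: "|?KT| =o cone"
    show "\<forall>i<n. |?K i| =o cone"
    proof (intro allI impI)
      fix i assume i: "i < n"
      have "|?K i| \<le>o cone" by (rule ordLeq_ordIso_trans[OF low[OF i] e])
      then show "|?K i| =o cone" using one[OF i] by (simp add: ordIso_iff_ordLeq)
    qed
  next
    assume "\<forall>i<n. |?K i| =o cone"
    then have "|?\<Pi>| =o cone" using finite_product_not_one[of n ?K] by blast
    then have "|?KT| \<le>o cone" by (rule ordLeq_ordIso_trans[OF up])
    then show "|?KT| =o cone" using oneT by (simp add: ordIso_iff_ordLeq)
  qed
  have a3: "I T =o cone \<longleftrightarrow> (\<forall>i<n. I (Ti i) =o cone)"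
  proof -
    have "I (Ti i) =o cone \<longleftrightarrow> |?K i| =o cone" if "i < n" for i by (rule ordIso_cong[OF I[OF that]])
    then show ?thesis unfolding ordIso_cong[OF IT] oneK by blast
  qed
  have b: "vaught TYPE('u) L T \<and>
      (if \<kappa> =o cone \<or> \<kappa> =o natLeq \<or> \<kappa> =o ctwo ^c natLeq then I T =o \<kappa>
       else |{..<3::nat}| \<le>o I T \<and> I T <o natLeq)"
    if v: "\<forall>i<n. vaught TYPE('u) L (Ti i)"
  proof -
    let ?c = "ctwo ^c natLeq"
    have nc: "natLeq <o ?c" by (rule ordLess_ctwo_cexp[OF natLeq_Card_order])
    have cinf: "Card_order ?c" "infinite (Field ?c)"
      using Cinfinite_cexp[OF ordLeq_refl[OF Card_order_ctwo] natLeq_Cinfinite] by (auto simp: cinfinite_def)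
    have vK: "|?K i| \<le>o natLeq \<or> |?K i| =o ?c" if "i < n" for i
      using v that I[OF that] ordIso_ordLeq_trans[OF ordIso_symmetric[OF I[OF that]]] ordIso_cong[OF I[OF that]]
      unfolding vaught_def I_def[symmetric] by blast
    have vT: "vaught TYPE('u) L T" if "|?KT| \<le>o natLeq \<or> |?KT| =o ?c"
      using that ordIso_ordLeq_trans[OF IT] ordIso_cong[OF IT] unfolding vaught_def I_def[symmetric] by blast
    have sandwich: "I T =o \<kappa>" if "|?\<Pi>| \<le>o |?KT|"
    proof -
      have "|?KT| =o |?\<Pi>|" using that up by (simp add: ordIso_iff_ordLeq)
      then show ?thesis using IT \<kappa> ordIso_transitive ordIso_symmetric by meson
    qed
    show ?thesis
    proof (cases "\<exists>i<n. |?K i| =o ?c")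
      case True
      \<comment> \<open>one factor of size continuum determines the product, and \<open>I T\<close> by the lower bound\<close>
      then obtain i where i: "i < n" "|?K i| =o ?c" by blast
      have "|?K j| \<le>o ?c" if "j < n" for j
        using vK[OF that] ordLeq_ordLess_trans[OF _ nc] ordLess_imp_ordLeq ordIso_imp_ordLeq by blast
      then have \<Pi>c: "|?\<Pi>| \<le>o ?c" by (rule PiE_ordLeq[OF cinf])
      have cT: "?c \<le>o |?KT|" by (rule ordIso_ordLeq_trans[OF ordIso_symmetric[OF i(2)] low[OF i(1)]])
      have "I T =o \<kappa>" by (rule sandwich[OF ordLeq_transitive[OF \<Pi>c cT]])
      moreover have "|?KT| =o ?c" using cT ordLeq_transitive[OF up \<Pi>c] by (simp add: ordIso_iff_ordLeq)
      moreover have "\<kappa> =o ?c"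
        unfolding ordIso_cong[OF \<kappa>] using \<Pi>c ordLeq_transitive[OF cT up] by (simp add: ordIso_iff_ordLeq)
      ultimately show ?thesis using vT by simp
    next
      case False
      then have Kle: "|?K i| \<le>o natLeq" if "i < n" for i using vK that by blast
      have \<Pi>le: "|?\<Pi>| \<le>o natLeq"
        using Kle by (intro PiE_ordLeq natLeq_Card_order) (auto simp: Field_natLeq)
      have KTle: "|?KT| \<le>o natLeq" by (rule ordLeq_transitive[OF up \<Pi>le])
      show ?thesis
      proof (cases "finite ?\<Pi>")
        case True
        have "|?KT| <o natLeq"
          using ordLeq_ordLess_trans[OF up] True by (simp add: finite_iff_ordLess_natLeq)
        then have lt: "I T <o natLeq" by (rule ordIso_ordLess_trans[OF IT])
        show ?thesis
        proof (cases "|?\<Pi>| =o cone")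
          case True
          then have "I T =o \<kappa>" using ordIso_ordLeq_trans[OF _ oneT] sandwich by blast
          moreover have "\<kappa> =o cone" using True ordIso_cong[OF \<kappa>] by blast
          ultimately show ?thesis using vT KTle by simp
        next
          case False
          then obtain i where i: "i < n" "\<not> |?K i| =o cone" using finite_product_not_one[of n ?K] by blast
          \<comment> \<open>Vaught's theorem for the \<open>i\<close>-th factor, and the lower bound\<close>
          have "|{..<3::nat}| \<le>o I T"
            using three_iso_types[OF L XS[OF i(1)] i(2)] low[OF i(1)] ordIso_symmetric[OF IT]
              ordLeq_transitive ordLeq_ordIso_trans by meson
          moreover have "|?\<Pi>| <o natLeq" using True by (simp add: finite_iff_ordLess_natLeq)
          then have "\<not> |?\<Pi>| =o natLeq" "\<not> |?\<Pi>| =o ?c"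
            using nc not_ordLess_ordIso ordLess_transitive by blast+
          then have "\<not> (\<kappa> =o cone \<or> \<kappa> =o natLeq \<or> \<kappa> =o ?c)"
            unfolding ordIso_cong[OF \<kappa>] using False by blast
          ultimately show ?thesis using lt vT KTle by simp
        qed
      next
        case inf: False
        then obtain i where i: "i < n" "infinite (?K i)" using finite_PiE[of "{..<n}" ?K] by auto
        \<comment> \<open>an infinite factor gives \<open>I T\<close> at least \<open>\<omega>\<close>, the value of the product\<close>
        have "natLeq \<le>o |?K i|" using i(2) infinite_iff_natLeq_ordLeq by blast
        then have nT: "natLeq \<le>o |?KT|" using low[OF i(1)] ordLeq_transitive by blast
        have "I T =o \<kappa>" by (rule sandwich[OF ordLeq_transitive[OF \<Pi>le nT]])
        moreover have "\<kappa> =o natLeq"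
          unfolding ordIso_cong[OF \<kappa>] using \<Pi>le ordLeq_transitive[OF nT up] by (simp add: ordIso_iff_ordLeq)
        ultimately show ?thesis using vT KTle by simp
      qed
    qed
  qed
  have atomic_prod: "countable_atomic_model L T (product A)"
    if A: "\<forall>i<n. countable_atomic_model L (Ti i) (A i)" for A :: "nat \<Rightarrow> ('f, 'r, 'u) struct"
  proof -
    have A': "\<forall>i<n. is_struct L (A i) \<and> Th L (A i) = Th L (X i) \<and> countable (univ (A i)) \<and> isolated_tuples L (A i)"
      using A XS unfolding Ti_def by (simp add: countable_atomic_model_iff)
    then have A1: "\<forall>i<n. is_struct L (A i)" "\<forall>i<n. Th L (A i) = Th L (X i)" "\<forall>i<n. countable (univ (A i))" by auto
    show ?thesis
      unfolding T countable_atomic_model_iff[OF PS]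
      by (intro conjI product_struct(1)[OF A1(1)] product_Th[OF X A1(1,2)] product_countable[OF A1(1,3)]
          product_isolated_tuples[OF X A'])
  qed
  have ex_at: "\<exists>A :: ('f, 'r, 'u) struct. countable_atomic_model L (Ti i) A"
    if at: "atomic_theory TYPE('u) L (Ti i)" and i: "i < n" for i
  proof -
    obtain A :: "('f, 'r, 'u) struct" where "is_struct L A" "countable (univ A)" "Th L A = Th L (X i)" "isolated_tuples L A"
      by (rule atomic_theory_model[OF L XS[OF i] at[unfolded Ti_def]])
    then show ?thesis unfolding Ti_def countable_atomic_model_iff[OF XS[OF i]] by blast
  qed
  have c1: "atomic_theory TYPE('u) L T \<longleftrightarrow> (\<forall>i<n. atomic_theory TYPE('u) L (Ti i))"
  proof
    assume "atomic_theory TYPE('u) L T"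
    then show "\<forall>i<n. atomic_theory TYPE('u) L (Ti i)" unfolding T Ti_def using factor_atomic[OF X] by blast
  next
    assume "\<forall>i<n. atomic_theory TYPE('u) L (Ti i)"
    then have "\<forall>i\<in>{..<n}. \<exists>A :: ('f, 'r, 'u) struct. countable_atomic_model L (Ti i) A" using ex_at by simp
    from bchoice[OF this] obtain A :: "nat \<Rightarrow> ('f, 'r, 'u) struct" where
      "\<forall>i<n. countable_atomic_model L (Ti i) (A i)" unfolding Ball_def lessThan_iff by (rule exE)
    then have "countable_atomic_model L T (product A)" by (rule atomic_prod)
    then show "atomic_theory TYPE('u) L T"
      unfolding T countable_atomic_model_iff[OF PS] using isolated_tuples_atomic_theory by metis
  qed
  have d: "(small_theory TYPE('u) L T \<longleftrightarrow> (\<forall>i<n. small_theory TYPE('u) L (Ti i))) \<and>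
        (small_theory TYPE('u) L T \<longrightarrow>
           (\<forall>i<n. \<exists>S :: ('f, 'r, 'u) struct. countably_saturated_model L (Ti i) S) \<and>
           (\<forall>S :: nat \<Rightarrow> ('f, 'r, 'u) struct.
              (\<forall>i<n. countably_saturated_model L (Ti i) (S i)) \<longrightarrow>
              countably_saturated_model L T (product S)))"
    if ps: "Perf_s L box C"
  proof -
    have prod: "countably_saturated_model L T (product S)"
      if S: "\<forall>i<n. countably_saturated_model L (Ti i) (S i)" for S :: "nat \<Rightarrow> ('f, 'r, 'u) struct"
    proof -
      have S': "\<forall>i<n. is_struct L (S i) \<and> Th L (S i) = Th L (X i) \<and> countable (univ (S i)) \<and> omega_saturated L (S i)"
        using S XS unfolding Ti_def by (simp add: countably_saturated_model_iff[OF L])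
      then have S1: "\<forall>i<n. is_struct L (S i)" "\<forall>i<n. Th L (S i) = Th L (X i)" "\<forall>i<n. countable (univ (S i))"
        "\<forall>i<n. is_struct L (S i) \<and> Th L (S i) = Th L (X i) \<and> omega_saturated L (S i)" by auto
      show ?thesis
        unfolding T countably_saturated_model_iff[OF L PS]
        by (intro conjI product_struct(1)[OF S1(1)] product_Th[OF X S1(1,2)] product_countable[OF S1(1,3)]
            product_omega_saturated[OF X ps S1(4)])
    qed
    have ex: "\<exists>S :: ('f, 'r, 'u) struct. countably_saturated_model L (Ti i) S"
      if small: "small_theory TYPE('u) L (Ti i)" and i: "i < n" for i
    proof -
      obtain S :: "('f, 'r, 'u) struct" where "is_struct L S" "countable (univ S)" "Th L S = Th L (X i)" "omega_saturated L S"
        by (rule small_saturated_model[OF L XS[OF i] small[unfolded Ti_def]])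
      then show ?thesis unfolding Ti_def countably_saturated_model_iff[OF L XS[OF i]] by blast
    qed
    have "small_theory TYPE('u) L T \<longleftrightarrow> (\<forall>i<n. small_theory TYPE('u) L (Ti i))"
    proof
      assume "small_theory TYPE('u) L T"
      then show "\<forall>i<n. small_theory TYPE('u) L (Ti i)" unfolding T Ti_def using factor_small[OF X] by blast
    next
      assume "\<forall>i<n. small_theory TYPE('u) L (Ti i)"
      then have "\<forall>i\<in>{..<n}. \<exists>S :: ('f, 'r, 'u) struct. countably_saturated_model L (Ti i) S" using ex by simp
      from bchoice[OF this] obtain S :: "nat \<Rightarrow> ('f, 'r, 'u) struct" where
        "\<forall>i<n. countably_saturated_model L (Ti i) (S i)" unfolding Ball_def lessThan_iff by (rule exE)
      then have "countably_saturated_model L T (product S)" by (rule prod)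
      then show "small_theory TYPE('u) L T"
        unfolding T countably_saturated_model_iff[OF L PS] using omega_saturated_small[OF L] by metis
    qed
    then show ?thesis using ex prod by blast
  qed
  show ?thesis
    unfolding product_def[symmetric]
    using a1 a2 a3 b c1 ex_at atomic_prod d by blast
qed

end
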